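(* Let $K$ be a scattered, locally compact Hausdorff space and consider the Calkin algebra $\mathscr{B}(C_0(K))/\mathscr{K}(C_0(K))$. Then the essential norm $\|\cdot\|_e$ is a minimal algebra norm on this algebra; that is, for every algebra norm $|||\cdot|||$ on $\mathscr{B}(C_0(K))/\mathscr{K}(C_0(K))$ there is a constant $c>0$ such that $c\,\|T\|_e\le |||T+\mathscr{K}(C_0(K))|||$ for all $T\in\mathscr{B}(C_0(K))$. In particular, the Calkin algebra $\mathscr{B}(C_0(K))/\mathscr{K}(C_0(K))$ admits a unique complete algebra norm, i.e. any two complete algebra norms on it are equivalent.
   Context: All spaces and algebras are over a scalar field $\mathbb{K}$ which is either $\mathbb{R}$ or $\mathbb{C}$. $C_0(K)$ is the Banach space of continuous functions $f:K\to\mathbb{K}$ vanishing at infinity (i.e. $\{k\in K:|f(k)|\ge\varepsilon\}$ is compact for all $\varepsilon>0$), with the supremum norm. $\mathscr{B}(X)$ is the algebra of bounded linear operators on a Banach space $X$ and $\mathscr{K}(X)$ is the ideal of compact operators. The essential norm of $T\in\mathscr{B}(X)$ is $\|T\|_e=\inf\{\|T-S\|:S\in\mathscr{K}(X)\}$, i.e. the quotient norm of $T+\mathscr{K}(X)$. An algebra norm on an algebra $\mathcal{A}$ is a vector space norm on $\mathcal{A}$ that is submultiplicative ($|||ab|||\le|||a|||\,|||b|||$); it is not assumed complete unless so stated. *)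

theory Defs
  imports "HOL-Analysis.Analysis"
begin

section \<open>The scalar field\<close>

text \<open>
  A type of this class is a copy of the real or of the complex numbers, with the usual absolute
  value; \<^term>\<open>\<phi>\<close> identifies it with the corresponding subfield of the complex numbers.
  The superclass \<^class>\<open>heine_borel\<close> follows from the axiom and is included only
  for convenience.
\<close>

class real_or_complex = real_normed_field + heine_borel +
  assumes real_or_complex: "\<exists>\<phi> :: 'a \<Rightarrow> complex.
    (\<forall>x y. \<phi> (x + y) = \<phi> x + \<phi> y) \<and> (\<forall>x y. \<phi> (x * y) = \<phi> x * \<phi> y) \<and>
    (\<forall>x. norm (\<phi> x) = norm x) \<and> (range \<phi> = \<real> \<or> range \<phi> = UNIV)"

instance real :: real_or_complex
proof
  show "\<exists>\<phi> :: real \<Rightarrow> complex.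
    (\<forall>x y. \<phi> (x + y) = \<phi> x + \<phi> y) \<and> (\<forall>x y. \<phi> (x * y) = \<phi> x * \<phi> y) \<and>
    (\<forall>x. norm (\<phi> x) = norm x) \<and> (range \<phi> = \<real> \<or> range \<phi> = UNIV)"
    by (rule exI[of _ of_real]) (auto simp: Reals_def)
qed

instance complex :: real_or_complex
proof
  show "\<exists>\<phi> :: complex \<Rightarrow> complex.
    (\<forall>x y. \<phi> (x + y) = \<phi> x + \<phi> y) \<and> (\<forall>x y. \<phi> (x * y) = \<phi> x * \<phi> y) \<and>
    (\<forall>x. norm (\<phi> x) = norm x) \<and> (range \<phi> = \<real> \<or> range \<phi> = UNIV)"
    by (rule exI[of _ "\<lambda>x. x"]) auto
qed


section \<open>Scattered spaces\<close>

definition scattered :: "'a::topological_space set \<Rightarrow> bool" where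
  "scattered S \<longleftrightarrow> (\<forall>A. A \<subseteq> S \<and> A \<noteq> {} \<longrightarrow> (\<exists>x. x isolated_in A))"


section \<open>Continuous functions vanishing at infinity\<close>

lemma compact_superlevel_add:
  fixes f g :: "'a::topological_space \<Rightarrow> 'b::real_normed_vector"
  assumes f: "continuous_on UNIV f" "\<forall>e>0. compact {x. e \<le> norm (f x)}"
    and g: "continuous_on UNIV g" "\<forall>e>0. compact {x. e \<le> norm (g x)}"
  shows "\<forall>e>0. compact {x. e \<le> norm (f x + g x)}"
proof safe
  fix e :: real assume "e > 0"
  then have "compact ({x. e/2 \<le> norm (f x)} \<union> {x. e/2 \<le> norm (g x)})"
    using f(2) g(2) by (intro compact_Un) (metis half_gt_zero)+
  moreover have "closed {x. e \<le> norm (f x + g x)}"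
    by (intro closed_Collect_le continuous_intros f g)
  ultimately have "compact (({x. e/2 \<le> norm (f x)} \<union> {x. e/2 \<le> norm (g x)})
      \<inter> {x. e \<le> norm (f x + g x)})"
    by (rule compact_Int_closed)
  moreover have "({x. e/2 \<le> norm (f x)} \<union> {x. e/2 \<le> norm (g x)})
      \<inter> {x. e \<le> norm (f x + g x)} = {x. e \<le> norm (f x + g x)}"
    proof -
    have "e/2 \<le> norm (f x) \<or> e/2 \<le> norm (g x)" if "e \<le> norm (f x + g x)" for x
      using norm_triangle_ineq[of "f x" "g x"] that by linarith
    then show ?thesis by auto
  qed
  ultimately show "compact {x. e \<le> norm (f x + g x)}" by simp
qed

lemma compact_superlevel_scale:
  fixes f g :: "'a::topological_space \<Rightarrow> 'b::real_normed_vector"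
  assumes "\<forall>e>0. compact {x. e \<le> norm (f x)}" and g: "\<And>x. norm (g x) = r * norm (f x)" and "r \<ge> 0"
  shows "\<forall>e>0. compact {x. e \<le> norm (g x)}"
proof safe
  fix e :: real assume "e > 0"
  show "compact {x. e \<le> norm (g x)}"
  proof (cases "r = 0")
    case True
    then show ?thesis using \<open>e > 0\<close> by (simp add: g)
  next
    case False
    then have "{x. e \<le> norm (g x)} = {x. e / r \<le> norm (f x)}" "e / r > 0"
      using \<open>r \<ge> 0\<close> \<open>e > 0\<close> by (auto simp: g field_simps)
    then show ?thesis using assms(1) by simp
  qed
qed

typedef (overloaded) ('a, 'k) c0 =
  "{f :: 'a::topological_space \<Rightarrow> 'k::real_normed_field.
      continuous_on UNIV f \<and> (\<forall>e>0. compact {x. e \<le> norm (f x)})}"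
  morphisms c0_apply Abs_c0
  by (rule exI[of _ "\<lambda>_. 0"]) simp

setup_lifting type_definition_c0

lemma c0_eqI: "(\<And>x. c0_apply f x = c0_apply g x) \<Longrightarrow> f = g"
  by transfer auto

lemma continuous_on_c0_apply: "continuous_on UNIV (c0_apply f)"
  by transfer auto

lemma compact_c0_superlevel: "e > 0 \<Longrightarrow> compact {x. e \<le> norm (c0_apply f x)}"
  by transfer auto

lemma bdd_above_c0: "bdd_above (range (\<lambda>x. norm (c0_apply f x)))"
proof -
  have "compact (c0_apply f ` {x. 1 \<le> norm (c0_apply f x)})"
    by (intro compact_continuous_image compact_c0_superlevel continuous_on_subset[OF continuous_on_c0_apply]) auto
  then have "bounded (c0_apply f ` {x. 1 \<le> norm (c0_apply f x)})"
    by (rule compact_imp_bounded)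
  then obtain B where B: "\<And>x. 1 \<le> norm (c0_apply f x) \<Longrightarrow> norm (c0_apply f x) \<le> B"
    by (auto simp: bounded_iff)
  have "norm (c0_apply f x) \<le> max 1 B" for x
    using B[of x] by linarith
  then show ?thesis by (auto simp: bdd_above_def)
qed

instantiation c0 :: (topological_space, real_normed_field) real_vector
begin

lift_definition zero_c0 :: "('a, 'b) c0" is "\<lambda>_. 0"
  by simp

lift_definition plus_c0 :: "('a, 'b) c0 \<Rightarrow> ('a, 'b) c0 \<Rightarrow> ('a, 'b) c0" is "\<lambda>f g x. f x + g x"
  subgoal for f g
    using compact_superlevel_add[of f g] by (simp add: continuous_on_add)
  done

lift_definition uminus_c0 :: "('a, 'b) c0 \<Rightarrow> ('a, 'b) c0" is "\<lambda>f x. - f x"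
  by (auto intro: continuous_on_minus)

lift_definition scaleR_c0 :: "real \<Rightarrow> ('a, 'b) c0 \<Rightarrow> ('a, 'b) c0" is "\<lambda>r f x. r *\<^sub>R f x"
  subgoal for r f
    using compact_superlevel_scale[of f "\<lambda>x. r *\<^sub>R f x" "\<bar>r\<bar>"] by (auto intro!: continuous_intros)
  done

definition minus_c0 :: "('a, 'b) c0 \<Rightarrow> ('a, 'b) c0 \<Rightarrow> ('a, 'b) c0" where
  "minus_c0 f g = f + (- g)"

lemmas c0_apply_simps [simp] =
  zero_c0.rep_eq plus_c0.rep_eq uminus_c0.rep_eq scaleR_c0.rep_eq

instance
  by standard (auto intro!: c0_eqI simp: minus_c0_def algebra_simps)

end

lemma c0_apply_minus [simp]: "c0_apply (f - g) x = c0_apply f x - c0_apply g x"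
  by (simp only: minus_c0_def plus_c0.rep_eq uminus_c0.rep_eq diff_conv_add_uminus)

lift_definition c0_scale ::
  "'k \<Rightarrow> ('a::topological_space, 'k::real_normed_field) c0 \<Rightarrow> ('a, 'k) c0" is "\<lambda>c f x. c * f x"
  subgoal for c f
    using compact_superlevel_scale[of f "\<lambda>x. c * f x" "norm c"]
    by (auto intro!: continuous_intros simp: norm_mult)
  done

declare c0_scale.rep_eq [simp]

instantiation c0 :: (topological_space, real_normed_field) real_normed_vector
begin

definition norm_c0 :: "('a, 'b) c0 \<Rightarrow> real" where
  "norm_c0 f = (SUP x. norm (c0_apply f x))"

definition dist_c0 :: "('a, 'b) c0 \<Rightarrow> ('a, 'b) c0 \<Rightarrow> real" where
  "dist_c0 f g = norm (f - g)"

definition sgn_c0 :: "('a, 'b) c0 \<Rightarrow> ('a, 'b) c0" where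
  "sgn_c0 f = f /\<^sub>R norm f"

definition uniformity_c0 :: "(('a, 'b) c0 \<times> ('a, 'b) c0) filter" where
  "uniformity_c0 = (INF e\<in>{0 <..}. principal {(x, y). dist x y < e})"

definition open_c0 :: "('a, 'b) c0 set \<Rightarrow> bool" where
  "open_c0 S = (\<forall>x\<in>S. \<forall>\<^sub>F (x', y) in uniformity. x' = x \<longrightarrow> y \<in> S)"

lemma norm_c0_apply_le: "norm (c0_apply f x) \<le> norm f"
  unfolding norm_c0_def by (rule cSUP_upper[OF _ bdd_above_c0]) simp

lemma norm_c0_le: "(\<And>x. norm (c0_apply f x) \<le> b) \<Longrightarrow> norm f \<le> b"
  unfolding norm_c0_def by (rule cSUP_least) auto

instance
proof
  fix f g :: "('a, 'b) c0" and a :: real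
  have nonneg: "0 \<le> norm f" for f :: "('a, 'b) c0"
    using norm_c0_apply_le[of f undefined] norm_ge_zero order_trans by blast
  show "norm f = 0 \<longleftrightarrow> f = 0"
  proof
    assume "norm f = 0"
    then show "f = 0"
      using norm_c0_apply_le[of f] by (intro c0_eqI) simp
  qed (simp add: norm_c0_def)
  show "norm (f + g) \<le> norm f + norm g"
    by (intro norm_c0_le) (simp add: norm_triangle_le add_mono norm_c0_apply_le)
  have le: "norm (a *\<^sub>R f) \<le> \<bar>a\<bar> * norm f" for a and f :: "('a, 'b) c0"
    by (intro norm_c0_le) (simp add: mult_left_mono norm_c0_apply_le)
  show "norm (a *\<^sub>R f) = \<bar>a\<bar> * norm f"
  proof (cases "a = 0")
    case True
    then show ?thesis using le[of a f] nonneg[of "a *\<^sub>R f"] by simp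
  next
    case False
    have "norm f \<le> \<bar>inverse a\<bar> * norm (a *\<^sub>R f)"
      using le[of "inverse a" "a *\<^sub>R f"] False by simp
    then have "\<bar>a\<bar> * norm f \<le> norm (a *\<^sub>R f)"
      using False by (simp add: field_simps)
    then show ?thesis using le[of a f] by simp
  qed
qed (auto simp: dist_c0_def sgn_c0_def uniformity_c0_def open_c0_def)

end

lemma norm_c0_scale: "norm (c0_scale c f) = norm c * norm f"
proof -
  have le: "norm (c0_scale c f) \<le> norm c * norm f" for c and f :: "('a, 'b) c0"
    by (intro norm_c0_le) (simp add: norm_mult mult_left_mono norm_c0_apply_le)
  show ?thesis
  proof (cases "c = 0")
    case True
    then show ?thesis using le[of c f] by simp
  next
    case False
    have "c0_scale (inverse c) (c0_scale c f) = f"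
      using False by (intro c0_eqI) simp
    then have "norm f \<le> norm (inverse c) * norm (c0_scale c f)"
      using le[of "inverse c" "c0_scale c f"] by simp
    then have "norm c * norm f \<le> norm (c0_scale c f)"
      using False by (simp add: norm_inverse norm_divide field_simps)
    then show ?thesis using le[of c f] by simp
  qed
qed

instance c0 :: (topological_space, real_or_complex) banach
proof
  fix F :: "nat \<Rightarrow> ('a, 'b) c0"
  assume "Cauchy F"
  have "\<exists>g. uniform_limit UNIV (\<lambda>n. c0_apply (F n)) g sequentially"
  proof -
    have "\<exists>N. \<forall>n m x. N \<le> n \<and> N \<le> m \<longrightarrow> dist (c0_apply (F n) x) (c0_apply (F m) x) < e"
      if "e > 0" for e
    proof -
      obtain N where N: "\<And>n m. N \<le> n \<Longrightarrow> N \<le> m \<Longrightarrow> norm (F n - F m) < e"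
        using \<open>Cauchy F\<close> \<open>e > 0\<close> unfolding Cauchy_def dist_norm by metis
      have "dist (c0_apply (F n) x) (c0_apply (F m) x) < e" if "N \<le> n" "N \<le> m" for n m x
        using N[OF that] norm_c0_apply_le[of "F n - F m" x] by (simp add: dist_norm)
      then show ?thesis by blast
    qed
    then show ?thesis
      using uniformly_convergent_eq_cauchy[of "\<lambda>_. True" "\<lambda>n. c0_apply (F n)"]
      unfolding uniform_limit_sequentially_iff by simp
  qed
  then obtain g where g: "uniform_limit UNIV (\<lambda>n. c0_apply (F n)) g sequentially" by blast
  have cont: "continuous_on UNIV g"
    by (rule uniform_limit_theorem[OF _ g]) (simp_all add: continuous_on_c0_apply)
  have "compact {x. e \<le> norm (g x)}" if "e > 0" for e
  proof -
    have "e / 2 > 0" using that by simp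
    then obtain n where n: "\<And>x. dist (c0_apply (F n) x) (g x) < e / 2"
      using g unfolding uniform_limit_sequentially_iff by (metis UNIV_I order_refl)
    have "closed {x. e \<le> norm (g x)}"
      by (intro closed_Collect_le continuous_intros cont)
    then have "compact ({x. e / 2 \<le> norm (c0_apply (F n) x)} \<inter> {x. e \<le> norm (g x)})"
      using compact_c0_superlevel[OF \<open>e / 2 > 0\<close>] by (intro compact_Int_closed)
    moreover have "e / 2 \<le> norm (c0_apply (F n) x)" if "e \<le> norm (g x)" for x
      using n[of x] that norm_triangle_ineq2[of "g x" "c0_apply (F n) x"]
      by (simp add: dist_norm norm_minus_commute)
    then have "{x. e / 2 \<le> norm (c0_apply (F n) x)} \<inter> {x. e \<le> norm (g x)} = {x. e \<le> norm (g x)}"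
      by auto
    ultimately show ?thesis by simp
  qed
  then obtain G where G: "c0_apply G = g"
    using cont Abs_c0_inverse[of g] by blast
  have "F \<longlonglongrightarrow> G"
  proof (rule metric_LIMSEQ_I)
    fix e :: real assume "e > 0"
    then have "e / 2 > 0" by simp
    then obtain N where N: "\<And>n x. N \<le> n \<Longrightarrow> dist (c0_apply (F n) x) (g x) < e / 2"
      using g unfolding uniform_limit_sequentially_iff by (metis UNIV_I)
    have "norm (F n - G) \<le> e / 2" if "N \<le> n" for n
      using N[OF that] by (intro norm_c0_le) (simp add: G dist_norm less_imp_le)
    then have "dist (F n) G < e" if "N \<le> n" for n
      using that \<open>e / 2 > 0\<close> by (fastforce simp: dist_norm)
    then show "\<exists>N. \<forall>n\<ge>N. dist (F n) G < e" by blast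
  qed
  then show "convergent F" by (rule convergentI)
qed


lifting_update c0.lifting
lifting_forget c0.lifting


section \<open>The algebra of bounded linear operators\<close>

text \<open>
  The library type of bounded linear maps is linear over the reals only, so linearity over the
  scalar field \<^typ>\<open>'k\<close> has to be imposed.
\<close>

typedef (overloaded) ('a, 'k) c0_op =
  "{T :: ('a::topological_space, 'k::real_normed_field) c0 \<Rightarrow>\<^sub>L ('a, 'k) c0.
      \<forall>c f. blinfun_apply T (c0_scale c f) = c0_scale c (blinfun_apply T f)}"
  morphisms c0_op_blinfun Abs_c0_op
  by (rule exI[of _ id_blinfun]) simp

setup_lifting type_definition_c0_op

lemma c0_scale_algebra:
  "c0_scale c (f + g) = c0_scale c f + c0_scale c g"
  "c0_scale c (f - g) = c0_scale c f - c0_scale c g"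
  "c0_scale c (- f) = - c0_scale c f"
  "c0_scale c (r *\<^sub>R f) = r *\<^sub>R c0_scale c f"
  "c0_scale c 0 = 0"
  "c0_scale (c + d) f = c0_scale c f + c0_scale d f"
  "c0_scale c (c0_scale d f) = c0_scale (c * d) f"
  "c0_scale 1 f = f"
  by (auto intro!: c0_eqI simp: algebra_simps)

instantiation c0_op :: (topological_space, real_normed_field) real_normed_algebra
begin

lift_definition zero_c0_op :: "('a, 'b) c0_op" is 0
  by (simp add: c0_scale_algebra)

lift_definition plus_c0_op :: "('a, 'b) c0_op \<Rightarrow> ('a, 'b) c0_op \<Rightarrow> ('a, 'b) c0_op" is "(+)"
  by (simp add: c0_scale_algebra blinfun.add_left)

lift_definition minus_c0_op :: "('a, 'b) c0_op \<Rightarrow> ('a, 'b) c0_op \<Rightarrow> ('a, 'b) c0_op" is "(-)"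
  by (simp add: c0_scale_algebra blinfun.diff_left)

lift_definition uminus_c0_op :: "('a, 'b) c0_op \<Rightarrow> ('a, 'b) c0_op" is uminus
  by (simp add: c0_scale_algebra blinfun.minus_left)

lift_definition scaleR_c0_op :: "real \<Rightarrow> ('a, 'b) c0_op \<Rightarrow> ('a, 'b) c0_op" is "(*\<^sub>R)"
  by (simp add: c0_scale_algebra blinfun.scaleR_left)

lift_definition times_c0_op :: "('a, 'b) c0_op \<Rightarrow> ('a, 'b) c0_op \<Rightarrow> ('a, 'b) c0_op" is "(o\<^sub>L)"
  by simp

lift_definition norm_c0_op :: "('a, 'b) c0_op \<Rightarrow> real" is norm .

definition dist_c0_op :: "('a, 'b) c0_op \<Rightarrow> ('a, 'b) c0_op \<Rightarrow> real" where
  "dist_c0_op S T = norm (S - T)"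

definition sgn_c0_op :: "('a, 'b) c0_op \<Rightarrow> ('a, 'b) c0_op" where
  "sgn_c0_op T = inverse (norm T) *\<^sub>R T"

definition uniformity_c0_op :: "(('a, 'b) c0_op \<times> ('a, 'b) c0_op) filter" where
  "uniformity_c0_op = (INF e\<in>{0 <..}. principal {(x, y). dist x y < e})"

definition open_c0_op :: "('a, 'b) c0_op set \<Rightarrow> bool" where
  "open_c0_op S = (\<forall>x\<in>S. \<forall>\<^sub>F (x', y) in uniformity. x' = x \<longrightarrow> y \<in> S)"

instance
proof
  fix S T U :: "('a, 'b) c0_op" and a b :: real
  show "S + T + U = S + (T + U)" by transfer simp
  show "S + T = T + S" by transfer simp
  show "0 + S = S" by transfer simp
  show "- S + S = 0" by transfer simp
  show "S - T = S + - T" by transfer simp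
  show "a *\<^sub>R (S + T) = a *\<^sub>R S + a *\<^sub>R T" by transfer (simp add: scaleR_add_right)
  show "(a + b) *\<^sub>R S = a *\<^sub>R S + b *\<^sub>R S" by transfer (simp add: scaleR_add_left)
  show "a *\<^sub>R b *\<^sub>R S = (a * b) *\<^sub>R S" by transfer simp
  show "1 *\<^sub>R S = S" by transfer simp
  show "S * T * U = S * (T * U)" by transfer (auto intro: blinfun_eqI)
  show "(S + T) * U = S * U + T * U" by transfer (auto intro: blinfun_eqI simp: blinfun.bilinear_simps)
  show "S * (T + U) = S * T + S * U" by transfer (auto intro: blinfun_eqI simp: blinfun.bilinear_simps)
  show "a *\<^sub>R S * T = a *\<^sub>R (S * T)" by transfer (auto intro: blinfun_eqI simp: blinfun.bilinear_simps)
  show "S * a *\<^sub>R T = a *\<^sub>R (S * T)" by transfer (auto intro: blinfun_eqI simp: blinfun.bilinear_simps)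
  show "norm S = 0 \<longleftrightarrow> S = 0" by transfer simp
  show "norm (S + T) \<le> norm S + norm T" by transfer (rule norm_triangle_ineq)
  show "norm (a *\<^sub>R S) = \<bar>a\<bar> * norm S" by transfer simp
  show "norm (S * T) \<le> norm S * norm T" by transfer (rule norm_blinfun_compose)
qed (auto simp: dist_c0_op_def sgn_c0_op_def uniformity_c0_op_def open_c0_op_def)

end

lift_definition c0_op_apply ::
  "('a::topological_space, 'k::real_normed_field) c0_op \<Rightarrow> ('a, 'k) c0 \<Rightarrow> ('a, 'k) c0"
  is blinfun_apply .

lemma bounded_linear_c0_scale_blinfun:
  fixes T :: "('a::topological_space, 'k::real_normed_field) c0 \<Rightarrow>\<^sub>L ('a, 'k) c0"
  shows "bounded_linear (\<lambda>f. c0_scale c (blinfun_apply T f))"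
proof (rule bounded_linear_intro)
  show "norm (c0_scale c (blinfun_apply T f)) \<le> norm f * (norm c * norm T)" for f
    using mult_left_mono[OF norm_blinfun[of T f], of "norm c"]
    by (simp add: norm_c0_scale mult_ac)
qed (simp_all add: blinfun.bilinear_simps c0_scale_algebra)

lift_definition c0_op_scale ::
  "'k \<Rightarrow> ('a::topological_space, 'k::real_normed_field) c0_op \<Rightarrow> ('a, 'k) c0_op"
  is "\<lambda>c T. Blinfun (\<lambda>f. c0_scale c (blinfun_apply T f))"
  by (simp add: bounded_linear_Blinfun_apply[OF bounded_linear_c0_scale_blinfun]
      c0_scale_algebra mult.commute)

lemma c0_op_eqI: "(\<And>f. c0_op_apply S f = c0_op_apply T f) \<Longrightarrow> S = T"
  by transfer (rule blinfun_eqI)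

lemma c0_op_apply_simps [simp]:
  "c0_op_apply 0 f = 0"
  "c0_op_apply (S + T) f = c0_op_apply S f + c0_op_apply T f"
  "c0_op_apply (S - T) f = c0_op_apply S f - c0_op_apply T f"
  "c0_op_apply (- S) f = - c0_op_apply S f"
  "c0_op_apply (r *\<^sub>R S) f = r *\<^sub>R c0_op_apply S f"
  "c0_op_apply (S * T) f = c0_op_apply S (c0_op_apply T f)"
  by (transfer; simp add: blinfun.bilinear_simps)+

lemma c0_op_apply_scale [simp]: "c0_op_apply (c0_op_scale c T) f = c0_scale c (c0_op_apply T f)"
  by (simp add: c0_op_apply.rep_eq c0_op_scale.rep_eq
      bounded_linear_Blinfun_apply[OF bounded_linear_c0_scale_blinfun])

lemma bounded_linear_c0_op_apply: "bounded_linear (c0_op_apply T)"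
  by (simp add: c0_op_apply.rep_eq blinfun.bounded_linear_right)


section \<open>Compact operators and the essential norm\<close>

definition compact_op :: "('a::topological_space, 'k::real_normed_field) c0_op \<Rightarrow> bool" where
  "compact_op T \<longleftrightarrow> compact (closure (c0_op_apply T ` cball 0 1))"

definition essential_norm :: "('a::topological_space, 'k::real_normed_field) c0_op \<Rightarrow> real" where
  "essential_norm T = Inf {norm (T - S) | S. compact_op S}"

lemma compact_opI:
  assumes "compact C" "c0_op_apply T ` cball 0 1 \<subseteq> C"
  shows "compact_op T"
proof -
  have "closure (c0_op_apply T ` cball 0 1) \<subseteq> C"
    using assms by (intro closure_minimal compact_imp_closed)
  then show ?thesis
    unfolding compact_op_def using assms(1) by (metis closed_closure compact_Int_closed inf.absorb2)
qed

lemma compact_op_0 [simp]: "compact_op 0"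
  by (rule compact_opI[of "{0}"]) auto

lemma compact_op_add:
  assumes "compact_op S" "compact_op T"
  shows "compact_op (S + T)"
proof (rule compact_opI)
  let ?A = "closure (c0_op_apply S ` cball 0 1)" and ?B = "closure (c0_op_apply T ` cball 0 1)"
  show "compact {x + y | x y. x \<in> ?A \<and> y \<in> ?B}"
    by (rule compact_sums; use assms in \<open>simp add: compact_op_def\<close>)
  show "c0_op_apply (S + T) ` cball 0 1 \<subseteq> {x + y | x y. x \<in> ?A \<and> y \<in> ?B}"
  proof (rule image_subsetI)
    fix f :: "('a, 'b) c0" assume "f \<in> cball 0 1"
    then have "c0_op_apply S f \<in> ?A" "c0_op_apply T f \<in> ?B"
      by (auto intro!: closure_subset[THEN subsetD] imageI)
    moreover have "c0_op_apply (S + T) f = c0_op_apply S f + c0_op_apply T f"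
      by simp
    ultimately show "c0_op_apply (S + T) f \<in> {x + y | x y. x \<in> ?A \<and> y \<in> ?B}"
      unfolding mem_Collect_eq by (intro exI conjI)
  qed
qed

lemma compact_op_mult_left:
  assumes "compact_op T"
  shows "compact_op (S * T)"
proof (rule compact_opI)
  show "compact (c0_op_apply S ` closure (c0_op_apply T ` cball 0 1))"
    using assms unfolding compact_op_def
    by (intro compact_continuous_image linear_continuous_on bounded_linear_c0_op_apply)
  have "c0_op_apply (S * T) ` cball 0 1 = c0_op_apply S ` c0_op_apply T ` cball 0 1"
    by (simp add: image_image)
  also have "\<dots> \<subseteq> c0_op_apply S ` closure (c0_op_apply T ` cball 0 1)"
    by (intro image_mono closure_subset)
  finally show "c0_op_apply (S * T) ` cball 0 1 \<subseteq> c0_op_apply S ` closure (c0_op_apply T ` cball 0 1)" .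
qed

lemma compact_op_mult_right:
  assumes "compact_op S"
  shows "compact_op (S * T)"
proof -
  obtain B where B: "B > 0" "\<And>f. norm (c0_op_apply T f) \<le> norm f * B"
    using bounded_linear.pos_bounded[OF bounded_linear_c0_op_apply] by blast
  let ?C = "(\<lambda>g. B *\<^sub>R g) ` closure (c0_op_apply S ` cball 0 1)"
  have C: "compact ?C"
    using assms unfolding compact_op_def by (rule compact_scaling)
  show ?thesis
  proof (rule compact_opI[OF C], safe)
    fix f :: "('a, 'b) c0" assume "f \<in> cball 0 1"
    then have f: "norm f \<le> 1" by simp
    have "norm (c0_op_apply T f) \<le> B"
      using B(2)[of f] mult_right_mono[OF f, of B] B(1) by linarith
    then have "inverse B *\<^sub>R c0_op_apply T f \<in> cball 0 1"
      using B(1) by (simp add: field_simps)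
    then have "c0_op_apply S (inverse B *\<^sub>R c0_op_apply T f) \<in> closure (c0_op_apply S ` cball 0 1)"
      by (intro closure_subset[THEN subsetD] imageI)
    moreover have "c0_op_apply (S * T) f = B *\<^sub>R c0_op_apply S (inverse B *\<^sub>R c0_op_apply T f)"
      using B(1) by (simp add: linear_simps[OF bounded_linear_c0_op_apply])
    ultimately show "c0_op_apply (S * T) f \<in> ?C" by blast
  qed
qed

lift_definition c0_op_id :: "('a::topological_space, 'k::real_normed_field) c0_op" is id_blinfun
  by simp

lemma c0_op_apply_id [simp]: "c0_op_apply c0_op_id f = f"
  by transfer simp

lemma compact_op_scale: "compact_op T \<Longrightarrow> compact_op (c0_op_scale c T)"
proof -
  assume "compact_op T"
  moreover have "c0_op_scale c T = c0_op_scale c c0_op_id * T"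
    by (rule c0_op_eqI) simp
  ultimately show ?thesis by (simp add: compact_op_mult_left)
qed

lemma compact_op_uminus: "compact_op T \<Longrightarrow> compact_op (- T)"
proof -
  assume "compact_op T"
  moreover have "- T = (- c0_op_id) * T"
    by (rule c0_op_eqI) simp
  ultimately show ?thesis by (metis compact_op_mult_left)
qed

lemma compact_op_diff: "compact_op S \<Longrightarrow> compact_op T \<Longrightarrow> compact_op (S - T)"
  using compact_op_add[of S "- T"] compact_op_uminus by auto


section \<open>The Calkin algebra\<close>

quotient_type (overloaded) ('a, 'k) calkin =
  "('a::topological_space, 'k::real_normed_field) c0_op" / "\<lambda>S T. compact_op (S - T)"
  morphisms rep_calkin to_calkin
proof (rule equivpI)
  show "reflp (\<lambda>S T :: ('a, 'k) c0_op. compact_op (S - T))"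
    by (simp add: reflp_def)
  show "symp (\<lambda>S T :: ('a, 'k) c0_op. compact_op (S - T))"
  proof (rule sympI)
    fix S T :: "('a, 'k) c0_op"
    assume "compact_op (S - T)"
    then show "compact_op (T - S)"
      using compact_op_uminus[of "S - T"] by simp
  qed
  show "transp (\<lambda>S T :: ('a, 'k) c0_op. compact_op (S - T))"
  proof (rule transpI)
    fix S T U :: "('a, 'k) c0_op"
    assume "compact_op (S - T)" "compact_op (T - U)"
    then show "compact_op (S - U)"
      using compact_op_add[of "S - T" "T - U"] by simp
  qed
qed

instantiation calkin :: (topological_space, real_normed_field) ring
begin

lift_definition zero_calkin :: "('a, 'b) calkin" is 0 .

lift_definition plus_calkin :: "('a, 'b) calkin \<Rightarrow> ('a, 'b) calkin \<Rightarrow> ('a, 'b) calkin" is "(+)"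
  subgoal for S S' T T'
    using compact_op_add[of "S - S'" "T - T'"] by (simp add: algebra_simps)
  done

lift_definition minus_calkin :: "('a, 'b) calkin \<Rightarrow> ('a, 'b) calkin \<Rightarrow> ('a, 'b) calkin" is "(-)"
  subgoal for S S' T T'
    using compact_op_diff[of "S - S'" "T - T'"] by (simp add: algebra_simps)
  done

lift_definition uminus_calkin :: "('a, 'b) calkin \<Rightarrow> ('a, 'b) calkin" is uminus
  subgoal for S T
    using compact_op_uminus[of "S - T"] by simp
  done

lift_definition times_calkin :: "('a, 'b) calkin \<Rightarrow> ('a, 'b) calkin \<Rightarrow> ('a, 'b) calkin" is "(*)"
proof -
  fix S S' T T' :: "('a, 'b) c0_op"
  assume "compact_op (S - S')" "compact_op (T - T')"
  then have "compact_op (S * (T - T') + (S - S') * T')"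
    by (intro compact_op_add compact_op_mult_left compact_op_mult_right)
  then show "compact_op (S * T - S' * T')" by (simp add: algebra_simps)
qed

instance
  by standard (transfer; simp add: algebra_simps)+

end

lift_definition calkin_scale ::
  "'k \<Rightarrow> ('a::topological_space, 'k::real_normed_field) calkin \<Rightarrow> ('a, 'k) calkin" is c0_op_scale
proof -
  fix c :: 'k and S T :: "('a, 'k) c0_op"
  assume "compact_op (S - T)"
  moreover have "c0_op_scale c S - c0_op_scale c T = c0_op_scale c (S - T)"
    by (rule c0_op_eqI) (simp add: c0_scale_algebra)
  ultimately show "compact_op (c0_op_scale c S - c0_op_scale c T)"
    by (simp add: compact_op_scale)
qed

lift_definition calkin_norm ::
  "('a::topological_space, 'k::real_normed_field) calkin \<Rightarrow> real" is essential_norm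
proof -
  have *: "{norm (S - U) | U. compact_op U} \<subseteq> {norm (T - U) | U. compact_op U}"
    if "compact_op (S - T)" for S T :: "('a, 'k) c0_op"
  proof safe
    fix U :: "('a, 'k) c0_op" assume "compact_op U"
    then have "compact_op (U - (S - T))" using that by (rule compact_op_diff)
    moreover have "norm (S - U) = norm (T - (U - (S - T)))" by simp
    ultimately show "\<exists>V. norm (S - U) = norm (T - V) \<and> compact_op V" by blast
  qed
  fix S T :: "('a, 'k) c0_op"
  assume "compact_op (S - T)"
  moreover from this have "compact_op (T - S)"
    using compact_op_uminus by fastforce
  ultimately show "essential_norm S = essential_norm T"
    unfolding essential_norm_def using *[of S T] *[of T S] by (simp add: subset_antisym)
qed

lemma calkin_norm_to_calkin [simp]: "calkin_norm (to_calkin T) = essential_norm T"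
  by (rule calkin_norm.abs_eq)

lemma to_calkin_eq_iff: "to_calkin S = to_calkin T \<longleftrightarrow> compact_op (S - T)"
  by (rule calkin.abs_eq_iff)

lemma c0_op_scale_algebra:
  "c0_op_scale c (S + T) = c0_op_scale c S + c0_op_scale c T"
  "c0_op_scale (c + d) T = c0_op_scale c T + c0_op_scale d T"
  "c0_op_scale c (c0_op_scale d T) = c0_op_scale (c * d) T"
  "c0_op_scale 1 T = T"
  "c0_op_scale c S * T = c0_op_scale c (S * T)"
  "S * c0_op_scale c T = c0_op_scale c (S * T)"
proof -
  show "S * c0_op_scale c T = c0_op_scale c (S * T)"
  proof (rule c0_op_eqI)
    fix f
    have "c0_op_apply S (c0_scale c g) = c0_scale c (c0_op_apply S g)" for g
      by transfer simp
    then show "c0_op_apply (S * c0_op_scale c T) f = c0_op_apply (c0_op_scale c (S * T)) f"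
      by simp
  qed
qed (rule c0_op_eqI; simp add: c0_scale_algebra)+

lemma vector_space_calkin_scale: "vector_space calkin_scale"
  by standard (transfer; simp add: c0_op_scale_algebra)+

lemma calkin_scale_mult:
  "calkin_scale c x * y = calkin_scale c (x * y)"
  "x * calkin_scale c y = calkin_scale c (x * y)"
  by (transfer; simp add: c0_op_scale_algebra)+


section \<open>Algebra norms\<close>

text \<open>
  Norms are functions rather than type class instances, since several norms on the same algebra
  have to be compared. In \<^term>\<open>algebra_norm smul p\<close> the function \<^term>\<open>smul\<close> is the
  multiplication by scalars, so homogeneity is over the whole scalar field.
\<close>

definition algebra_norm :: "('k::real_normed_field \<Rightarrow> 'b::ring \<Rightarrow> 'b) \<Rightarrow> ('b \<Rightarrow> real) \<Rightarrow> bool" where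
  "algebra_norm smul p \<longleftrightarrow>
     (\<forall>x. 0 \<le> p x) \<and>
     (\<forall>x. p x = 0 \<longleftrightarrow> x = 0) \<and>
     (\<forall>x y. p (x + y) \<le> p x + p y) \<and>
     (\<forall>c x. p (smul c x) = norm c * p x) \<and>
     (\<forall>x y. p (x * y) \<le> p x * p y)"

definition complete_norm :: "('b::ab_group_add \<Rightarrow> real) \<Rightarrow> bool" where
  "complete_norm p \<longleftrightarrow>
     (\<forall>X :: nat \<Rightarrow> 'b. (\<forall>e>0. \<exists>N. \<forall>m\<ge>N. \<forall>n\<ge>N. p (X m - X n) < e) \<longrightarrow>
        (\<exists>x. (\<lambda>n. p (X n - x)) \<longlonglongrightarrow> 0))"

definition equivalent_norms :: "('b \<Rightarrow> real) \<Rightarrow> ('b \<Rightarrow> real) \<Rightarrow> bool" where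
  "equivalent_norms p q \<longleftrightarrow> (\<exists>c>0. \<exists>C>0. \<forall>x. c * p x \<le> q x \<and> q x \<le> C * p x)"

end

theory Submission
  imports Defs
begin

text \<open>
  Let \<open>X\<close> be \<open>C\<^sub>0(K)\<close>, and let \<open>c\<^sub>0\<close> be the space of null sequences, which is
  \<open>C\<^sub>0\<close> of the discrete space of natural numbers.

  The heart of the matter is a quantitative factorization (lemma
  \<open>identity_factors_modulo_compact\<close>): if the essential norm of an operator \<open>T\<close> on \<open>X\<close>
  exceeds 1, there are operators \<open>R\<close> from \<open>c\<^sub>0\<close> to \<open>X\<close> and \<open>S\<close> from \<open>X\<close> to \<open>c\<^sub>0\<close>, of norm at
  most 4 and 2, such that \<open>S T R\<close> is a compact perturbation of the identity of \<open>c\<^sub>0\<close>. Subtracting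
  from \<open>T\<close> its composition with a finite-rank operator that interpolates at the points of a
  finite set \<open>F\<close>, one finds a function \<open>h\<close> in the unit ball which vanishes on \<open>F\<close> and for which
  \<open>T h\<close> is larger than 1/2 at some point \<open>x\<close>. Because \<open>K\<close> is scattered, every bounded functional on
  \<open>X\<close>, in particular the functional taking \<open>f\<close> to \<open>T f\<close> at \<open>x\<close>, is concentrated on a finite set up
  to an arbitrarily small error (\<open>finitely_concentrated_UNIV\<close>); this is the elementary
  content of the theorem that the dual of \<open>X\<close> is an \<open>\<ell>\<^sub>1\<close> space. Hence the
  construction can be iterated, and a gliding hump argument produces functions with pairwise
  disjoint supports which \<open>T\<close> keeps away from zero (\<open>disjoint_bumps\<close>). They span a copy of
  \<open>c\<^sub>0\<close>, whence \<open>R\<close>. The values at the points \<open>x\<close>, corrected by their limit, which exists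
  along a subsequence because \<open>K\<close> is scattered, give \<open>S\<close>. After a further
  subsequence the matrix of \<open>S T R\<close> differs from the identity matrix by a summable error.

  Minimality (\<open>essential_norm_minimal\<close>) follows by an argument in the manner of Eidelheit. An
  algebra norm \<open>p\<close> on the Calkin algebra need not be dominated by the operator norm, so the norms
  of \<open>R\<close> and \<open>S\<close> do not control \<open>p\<close> directly. Instead, suppose that no constant \<open>c\<close> works. Fix
  one factorization, that is, operators \<open>A\<close> from \<open>c\<^sub>0\<close> to \<open>X\<close> and \<open>B\<close> from \<open>X\<close> to \<open>c\<^sub>0\<close> such that
  \<open>B A\<close> is the identity modulo compact operators. Split \<open>c\<^sub>0\<close> into infinitely many copies of
  itself, and let \<open>e\<^sub>n\<close> be \<open>A\<close>, the projection onto the \<open>n\<close>-th copy, and \<open>B\<close> composed. Choose \<open>T\<^sub>n\<close> with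
  essential norm greater than 1 and with \<open>p(T\<^sub>n)\<close> extremely small compared with \<open>1 / p(e\<^sub>n)\<close>, and
  glue the corresponding operators \<open>R\<^sub>n\<close>, \<open>S\<^sub>n\<close>, with weights \<open>2\<^sup>-\<^sup>n\<close>, to single operators
  \<open>R\<close>, \<open>S\<close>. Then \<open>4\<^sup>-\<^sup>n e\<^sub>n = e\<^sub>n (A S) T\<^sub>n (R B) e\<^sub>n\<close> modulo compact operators, and the
  submultiplicativity of \<open>p\<close> gives a contradiction.

  Finally, a complete algebra norm \<open>p\<close> dominates a multiple of the essential norm by minimality.
  It is then countably subadditive on the Banach space of operators, hence bounded by a multiple
  of the operator norm (\<open>countably_subadditive_seminorm_bounded\<close>, a lemma of Zabreiko that
  replaces the open mapping theorem), and therefore by a multiple of the essential norm. So every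
  complete algebra norm is equivalent to the essential norm, which is itself complete.
\<close>

section \<open>Scattered locally compact spaces\<close>

text \<open>
  The hypotheses on the space. The parameter only serves to name the type of its points.
\<close>

locale scattered_lc_space =
  fixes K :: "'a::t2_space itself"
  assumes lc: "locally_compact_space (euclidean :: 'a topology)"
    and scat: "scattered (UNIV :: 'a set)"
begin

lemma nbhd_compact_closure:
  fixes y :: 'a
  assumes "open U" "y \<in> U"
  obtains G where "open G" "y \<in> G" "compact (closure G)" "closure G \<subseteq> U"
proof -
  have "Hausdorff_space (euclidean :: 'a topology)"
    by (simp add: Hausdorff_space_def) (metis hausdorff disjnt_def)
  then have "neighbourhood_base_of (\<lambda>C. compactin (euclidean :: 'a topology) C \<and> closedin euclidean C) euclidean"
    using lc locally_compact_Hausdorff_imp_regular_space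
      locally_compact_regular_space_neighbourhood_base by blast
  then obtain G C where "open G" "compact C" "closed C" "y \<in> G" "G \<subseteq> C" "C \<subseteq> U"
    using assms unfolding neighbourhood_base_of
    by (metis compactin_euclidean_iff open_openin closed_closedin)
  moreover from this have "closure G \<subseteq> C" by (simp add: closure_minimal)
  moreover from this \<open>compact C\<close> have "compact (closure G)"
    by (metis closed_closure compact_Int_closed inf.absorb2)
  ultimately show ?thesis using that by blast
qed

lemma isolated_point:
  assumes "A \<noteq> ({} :: 'a set)"
  obtains y W where "open W" "W \<inter> A = {y}"
proof -
  obtain y where "y isolated_in A" using assms scat unfolding scattered_def by blast
  then show ?thesis using that unfolding isolated_in_def by blast
qed

text \<open>
  A scattered, locally compact Hausdorff space has a base of compact open sets. If \<open>y\<close> is isolated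
  among the points where this fails, and \<open>G\<close> is a small neighbourhood of \<open>y\<close>, then the boundary of
  \<open>G\<close> consists of points where it does not fail; removing from \<open>G\<close> a compact open neighbourhood of
  the boundary leaves a compact open neighbourhood of \<open>y\<close>.
\<close>

lemma compact_open_base:
  fixes y :: 'a
  assumes "open U" "y \<in> U"
  obtains V where "open V" "compact V" "y \<in> V" "V \<subseteq> U"
proof -
  define good where "good y \<longleftrightarrow> (\<forall>U. open U \<and> y \<in> U \<longrightarrow> (\<exists>V. open V \<and> compact V \<and> y \<in> V \<and> V \<subseteq> U))"
    for y :: 'a
  have "{y. \<not> good y} = {}"
  proof (rule ccontr)
    assume "{y. \<not> good y} \<noteq> {}"
    then obtain y W where W: "open W" "W \<inter> {y. \<not> good y} = {y}"
      by (rule isolated_point)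
    have "good y" unfolding good_def
    proof (intro allI impI)
      fix U assume U: "open U \<and> y \<in> U"
      obtain G where G: "open G" "y \<in> G" "compact (closure G)" "closure G \<subseteq> U \<inter> W"
        using nbhd_compact_closure[of "U \<inter> W" y] U W by blast
      let ?B = "closure G - G"
      have "compact ?B" using G by (simp add: compact_diff)
      have "\<exists>V. open V \<and> compact V \<and> z \<in> V \<and> V \<subseteq> - {y}" if "z \<in> ?B" for z
      proof -
        have "z \<in> W" "z \<noteq> y" using that G by auto
        then have "good z" using W by blast
        then show ?thesis using \<open>z \<noteq> y\<close> unfolding good_def by (metis ComplI open_Compl closed_singleton singletonD)
      qed
      then obtain V where V: "\<And>z. z \<in> ?B \<Longrightarrow> open (V z) \<and> compact (V z) \<and> z \<in> V z \<and> V z \<subseteq> - {y}"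
        by metis
      have "?B \<subseteq> (\<Union>z\<in>?B. V z)" using V by blast
      then obtain D where D: "D \<subseteq> ?B" "finite D" "?B \<subseteq> (\<Union>z\<in>D. V z)"
        using compactE_image[OF \<open>compact ?B\<close>, of ?B V] V by blast
      let ?Q = "\<Union>z\<in>D. V z"
      have "open ?Q" "compact ?Q" "y \<notin> ?Q"
        using D V by auto
      then have cl: "closed ?Q" by (simp add: compact_imp_closed)
      have eq: "G - ?Q = closure G - ?Q" using D(3) closure_subset[of G] by blast
      have "open (G - ?Q)" using G cl by (simp add: open_Diff)
      moreover have "compact (G - ?Q)" unfolding eq using G(3) \<open>open ?Q\<close> by (rule compact_diff)
      moreover have "y \<in> G - ?Q" "G - ?Q \<subseteq> U" using G \<open>y \<notin> ?Q\<close> closure_subset[of G] by blast+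
      ultimately show "\<exists>V. open V \<and> compact V \<and> y \<in> V \<and> V \<subseteq> U" by blast
    qed
    then show False using W by blast
  qed
  then have "good y" by blast
  then show ?thesis using assms that unfolding good_def by blast
qed

lemma compact_open_between:
  fixes C :: "'a set"
  assumes "compact C" "open U" "C \<subseteq> U"
  obtains V where "open V" "compact V" "C \<subseteq> V" "V \<subseteq> U"
proof -
  have "\<exists>V. open V \<and> compact V \<and> z \<in> V \<and> V \<subseteq> U" if "z \<in> C" for z
  proof -
    have "z \<in> U" using assms(3) that by blast
    with assms(2) obtain V where "open V" "compact V" "z \<in> V" "V \<subseteq> U" by (rule compact_open_base)
    then show ?thesis by blast
  qed
  then obtain V where V: "\<And>z. z \<in> C \<Longrightarrow> open (V z) \<and> compact (V z) \<and> z \<in> V z \<and> V z \<subseteq> U"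
    by metis
  have "C \<subseteq> (\<Union>z\<in>C. V z)" using V by blast
  then obtain D where D: "D \<subseteq> C" "finite D" "C \<subseteq> (\<Union>z\<in>D. V z)"
    using compactE_image[OF \<open>compact C\<close>, of C V] V by blast
  show ?thesis
  proof (rule that[of "\<Union>z\<in>D. V z"])
    have "\<forall>z\<in>D. open (V z) \<and> compact (V z)" using D V by blast
    then show "open (\<Union>z\<in>D. V z)" "compact (\<Union>z\<in>D. V z)"
      using D(2) by (auto intro: compact_UN)
  qed (use D V in blast)+
qed

lemma disjoint_compact_open_nbhds:
  assumes "finite (F :: 'a set)"
  obtains W where "\<And>y. y \<in> F \<Longrightarrow> open (W y) \<and> compact (W y) \<and> y \<in> W y"
    "\<And>y z. y \<in> F \<Longrightarrow> z \<in> F \<Longrightarrow> y \<noteq> z \<Longrightarrow> W y \<inter> W z = {}"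
proof -
  have "\<exists>W. (\<forall>y\<in>F. open (W y) \<and> compact (W y) \<and> y \<in> W y) \<and>
      (\<forall>y\<in>F. \<forall>z\<in>F. y \<noteq> z \<longrightarrow> W y \<inter> W z = {})"
    using assms
  proof (induction F)
    case (insert x F)
    from insert.IH obtain W where W: "\<forall>y\<in>F. open (W y) \<and> compact (W y) \<and> y \<in> W y"
      "\<forall>y\<in>F. \<forall>z\<in>F. y \<noteq> z \<longrightarrow> W y \<inter> W z = {}" by (elim exE conjE)
    have "closed F" using insert by (simp add: finite_imp_closed)
    then obtain V where V: "open V" "compact V" "x \<in> V" "V \<subseteq> - F"
      using compact_open_base[of "- F" x] insert by auto
    have "closed V" using V by (simp add: compact_imp_closed)
    show ?case
    proof (intro exI[of _ "\<lambda>y. if y = x then V else W y - V"] conjI ballI impI)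
      fix y assume "y \<in> insert x F"
      then show "open (if y = x then V else W y - V)" "compact (if y = x then V else W y - V)"
        "y \<in> (if y = x then V else W y - V)"
        using V W \<open>closed V\<close> by (auto intro!: compact_diff)
    next
      fix y z assume "y \<in> insert x F" "z \<in> insert x F" "y \<noteq> z"
      then show "(if y = x then V else W y - V) \<inter> (if z = x then V else W z - V) = {}"
        using W(2) by auto
    qed
  qed simp
  then obtain W where "\<forall>y\<in>F. open (W y) \<and> compact (W y) \<and> y \<in> W y"
      "\<forall>y\<in>F. \<forall>z\<in>F. y \<noteq> z \<longrightarrow> W y \<inter> W z = {}" by (elim exE conjE)
  then show ?thesis using that[of W] by simp
qed

text \<open>
  The one-point compactification of the space is sequentially compact: an isolated point of the set
  of cluster points of a sequence is the limit of a subsequence.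
\<close>

lemma convergent_subsequence_or_escaping:
  fixes x :: "nat \<Rightarrow> 'a"
  obtains (limit) y r where "strict_mono r" "(x \<circ> r) \<longlonglongrightarrow> y"
  | (escape) "\<And>C. compact C \<Longrightarrow> \<forall>\<^sub>F n in sequentially. x n \<notin> C"
proof (cases "{y. \<forall>U. open U \<and> y \<in> U \<longrightarrow> infinite {n. x n \<in> U}} = {}")
  case True
  have "\<forall>\<^sub>F n in sequentially. x n \<notin> C" if C: "compact C" for C
  proof -
    obtain U where U: "\<And>y. open (U y) \<and> y \<in> U y \<and> finite {n. x n \<in> U y}"
      using True by simp metis
    obtain D where D: "D \<subseteq> C" "finite D" "C \<subseteq> (\<Union>z\<in>D. U z)"
      using compactE_image[OF C, of C U] U by blast
    have "{n. x n \<in> C} \<subseteq> (\<Union>z\<in>D. {n. x n \<in> U z})" using D by auto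
    then have "finite {n. x n \<in> C}" using D U by (meson finite_UN_I finite_subset)
    then show ?thesis by (simp add: eventually_cofinite flip: cofinite_eq_sequentially)
  qed
  then show ?thesis by (rule escape)
next
  case False
  let ?A = "{y. \<forall>U. open U \<and> y \<in> U \<longrightarrow> infinite {n. x n \<in> U}}"
  obtain y W where W: "open W" "W \<inter> ?A = {y}" using False by (rule isolated_point)
  then obtain V where V: "open V" "compact V" "y \<in> V" "V \<subseteq> W"
    using compact_open_base[of W y] by blast
  have inf: "infinite {n. x n \<in> V}" using V W by blast
  \<comment> \<open>The subsequence visits only \<open>V\<close>, where \<open>y\<close> is the only cluster point.\<close>
  define r where "r = enumerate {n. x n \<in> V}"
  have r: "strict_mono r" "\<And>n. x (r n) \<in> V"
    using enumerate_in_set[OF inf] strict_mono_enumerate[OF inf] unfolding r_def by auto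
  have "(x \<circ> r) \<longlonglongrightarrow> y"
  proof (rule topological_tendstoI)
    fix U assume U: "open U" "y \<in> U"
    have C: "compact (V - U)" using V U by (simp add: compact_diff)
    have "\<exists>G. open G \<and> z \<in> G \<and> finite {n. x n \<in> G}" if "z \<in> V - U" for z
    proof -
      have "z \<in> W" "z \<noteq> y" using that V U by auto
      then have "z \<notin> ?A" using W by blast
      then show ?thesis by auto
    qed
    then obtain G where G: "\<And>z. z \<in> V - U \<Longrightarrow> open (G z) \<and> z \<in> G z \<and> finite {n. x n \<in> G z}"
      by metis
    obtain D where D: "D \<subseteq> V - U" "finite D" "V - U \<subseteq> (\<Union>z\<in>D. G z)"
      using compactE_image[OF C, of "V - U" G] G by blast
    have "{n. x n \<in> V - U} \<subseteq> (\<Union>z\<in>D. {n. x n \<in> G z})" using D by auto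
    moreover have "finite (\<Union>z\<in>D. {n. x n \<in> G z})" using D G by blast
    ultimately have "finite {n. x n \<in> V - U}" by (rule finite_subset)
    then have "\<forall>\<^sub>F n in sequentially. x n \<notin> V - U"
      by (simp add: eventually_cofinite flip: cofinite_eq_sequentially)
    then have "\<forall>\<^sub>F n in sequentially. x (r n) \<notin> V - U"
      by (rule eventually_subseq[OF r(1)])
    then show "\<forall>\<^sub>F n in sequentially. (x \<circ> r) n \<in> U"
      by eventually_elim (use r in auto)
  qed
  then show ?thesis using r limit by blast
qed

end

section \<open>Restrictions to clopen sets\<close>

definition clopen_set :: "'a::topological_space set \<Rightarrow> bool" where
  "clopen_set V \<longleftrightarrow> open V \<and> closed V"

lemma clopen_set_ops:
  "clopen_set V \<Longrightarrow> clopen_set W \<Longrightarrow> clopen_set (V \<union> W)"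
  "clopen_set V \<Longrightarrow> clopen_set W \<Longrightarrow> clopen_set (V \<inter> W)"
  "clopen_set V \<Longrightarrow> clopen_set W \<Longrightarrow> clopen_set (V - W)"
  "clopen_set V \<Longrightarrow> clopen_set (- V)"
  by (auto simp: clopen_set_def intro: open_Diff closed_Diff)

lemma compact_open_clopen: "compact V \<Longrightarrow> open V \<Longrightarrow> clopen_set (V :: 'a::t2_space set)"
  by (simp add: clopen_set_def compact_imp_closed)

text \<open>
  The product of \<open>f\<close> with the indicator function of \<open>V\<close>. It is continuous when \<open>V\<close> is clopen, and
  only then is the definition meaningful.
\<close>

definition restrict_c0 ::
  "'a set \<Rightarrow> ('a::topological_space, 'k::real_normed_field) c0 \<Rightarrow> ('a, 'k) c0" where
  "restrict_c0 V f = Abs_c0 (\<lambda>x. if x \<in> V then c0_apply f x else 0)"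

lemma c0_apply_Abs:
  assumes "continuous_on UNIV g" "\<And>e. e > 0 \<Longrightarrow> compact {x. e \<le> norm (g x)}"
  shows "c0_apply (Abs_c0 g) = g"
  using assms by (intro Abs_c0_inverse) auto

lemma restrict_c0_apply:
  assumes "clopen_set V"
  shows "c0_apply (restrict_c0 V f) x = (if x \<in> V then c0_apply f x else 0)"
proof -
  have "c0_apply (restrict_c0 V f) = (\<lambda>x. if x \<in> V then c0_apply f x else 0)"
    unfolding restrict_c0_def
  proof (rule c0_apply_Abs)
    have "continuous_on (V \<union> - V) (\<lambda>x. if x \<in> V then c0_apply f x else 0)"
    proof (rule continuous_on_If)
      show "closed V" "closed (- V)" using assms by (simp_all add: clopen_set_def closed_Compl)
      show "continuous_on V (c0_apply f)" by (rule continuous_on_subset[OF continuous_on_c0_apply]) simp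
    qed (auto simp del: closed_Compl)
    then show "continuous_on UNIV (\<lambda>x. if x \<in> V then c0_apply f x else 0)" by simp
    fix e :: real assume "e > 0"
    then have "{x. e \<le> norm (if x \<in> V then c0_apply f x else 0)} = {x. e \<le> norm (c0_apply f x)} \<inter> V"
      by auto
    moreover have "compact ({x. e \<le> norm (c0_apply f x)} \<inter> V)"
      using compact_c0_superlevel[OF \<open>e > 0\<close>] assms unfolding clopen_set_def by (intro compact_Int_closed) auto
    ultimately show "compact {x. e \<le> norm (if x \<in> V then c0_apply f x else 0)}" by simp
  qed
  then show ?thesis by simp
qed

lemma norm_restrict_c0_le: "clopen_set V \<Longrightarrow> norm (restrict_c0 V f) \<le> norm f"
  by (rule norm_c0_le) (use norm_c0_apply_le[of f] in \<open>auto simp: restrict_c0_apply\<close>)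

text \<open>
  The indicator function of \<open>V\<close>; it belongs to \<open>C\<^sub>0(K)\<close> when \<open>V\<close> is compact and open, and only then
  is the definition meaningful.
\<close>

definition indicator_c0 :: "'a set \<Rightarrow> ('a::topological_space, 'k::real_normed_field) c0" where
  "indicator_c0 V = Abs_c0 (\<lambda>x. if x \<in> V then 1 else 0)"

lemma indicator_c0_apply:
  fixes V :: "'a::t2_space set"
  assumes "compact V" "open V"
  shows "c0_apply (indicator_c0 V :: ('a, 'k::real_normed_field) c0) x = (if x \<in> V then 1 else 0)"
proof -
  have "c0_apply (indicator_c0 V :: ('a, 'k) c0) = (\<lambda>x. if x \<in> V then 1 else 0)"
    unfolding indicator_c0_def
  proof (rule c0_apply_Abs)
    have "continuous_on (V \<union> - V) (\<lambda>x. if x \<in> V then 1 else 0 :: 'k)"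
    proof (rule continuous_on_If)
      show "closed V" "closed (- V)" using assms by (simp_all add: compact_imp_closed closed_Compl)
    qed simp_all
    then show "continuous_on UNIV (\<lambda>x. if x \<in> V then 1 else 0 :: 'k)" by simp
    fix e :: real assume "e > 0"
    then have "{x. e \<le> norm (if x \<in> V then 1 else 0 :: 'k)} = (if e \<le> 1 then V else {})"
      by auto
    then show "compact {x. e \<le> norm (if x \<in> V then 1 else 0 :: 'k)}" using assms by simp
  qed
  then show ?thesis by simp
qed

lemma norm_c0_less_witness:
  assumes "r < norm f" "0 \<le> r"
  obtains x where "r < norm (c0_apply f x)"
  using norm_c0_le[of f r] assms by (meson not_less)

lemma c0_apply_sum: "c0_apply (sum f A) x = (\<Sum>i\<in>A. c0_apply (f i) x)"
  by (induction A rule: infinite_finite_induct) auto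

text \<open>
  Functions with pairwise disjoint supports behave like the unit vectors of \<open>c\<^sub>0\<close>.
\<close>

lemma norm_disjoint_sum_le:
  fixes g :: "'i \<Rightarrow> ('a::topological_space, 'k::real_normed_field) c0"
  assumes disj: "\<And>i j x. i \<in> A \<Longrightarrow> j \<in> A \<Longrightarrow> i \<noteq> j \<Longrightarrow> c0_apply (g i) x = 0 \<or> c0_apply (g j) x = 0"
    and bound: "\<And>i. i \<in> A \<Longrightarrow> norm (g i) \<le> C" and "0 \<le> C"
  shows "norm (sum g A) \<le> C"
proof (cases "finite A")
  case True
  show ?thesis
  proof (rule norm_c0_le)
    fix x
    show "norm (c0_apply (sum g A) x) \<le> C"
    proof (cases "\<exists>i\<in>A. c0_apply (g i) x \<noteq> 0")
      case nz: True
      then obtain i where i: "i \<in> A" "c0_apply (g i) x \<noteq> 0" by blast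
      have "(\<Sum>j\<in>A. c0_apply (g j) x) = (\<Sum>j\<in>{i}. c0_apply (g j) x)"
        using True i disj by (intro sum.mono_neutral_right) auto
      then have "c0_apply (sum g A) x = c0_apply (g i) x" by (simp add: c0_apply_sum)
      then show ?thesis using bound[OF i(1)] norm_c0_apply_le[of "g i" x] by simp
    next
      case False
      then show ?thesis using \<open>0 \<le> C\<close> by (simp add: c0_apply_sum)
    qed
  qed
qed (use \<open>0 \<le> C\<close> in simp)

section \<open>Bounded functionals\<close>

lemma unit_rotation:
  fixes c :: "'k::real_normed_field"
  obtains u where "norm u = 1" "u * c = of_real (norm c)"
proof (cases "c = 0")
  case True
  then show ?thesis using that[of 1] by simp
next
  case False
  then show ?thesis using that[of "of_real (norm c) / c"] by (simp add: norm_divide)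
qed

text \<open>
  A functional that is linear over the scalar field and bounded by the constant \<open>B\<close>, which need not
  be the optimal one.
\<close>

locale c0_functional =
  fixes \<phi> :: "('a::topological_space, 'k::real_normed_field) c0 \<Rightarrow> 'k" and B :: real
  assumes add: "\<phi> (f + g) = \<phi> f + \<phi> g"
    and scale: "\<phi> (c0_scale c f) = c * \<phi> f"
    and bound: "norm (\<phi> f) \<le> B * norm f"
    and B_nonneg: "0 \<le> B"
begin

lemma zero: "\<phi> 0 = 0"
  using add[of 0 0] by simp

lemma sum: "\<phi> (sum f A) = (\<Sum>i\<in>A. \<phi> (f i))"
  by (induction A rule: infinite_finite_induct) (auto simp: zero add)

lemma minus: "\<phi> (f - g) = \<phi> f - \<phi> g"
  using add[of "f - g" g] by simp

lemma bound': "norm f \<le> C \<Longrightarrow> norm (\<phi> f) \<le> B * C"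
  using bound[of f] B_nonneg by (meson mult_left_mono order_trans)

text \<open>
  Dually, the values of a bounded functional on functions with disjoint supports are absolutely
  summable: rotate the functions so that the values become nonnegative, and add them up.
\<close>

lemma sum_norm_disjoint_le:
  fixes g :: "'i \<Rightarrow> ('a, 'k) c0"
  assumes disj: "\<And>i j x. i \<in> A \<Longrightarrow> j \<in> A \<Longrightarrow> i \<noteq> j \<Longrightarrow> c0_apply (g i) x = 0 \<or> c0_apply (g j) x = 0"
    and bd: "\<And>i. i \<in> A \<Longrightarrow> norm (g i) \<le> C" and "0 \<le> C"
  shows "(\<Sum>i\<in>A. norm (\<phi> (g i))) \<le> B * C"
proof -
  have "\<exists>u. norm u = 1 \<and> u * \<phi> (g i) = of_real (norm (\<phi> (g i)))" for i
    by (metis unit_rotation)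
  then obtain u where u: "\<And>i. norm (u i) = 1" "\<And>i. u i * \<phi> (g i) = of_real (norm (\<phi> (g i)))"
    by metis
  have "norm (\<Sum>i\<in>A. c0_scale (u i) (g i)) \<le> C"
    by (rule norm_disjoint_sum_le) (use disj bd \<open>0 \<le> C\<close> in \<open>auto simp: norm_c0_scale u(1)\<close>)
  then have "norm (\<phi> (\<Sum>i\<in>A. c0_scale (u i) (g i))) \<le> B * C" by (rule bound')
  moreover have "\<phi> (\<Sum>i\<in>A. c0_scale (u i) (g i)) = of_real (\<Sum>i\<in>A. norm (\<phi> (g i)))"
    by (simp add: sum scale u(2))
  moreover have "0 \<le> (\<Sum>i\<in>A. norm (\<phi> (g i)))" by (simp add: sum_nonneg)
  ultimately show ?thesis by (simp del: of_real_sum)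
qed

lemma disjoint_tendsto_0:
  assumes disj: "\<And>i j x. i \<noteq> j \<Longrightarrow> c0_apply (g i) x = 0 \<or> c0_apply (g j) x = 0"
    and bd: "\<And>i::nat. norm (g i) \<le> C" and "0 \<le> C"
  shows "(\<lambda>i. \<phi> (g i)) \<longlonglongrightarrow> 0"
proof -
  have "summable (\<lambda>i. norm (\<phi> (g i)))"
    by (rule summableI_nonneg_bounded[where x = "B * C"])
      (use assms in \<open>auto intro!: sum_norm_disjoint_le\<close>)
  then show ?thesis by (simp add: summable_LIMSEQ_zero tendsto_norm_zero_cancel)
qed

end

lemma restrict_c0_split:
  assumes "clopen_set V" "clopen_set W" "\<And>x. x \<notin> V \<union> W \<Longrightarrow> c0_apply f x = 0"
  shows "f = restrict_c0 V f + restrict_c0 (W - V) f"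
  by (rule c0_eqI) (use assms in \<open>auto simp: restrict_c0_apply clopen_set_ops\<close>)

lemma restrict_c0_split_UNIV:
  assumes "clopen_set V"
  shows "f = restrict_c0 V f + restrict_c0 (- V) f"
  by (rule c0_eqI) (use assms in \<open>auto simp: restrict_c0_apply clopen_set_ops\<close>)

section \<open>Concentration of functionals on finite sets\<close>

context scattered_lc_space
begin

lemma compact_support_approx:
  fixes f :: "('a, 'k::real_normed_field) c0"
  assumes "open U" "\<And>x. x \<notin> U \<Longrightarrow> c0_apply f x = 0" "e > 0"
  obtains W where "open W" "compact W" "W \<subseteq> U" "norm (f - restrict_c0 W f) \<le> e"
proof -
  have "compact {x. e \<le> norm (c0_apply f x)}" using \<open>e > 0\<close> by (rule compact_c0_superlevel)
  moreover have "{x. e \<le> norm (c0_apply f x)} \<subseteq> U" using assms by force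
  ultimately obtain W where W: "open W" "compact W" "{x. e \<le> norm (c0_apply f x)} \<subseteq> W" "W \<subseteq> U"
    using compact_open_between \<open>open U\<close> by blast
  have "norm (c0_apply f x) \<le> e" if "x \<notin> W" for x
  proof (rule ccontr)
    assume "\<not> norm (c0_apply f x) \<le> e"
    then have "x \<in> {x. e \<le> norm (c0_apply f x)}" by simp
    then show False using W(3) that by blast
  qed
  then have "norm (f - restrict_c0 W f) \<le> e"
    by (intro norm_c0_le) (use W \<open>e > 0\<close> in \<open>auto simp: restrict_c0_apply compact_open_clopen\<close>)
  then show ?thesis using W that by blast
qed

end

text \<open>
  In terms of the measure that represents \<open>\<phi>\<close>, this says that within \<open>U\<close> its total variation off
  suitable finite sets is arbitrarily small, so that the measure is purely atomic there.
\<close>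

definition finitely_concentrated ::
  "(('a::topological_space, 'k::real_normed_field) c0 \<Rightarrow> 'k) \<Rightarrow> 'a set \<Rightarrow> bool" where
  "finitely_concentrated \<phi> U \<longleftrightarrow> (\<forall>e>0. \<exists>F. finite F \<and>
     (\<forall>f. norm f \<le> 1 \<and> (\<forall>x. x \<notin> U - F \<longrightarrow> c0_apply f x = 0) \<longrightarrow> norm (\<phi> f) \<le> e))"

lemma finitely_concentratedD:
  assumes "finitely_concentrated \<phi> U" "e > 0"
  obtains F where "finite F" "\<And>f. norm f \<le> 1 \<Longrightarrow> (\<And>x. x \<notin> U - F \<Longrightarrow> c0_apply f x = 0) \<Longrightarrow> norm (\<phi> f) \<le> e"
  using assms unfolding finitely_concentrated_def by meson

lemma finitely_concentrated_mono:
  assumes "finitely_concentrated \<phi> V" "U \<subseteq> V"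
  shows "finitely_concentrated \<phi> U"
  unfolding finitely_concentrated_def
proof (intro allI impI)
  fix e :: real assume "e > 0"
  obtain F where "finite F"
    "\<And>f. norm f \<le> 1 \<Longrightarrow> (\<And>x. x \<notin> V - F \<Longrightarrow> c0_apply f x = 0) \<Longrightarrow> norm (\<phi> f) \<le> e"
    using finitely_concentratedD[OF assms(1) \<open>e > 0\<close>] by blast
  then show "\<exists>F. finite F \<and> (\<forall>f. norm f \<le> 1 \<and> (\<forall>x. x \<notin> U - F \<longrightarrow> c0_apply f x = 0) \<longrightarrow> norm (\<phi> f) \<le> e)"
    using assms(2) by (intro exI[of _ F]) blast
qed

lemma finitely_concentrated_insert:
  assumes "finitely_concentrated \<phi> U"
  shows "finitely_concentrated \<phi> (insert y U)"
  unfolding finitely_concentrated_def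
proof (intro allI impI)
  fix e :: real assume "e > 0"
  obtain F where "finite F"
    "\<And>f. norm f \<le> 1 \<Longrightarrow> (\<And>x. x \<notin> U - F \<Longrightarrow> c0_apply f x = 0) \<Longrightarrow> norm (\<phi> f) \<le> e"
    using finitely_concentratedD[OF assms(1) \<open>e > 0\<close>] by blast
  then show "\<exists>F. finite F \<and> (\<forall>f. norm f \<le> 1 \<and> (\<forall>x. x \<notin> insert y U - F \<longrightarrow> c0_apply f x = 0) \<longrightarrow> norm (\<phi> f) \<le> e)"
    by (intro exI[of _ "insert y F"]) auto
qed

context c0_functional
begin

lemma finitely_concentrated_Un:
  assumes V: "clopen_set V" and W: "clopen_set W"
    and "finitely_concentrated \<phi> V" "finitely_concentrated \<phi> W"
  shows "finitely_concentrated \<phi> (V \<union> W)"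
  unfolding finitely_concentrated_def
proof (intro allI impI)
  fix e :: real assume "e > 0"
  then have e: "e / 2 > 0" by simp
  obtain F where F: "finite F"
    "\<And>f. norm f \<le> 1 \<Longrightarrow> (\<And>x. x \<notin> V - F \<Longrightarrow> c0_apply f x = 0) \<Longrightarrow> norm (\<phi> f) \<le> e / 2"
    using finitely_concentratedD[OF assms(3) e] by blast
  obtain G where G: "finite G"
    "\<And>f. norm f \<le> 1 \<Longrightarrow> (\<And>x. x \<notin> W - G \<Longrightarrow> c0_apply f x = 0) \<Longrightarrow> norm (\<phi> f) \<le> e / 2"
    using finitely_concentratedD[OF assms(4) e] by blast
  have "norm (\<phi> f) \<le> e"
    if f: "norm f \<le> 1" "\<And>x. x \<notin> V \<union> W - (F \<union> G) \<Longrightarrow> c0_apply f x = 0" for f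
  proof -
    have "clopen_set (W - V)" using V W by (rule clopen_set_ops(3)[rotated])
    note ap = restrict_c0_apply[OF V] restrict_c0_apply[OF this]
    have "norm (\<phi> (restrict_c0 V f)) \<le> e / 2"
      using f norm_restrict_c0_le[OF V, of f] by (intro F(2)) (auto simp: ap)
    moreover have "norm (\<phi> (restrict_c0 (W - V) f)) \<le> e / 2"
      using f norm_restrict_c0_le[OF \<open>clopen_set (W - V)\<close>, of f] by (intro G(2)) (auto simp: ap)
    moreover have "f = restrict_c0 V f + restrict_c0 (W - V) f"
      using f V W by (intro restrict_c0_split) auto
    ultimately show ?thesis
      by (metis add field_sum_of_halves norm_triangle_mono)
  qed
  then show "\<exists>F. finite F \<and> (\<forall>f. norm f \<le> 1 \<and> (\<forall>x. x \<notin> V \<union> W - F \<longrightarrow> c0_apply f x = 0) \<longrightarrow> norm (\<phi> f) \<le> e)"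
    using F(1) G(1) by (intro exI[of _ "F \<union> G"]) blast
qed

end

context scattered_lc_space
begin

text \<open>
  Choose \<open>f\<^sub>0\<close> in the unit ball, supported in a compact open subset \<open>V\<close> of \<open>U\<close>, where \<open>\<phi>\<close> almost
  attains its norm over \<open>U\<close>. By additivity on disjoint supports almost nothing is left for \<open>\<phi>\<close>
  outside \<open>V\<close>, and within \<open>V\<close> it is concentrated by assumption.
\<close>

lemma finitely_concentrated_open:
  fixes \<phi> :: "('a, 'k::real_normed_field) c0 \<Rightarrow> 'k"
  assumes "c0_functional \<phi> B" and U: "open U"
    and W: "\<And>W. open W \<Longrightarrow> compact W \<Longrightarrow> W \<subseteq> U \<Longrightarrow> finitely_concentrated \<phi> W"
  shows "finitely_concentrated \<phi> U"
  unfolding finitely_concentrated_def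
proof (intro allI impI)
  interpret c0_functional \<phi> B by fact
  fix e :: real assume "e > 0"
  define d where "d = e / 4"
  have d: "d > 0" using \<open>e > 0\<close> by (simp add: d_def)
  define S where "S = {norm (\<phi> f) |f. norm f \<le> 1 \<and> (\<forall>x. x \<notin> U \<longrightarrow> c0_apply f x = 0)}"
  have "bdd_above S" unfolding S_def using bound'[of _ 1] by (auto simp: bdd_above_def)
  then have S: "norm (\<phi> f) \<le> Sup S" if "norm f \<le> 1" "\<And>x. x \<notin> U \<Longrightarrow> c0_apply f x = 0" for f
    using that by (intro cSup_upper) (auto simp: S_def)
  have "norm (\<phi> 0) \<in> S" unfolding S_def by (auto intro!: exI[of _ 0])
  then obtain s where "s \<in> S" "Sup S - d < s"
    using less_cSupE[of "Sup S - d" S] d by auto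
  then obtain f0 where f0: "norm f0 \<le> 1" "\<And>x. x \<notin> U \<Longrightarrow> c0_apply f0 x = 0" "Sup S - d < norm (\<phi> f0)"
    unfolding S_def by blast
  have "d / (B + 1) > 0" using d B_nonneg by simp
  then obtain V where V: "open V" "compact V" "V \<subseteq> U" "norm (f0 - restrict_c0 V f0) \<le> d / (B + 1)"
    using compact_support_approx[OF U f0(2), of "d / (B + 1)"] by blast
  note clV = compact_open_clopen[OF V(2,1)]
  let ?f1 = "restrict_c0 V f0"
  have "norm (\<phi> (f0 - ?f1)) \<le> B * (d / (B + 1))" using V(4) by (rule bound')
  also have "\<dots> \<le> d" using B_nonneg d by (simp add: field_simps)
  finally have f1: "Sup S - 2 * d < norm (\<phi> ?f1)"
    using f0(3) norm_triangle_ineq2[of "\<phi> f0" "\<phi> ?f1"] by (simp add: minus)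
  obtain F where F: "finite F"
    "\<And>f. norm f \<le> 1 \<Longrightarrow> (\<And>x. x \<notin> V - F \<Longrightarrow> c0_apply f x = 0) \<Longrightarrow> norm (\<phi> f) \<le> d"
    using finitely_concentratedD[OF W[OF V(1-3)] d] by blast
  have "norm (\<phi> f) \<le> e"
    if f: "norm f \<le> 1" "\<And>x. x \<notin> U - F \<Longrightarrow> c0_apply f x = 0" for f
  proof -
    let ?g = "restrict_c0 (- V) f"
    note ap = restrict_c0_apply[OF clV] restrict_c0_apply[OF clopen_set_ops(4)[OF clV]]
    have 1: "norm (\<phi> (restrict_c0 V f)) \<le> d"
      using f norm_restrict_c0_le[OF clV, of f] by (intro F(2)) (auto simp: ap)
    obtain u v where u: "norm u = 1" "u * \<phi> ?f1 = of_real (norm (\<phi> ?f1))"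
      and v: "norm v = 1" "v * \<phi> ?g = of_real (norm (\<phi> ?g))"
      by (metis unit_rotation)
    have "norm (\<phi> (c0_scale u ?f1 + c0_scale v ?g)) \<le> Sup S"
    proof (rule S)
      show "norm (c0_scale u ?f1 + c0_scale v ?g) \<le> 1"
        by (rule norm_c0_le)
          (use f(1) f0(1) norm_c0_apply_le[of f] norm_c0_apply_le[of f0] in
            \<open>auto simp: ap norm_mult u v intro: order_trans\<close>)
      show "c0_apply (c0_scale u ?f1 + c0_scale v ?g) x = 0" if "x \<notin> U" for x
        using f0(2)[OF that] f(2)[of x] that by (auto simp: ap)
    qed
    also have "\<phi> (c0_scale u ?f1 + c0_scale v ?g) = of_real (norm (\<phi> ?f1) + norm (\<phi> ?g))"
      by (simp add: add scale u v)
    finally have "norm (\<phi> ?f1) + norm (\<phi> ?g) \<le> Sup S" by (simp add: abs_of_nonneg del: of_real_add)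
    with f1 have 2: "norm (\<phi> ?g) \<le> 2 * d" by linarith
    have "\<phi> f = \<phi> (restrict_c0 V f) + \<phi> ?g"
      using restrict_c0_split_UNIV[OF clV, of f] add by metis
    then have "norm (\<phi> f) \<le> 3 * d"
      using 1 2 norm_triangle_ineq[of "\<phi> (restrict_c0 V f)" "\<phi> ?g"] by simp
    then show ?thesis using d by (simp add: d_def)
  qed
  then show "\<exists>F. finite F \<and> (\<forall>f. norm f \<le> 1 \<and> (\<forall>x. x \<notin> U - F \<longrightarrow> c0_apply f x = 0) \<longrightarrow> norm (\<phi> f) \<le> e)"
    using F(1) by blast
qed

text \<open>
  Rudin's theorem that measures on a scattered space are purely atomic, in the present terms. If \<open>y\<close>
  is isolated among the points without a good neighbourhood, then a small neighbourhood of \<open>y\<close> is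
  good after removal of \<open>y\<close>, and a single point may always be added.
\<close>

theorem finitely_concentrated_UNIV:
  fixes \<phi> :: "('a, 'k::real_normed_field) c0 \<Rightarrow> 'k"
  assumes \<phi>: "c0_functional \<phi> B"
  shows "finitely_concentrated \<phi> UNIV"
proof -
  interpret c0_functional \<phi> B by fact
  define good where "good y \<longleftrightarrow> (\<exists>V. open V \<and> compact V \<and> y \<in> V \<and> finitely_concentrated \<phi> V)" for y
  have vanishing: "f = 0" if "\<forall>x. c0_apply f x = 0" for f :: "('a, 'k) c0"
    using that by (intro c0_eqI) simp
  have cpt: "finitely_concentrated \<phi> W" if W: "open W" "compact W" "\<And>y. y \<in> W \<Longrightarrow> good y" for W
  proof -
    obtain V where V: "\<And>y. y \<in> W \<Longrightarrow> open (V y) \<and> compact (V y) \<and> y \<in> V y \<and> finitely_concentrated \<phi> (V y)"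
      using W(3) unfolding good_def by metis
    obtain D where D: "D \<subseteq> W" "finite D" "W \<subseteq> (\<Union>z\<in>D. V z)"
      using compactE_image[OF W(2), of W V] V by blast
    have "clopen_set (\<Union>z\<in>D. V z) \<and> finitely_concentrated \<phi> (\<Union>z\<in>D. V z)"
      using D(2,1)
    proof (induction D)
      case empty
      then show ?case
        unfolding finitely_concentrated_def clopen_set_def
        by (auto simp: zero dest!: vanishing intro!: exI[of _ "{}"])
    next
      case (insert z D)
      then show ?case
        using V[of z] finitely_concentrated_Un[of "V z" "\<Union> (V ` D)"] clopen_set_ops(1)[of "V z" "\<Union> (V ` D)"]
        by (simp add: compact_open_clopen)
    qed
    then show ?thesis using D(3) finitely_concentrated_mono by blast
  qed
  have "{y. \<not> good y} = {}"
  proof (rule ccontr)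
    assume "{y. \<not> good y} \<noteq> {}"
    then obtain y T where T: "open T" "T \<inter> {y. \<not> good y} = {y}"
      by (rule isolated_point)
    obtain V where V: "open V" "compact V" "y \<in> V" "V \<subseteq> T"
      using compact_open_base[of T y] T by blast
    have "finitely_concentrated \<phi> (V - {y})"
    proof (rule finitely_concentrated_open[OF \<phi>])
      show "open (V - {y})" using V(1) by (simp add: open_Diff)
      show "finitely_concentrated \<phi> W" if "open W" "compact W" "W \<subseteq> V - {y}" for W
        using that(1,2)
      proof (rule cpt)
        show "good z" if "z \<in> W" for z using that \<open>W \<subseteq> V - {y}\<close> V T by blast
      qed
    qed
    then have "finitely_concentrated \<phi> V"
      using finitely_concentrated_insert[of \<phi> "V - {y}" y] V(3) by (simp add: insert_absorb)
    then show False using V T unfolding good_def by blast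
  qed
  then have "good y" for y by blast
  show ?thesis
  proof (rule finitely_concentrated_open[OF \<phi> open_UNIV])
    show "finitely_concentrated \<phi> W" if "open W" "compact W" for W
      using that \<open>\<And>y. good y\<close> by (rule cpt)
  qed
qed

end

section \<open>Compact operators between different spaces\<close>

text \<open>
  Compactness for operators between two different spaces; on \<open>C\<^sub>0(K)\<close> itself it is
  \<^const>\<open>compact_op\<close>, see \<open>compact_op_iff\<close>.
\<close>

definition compact_map :: "('x::real_normed_vector \<Rightarrow>\<^sub>L 'y::real_normed_vector) \<Rightarrow> bool" where
  "compact_map T \<longleftrightarrow> compact (closure (blinfun_apply T ` cball 0 1))"

text \<open>
  Linearity over the scalar field; a bounded linear map as such is linear over the reals only.
\<close>

definition klinear ::
  "(('a::topological_space, 'k::real_normed_field) c0 \<Rightarrow>\<^sub>L ('b::topological_space, 'k) c0) \<Rightarrow> bool" where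
  "klinear T \<longleftrightarrow> (\<forall>c f. blinfun_apply T (c0_scale c f) = c0_scale c (blinfun_apply T f))"

lemma compact_mapI:
  assumes "compact C" "blinfun_apply T ` cball 0 1 \<subseteq> C"
  shows "compact_map T"
proof -
  have "closure (blinfun_apply T ` cball 0 1) \<subseteq> C"
    using assms by (intro closure_minimal compact_imp_closed)
  then show ?thesis
    unfolding compact_map_def using assms(1) by (metis closed_closure compact_Int_closed inf.absorb2)
qed

lemma compact_map_zero: "compact_map 0"
  by (rule compact_mapI[of "{0}"]) auto

lemma compact_map_add:
  assumes "compact_map S" "compact_map T"
  shows "compact_map (S + T)"
proof (rule compact_mapI)
  let ?A = "closure (blinfun_apply S ` cball 0 1)" and ?B = "closure (blinfun_apply T ` cball 0 1)"
  show "compact {x + y | x y. x \<in> ?A \<and> y \<in> ?B}"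
    by (rule compact_sums; use assms in \<open>simp add: compact_map_def\<close>)
  show "blinfun_apply (S + T) ` cball 0 1 \<subseteq> {x + y | x y. x \<in> ?A \<and> y \<in> ?B}"
  proof (rule image_subsetI)
    fix f :: 'a assume "f \<in> cball 0 1"
    then have "blinfun_apply S f \<in> ?A" "blinfun_apply T f \<in> ?B"
      by (auto intro!: closure_subset[THEN subsetD] imageI)
    then show "blinfun_apply (S + T) f \<in> {x + y | x y. x \<in> ?A \<and> y \<in> ?B}"
      unfolding mem_Collect_eq blinfun.add_left by blast
  qed
qed

lemma compact_map_sum: "(\<And>i. i \<in> A \<Longrightarrow> compact_map (f i)) \<Longrightarrow> compact_map (sum f A)"
  by (induction A rule: infinite_finite_induct) (auto simp: compact_map_zero compact_map_add)

lemma compact_map_compose_left: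
  assumes "compact_map T"
  shows "compact_map (S o\<^sub>L T)"
proof (rule compact_mapI)
  show "compact (blinfun_apply S ` closure (blinfun_apply T ` cball 0 1))"
    using assms unfolding compact_map_def
    by (intro compact_continuous_image linear_continuous_on blinfun.bounded_linear_right)
  have "blinfun_apply (S o\<^sub>L T) ` cball 0 1 = blinfun_apply S ` blinfun_apply T ` cball 0 1"
    by (simp add: image_image)
  also have "\<dots> \<subseteq> blinfun_apply S ` closure (blinfun_apply T ` cball 0 1)"
    by (intro image_mono closure_subset)
  finally show "blinfun_apply (S o\<^sub>L T) ` cball 0 1 \<subseteq> blinfun_apply S ` closure (blinfun_apply T ` cball 0 1)" .
qed

lemma compact_map_compose_right:
  assumes "compact_map S"
  shows "compact_map (S o\<^sub>L T)"
proof -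
  define B where "B = norm T + 1"
  have B: "B > 0" unfolding B_def by (simp add: add_nonneg_pos)
  let ?C = "(\<lambda>g. B *\<^sub>R g) ` closure (blinfun_apply S ` cball 0 1)"
  have C: "compact ?C"
    using assms unfolding compact_map_def by (rule compact_scaling)
  show ?thesis
  proof (rule compact_mapI[OF C], rule image_subsetI)
    fix f :: 'c assume "f \<in> cball 0 1"
    then have "norm (blinfun_apply T f) \<le> norm T"
      using norm_blinfun[of T f] mult_left_mono[of "norm f" 1 "norm T"] by simp
    then have "norm (blinfun_apply T f) \<le> B" unfolding B_def by simp
    then have "inverse B *\<^sub>R blinfun_apply T f \<in> cball 0 1"
      using B by (simp add: field_simps)
    then have "blinfun_apply S (inverse B *\<^sub>R blinfun_apply T f) \<in> closure (blinfun_apply S ` cball 0 1)"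
      by (intro closure_subset[THEN subsetD] imageI)
    moreover have "blinfun_apply (S o\<^sub>L T) f = B *\<^sub>R blinfun_apply S (inverse B *\<^sub>R blinfun_apply T f)"
      using B by (simp add: blinfun.scaleR_right)
    ultimately show "blinfun_apply (S o\<^sub>L T) f \<in> ?C" by blast
  qed
qed

lemma compact_closure_totally_bounded:
  fixes S :: "'x::banach set"
  assumes "\<And>e. e > 0 \<Longrightarrow> \<exists>k. finite k \<and> S \<subseteq> (\<Union>x\<in>k. ball x e)"
  shows "compact (closure S)"
  unfolding compact_eq_totally_bounded
proof (intro conjI allI impI)
  show "complete (closure S)" by (simp add: complete_eq_closed)
  fix e :: real assume e: "e > 0"
  then obtain k where k: "finite k" "S \<subseteq> (\<Union>x\<in>k. ball x (e/2))" using assms[of "e/2"] by auto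
  have "closed (\<Union>x\<in>k. cball x (e/2))" using k(1) by (intro closed_UN) auto
  moreover have "S \<subseteq> (\<Union>x\<in>k. cball x (e/2))"
    using k(2) by (rule order_trans) (intro UN_mono ball_subset_cball order_refl)
  ultimately have "closure S \<subseteq> (\<Union>x\<in>k. cball x (e/2))"
    by (rule closure_minimal[rotated])
  also have "\<dots> \<subseteq> (\<Union>x\<in>k. ball x e)" using e by (intro UN_mono) auto
  finally show "\<exists>k. finite k \<and> closure S \<subseteq> (\<Union>x\<in>k. ball x e)" using k by blast
qed

lemma compact_map_limit:
  fixes T :: "'x::real_normed_vector \<Rightarrow>\<^sub>L 'y::banach"
  assumes "\<And>e. e > 0 \<Longrightarrow> \<exists>S. compact_map S \<and> norm (T - S) \<le> e"
  shows "compact_map T"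
  unfolding compact_map_def
proof (rule compact_closure_totally_bounded)
  fix e :: real assume "e > 0"
  then obtain S where S: "compact_map S" "norm (T - S) \<le> e / 2"
    using assms[of "e/2"] by auto
  then obtain k where k: "finite k" "closure (blinfun_apply S ` cball 0 1) \<subseteq> (\<Union>x\<in>k. ball x (e/2))"
    using \<open>e > 0\<close> unfolding compact_map_def compact_eq_totally_bounded by (meson half_gt_zero)
  have "blinfun_apply T ` cball 0 1 \<subseteq> (\<Union>x\<in>k. ball x e)"
  proof (rule image_subsetI)
    fix f :: 'x assume f: "f \<in> cball 0 1"
    then have "blinfun_apply S f \<in> closure (blinfun_apply S ` cball 0 1)"
      by (intro closure_subset[THEN subsetD] imageI)
    then obtain x where x: "x \<in> k" "dist x (blinfun_apply S f) < e / 2" using k by auto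
    have "norm (blinfun_apply (T - S) f) \<le> norm (T - S) * norm f" by (rule norm_blinfun)
    also have "\<dots> \<le> norm (T - S) * 1" using f by (intro mult_left_mono) auto
    finally have "dist (blinfun_apply S f) (blinfun_apply T f) \<le> e / 2"
      using S(2) by (simp add: dist_norm blinfun.diff_left norm_minus_commute)
    then have "dist x (blinfun_apply T f) < e" using x(2) dist_triangle[of x "blinfun_apply T f" "blinfun_apply S f"] by linarith
    then show "blinfun_apply T f \<in> (\<Union>x\<in>k. ball x e)" using x(1) by auto
  qed
  then show "\<exists>k. finite k \<and> blinfun_apply T ` cball 0 1 \<subseteq> (\<Union>x\<in>k. ball x e)" using k(1) by blast
qed

text \<open>
  The operator that takes \<open>f\<close> to \<open>\<phi>(f) g\<close>; only meaningful for a bounded functional \<open>\<phi>\<close>.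
\<close>

definition rank_one ::
  "(('a::topological_space, 'k::real_normed_field) c0 \<Rightarrow> 'k) \<Rightarrow> ('b::topological_space, 'k) c0
    \<Rightarrow> ('a, 'k) c0 \<Rightarrow>\<^sub>L ('b, 'k) c0" where
  "rank_one \<phi> g = Blinfun (\<lambda>f. c0_scale (\<phi> f) g)"

lemma c0_scale_of_real: "c0_scale (of_real r) f = r *\<^sub>R f"
  by (rule c0_eqI) (simp add: scaleR_conv_of_real)

lemma (in c0_functional) rank_one_apply:
  "blinfun_apply (rank_one \<phi> g) f = c0_scale (\<phi> f) g"
proof -
  have "bounded_linear (\<lambda>f. c0_scale (\<phi> f) g)"
  proof (rule bounded_linear_intro)
    show "c0_scale (\<phi> (f + h)) g = c0_scale (\<phi> f) g + c0_scale (\<phi> h) g" for f h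
      by (simp add: add c0_scale_algebra)
    show "c0_scale (\<phi> (r *\<^sub>R f)) g = r *\<^sub>R c0_scale (\<phi> f) g" for r f
      using scale[of "of_real r" f] by (simp add: c0_scale_algebra c0_scale_of_real flip: c0_scale_of_real)
    show "norm (c0_scale (\<phi> f) g) \<le> norm f * (B * norm g)" for f
      using mult_right_mono[OF bound[of f] norm_ge_zero[of g]] by (simp add: norm_c0_scale mult_ac)
  qed
  then show ?thesis by (simp add: rank_one_def bounded_linear_Blinfun_apply)
qed

lemma (in c0_functional) klinear_rank_one: "klinear (rank_one \<phi> g)"
  by (simp add: klinear_def rank_one_apply scale c0_scale_algebra)

lemma compact_rank_one:
  fixes \<phi> :: "('a::topological_space, 'k::real_or_complex) c0 \<Rightarrow> 'k"
  assumes "c0_functional \<phi> B"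
  shows "compact_map (rank_one \<phi> g)"
proof (rule compact_mapI)
  interpret c0_functional \<phi> B by fact
  have "bounded_linear (\<lambda>c. c0_scale c g)"
    by (rule bounded_linear_intro[where K = "norm g"])
      (auto simp: c0_scale_algebra norm_c0_scale scaleR_conv_of_real simp flip: c0_scale_of_real)
  then show "compact ((\<lambda>c. c0_scale c g) ` cball 0 B)"
    by (intro compact_continuous_image linear_continuous_on compact_cball)
  show "blinfun_apply (rank_one \<phi> g) ` cball 0 1 \<subseteq> (\<lambda>c. c0_scale c g) ` cball 0 B"
  proof (rule image_subsetI)
    fix f assume "f \<in> cball (0::('a, 'k) c0) 1"
    then have "norm (\<phi> f) \<le> B" using bound'[of f 1] by simp
    then show "blinfun_apply (rank_one \<phi> g) f \<in> (\<lambda>c. c0_scale c g) ` cball 0 B"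
      by (auto simp: rank_one_apply)
  qed
qed

lemma klinear_sum: "(\<And>i. i \<in> A \<Longrightarrow> klinear (f i)) \<Longrightarrow> klinear (sum f A)"
  by (simp add: klinear_def blinfun.sum_left) (induction A rule: infinite_finite_induct; simp add: c0_scale_algebra)

lemma klinear_ops:
  "klinear S \<Longrightarrow> klinear T \<Longrightarrow> klinear (S + T)"
  "klinear S \<Longrightarrow> klinear T \<Longrightarrow> klinear (S - T)"
  "klinear T \<Longrightarrow> klinear (r *\<^sub>R T)"
  "klinear S' \<Longrightarrow> klinear T \<Longrightarrow> klinear (S' o\<^sub>L T)"
  "klinear id_blinfun"
  by (auto simp: klinear_def blinfun.bilinear_simps c0_scale_algebra)

lemma c0_functional_eval: "c0_functional (\<lambda>f. c0_apply f x) 1"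
  by unfold_locales (auto simp: norm_c0_apply_le)

lemma c0_op_apply_scale_right [simp]: "c0_op_apply T (c0_scale c f) = c0_scale c (c0_op_apply T f)"
  by (metis c0_op_apply_id c0_op_apply_scale c0_op_apply_simps(6) c0_op_scale_algebra(6))

lemma norm_c0_op_apply_le: "norm (c0_op_apply T f) \<le> norm T * norm f"
  by (simp add: c0_op_apply.rep_eq norm_c0_op.rep_eq norm_blinfun)

lemma c0_functional_eval_op: "c0_functional (\<lambda>f. c0_apply (c0_op_apply T f) x) (norm T)"
  by unfold_locales
    (auto intro: order_trans[OF norm_c0_apply_le norm_c0_op_apply_le]
      simp: linear_simps[OF bounded_linear_c0_op_apply])

lemma klinear_c0_op_blinfun: "klinear (c0_op_blinfun T)"
  using c0_op_blinfun[of T] by (simp add: klinear_def)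

lemma c0_op_blinfun_inverse_klinear: "klinear T \<Longrightarrow> c0_op_blinfun (Abs_c0_op T) = T"
  by (intro Abs_c0_op_inverse) (simp add: klinear_def)

lemma compact_op_iff: "compact_op T \<longleftrightarrow> compact_map (c0_op_blinfun T)"
  by (simp add: compact_op_def compact_map_def c0_op_apply.rep_eq)

lemma essential_norm_le: "compact_op S \<Longrightarrow> essential_norm T \<le> norm (T - S)"
  unfolding essential_norm_def by (rule cInf_lower) (auto intro: bdd_belowI[of _ 0])

lemma essential_norm_nonneg: "0 \<le> essential_norm T"
  unfolding essential_norm_def by (rule cInf_greatest) (auto intro: exI[of _ 0])

section \<open>The gliding hump\<close>

context scattered_lc_space
begin

text \<open>
  The finite-rank operator \<open>P\<close> replaces \<open>f\<close> by a function that is constant on disjoint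
  neighbourhoods \<open>W y\<close> of the points \<open>y\<close> of \<open>F\<close>, with value \<open>f y\<close> there, and vanishes elsewhere.
  As \<open>T - T P\<close> has norm greater than 1, so has its value at some \<open>g\<close> in the unit ball; half of
  \<open>g - P g\<close> is the required function.
\<close>

lemma large_off_finite_set:
  fixes T :: "('a, 'k::real_or_complex) c0_op"
  assumes ess: "1 < essential_norm T" and F: "finite F"
  obtains h x where "norm h \<le> 1" "\<And>y. y \<in> F \<Longrightarrow> c0_apply h y = 0"
    "1 / 2 < norm (c0_apply (c0_op_apply T h) x)"
proof -
  obtain W where W: "\<And>y. y \<in> F \<Longrightarrow> open (W y) \<and> compact (W y) \<and> y \<in> W y"
    "\<And>y z. y \<in> F \<Longrightarrow> z \<in> F \<Longrightarrow> y \<noteq> z \<Longrightarrow> W y \<inter> W z = {}"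
    using disjoint_compact_open_nbhds[OF F] by metis
  let ?ind = "\<lambda>y. indicator_c0 (W y) :: ('a, 'k) c0"
  define P where "P = (\<Sum>y\<in>F. rank_one (\<lambda>f. c0_apply f y) (?ind y))"
  have klP: "klinear P" unfolding P_def
    by (intro klinear_sum c0_functional.klinear_rank_one[OF c0_functional_eval])
  have cP: "compact_map P" unfolding P_def
    by (intro compact_map_sum compact_rank_one[OF c0_functional_eval])
  have P_apply: "c0_apply (blinfun_apply P f) x = (\<Sum>y\<in>F. c0_apply f y * (if x \<in> W y then 1 else 0))" for f x
    unfolding P_def blinfun.sum_left c0_apply_sum
    by (rule sum.cong) (simp_all add: c0_functional.rank_one_apply[OF c0_functional_eval] indicator_c0_apply W)
  have P_in: "c0_apply (blinfun_apply P f) x = c0_apply f y" if "y \<in> F" "x \<in> W y" for f x y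
  proof -
    have "(\<Sum>z\<in>F. c0_apply f z * (if x \<in> W z then 1 else 0)) = (\<Sum>z\<in>{y}. c0_apply f z * (if x \<in> W z then 1 else 0))"
      by (rule sum.mono_neutral_right) (use F that W(2) in auto)
    then show ?thesis using that by (simp add: P_apply)
  qed
  have P_out: "c0_apply (blinfun_apply P f) x = 0" if "\<And>y. y \<in> F \<Longrightarrow> x \<notin> W y" for f x
    using that by (simp add: P_apply)
  define P' where "P' = Abs_c0_op P"
  have P': "c0_op_apply P' f = blinfun_apply P f" for f
    by (simp add: P'_def c0_op_apply.rep_eq c0_op_blinfun_inverse_klinear klP)
  have "compact_op P'" by (simp add: compact_op_iff P'_def c0_op_blinfun_inverse_klinear klP cP)
  then have "essential_norm T \<le> norm (T - T * P')"
    by (intro essential_norm_le compact_op_mult_left)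
  then have "\<not> norm (c0_op_blinfun (T - T * P')) \<le> 1" using ess by (simp add: norm_c0_op.rep_eq)
  then have "\<exists>f. \<not> norm (c0_op_apply (T - T * P') f) \<le> 1 * norm f"
    using norm_blinfun_bound[of 1 "c0_op_blinfun (T - T * P')"] unfolding c0_op_apply.rep_eq
    by (meson zero_le_one)
  then obtain f where f: "norm f < norm (c0_op_apply (T - T * P') f)"
    unfolding mult_1 not_le by blast
  have "f \<noteq> 0" using f by (auto simp: linear_simps[OF bounded_linear_c0_op_apply])
  define g where "g = f /\<^sub>R norm f"
  have g: "norm g = 1" using \<open>f \<noteq> 0\<close> by (simp add: g_def)
  have "norm (c0_op_apply (T - T * P') g) = norm (c0_op_apply (T - T * P') f) / norm f"
    using linear_simps(5)[OF bounded_linear_c0_op_apply, of "T - T * P'"]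
    by (simp add: g_def divide_inverse mult.commute del: c0_op_apply_simps)
  also have "\<dots> > 1" using f \<open>f \<noteq> 0\<close> by (simp add: less_divide_eq)
  finally have Tg: "norm (c0_op_apply (T - T * P') g) > 1" .
  define h where "h = (1/2) *\<^sub>R (g - c0_op_apply P' g)"
  have Th: "c0_op_apply T h = (1/2) *\<^sub>R c0_op_apply (T - T * P') g"
    by (simp add: h_def linear_simps[OF bounded_linear_c0_op_apply])
  then have "1 / 2 < norm (c0_op_apply T h)" using Tg by simp
  then obtain x where x: "1 / 2 < norm (c0_apply (c0_op_apply T h) x)"
    using norm_c0_less_witness[of "1/2" "c0_op_apply T h"] by auto
  have gle: "norm (c0_apply g z) \<le> 1" for z using norm_c0_apply_le[of g z] g by simp
  have "norm (c0_apply g z - c0_apply (c0_op_apply P' g) z) \<le> 2" for z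
  proof (cases "\<exists>y\<in>F. z \<in> W y")
    case True
    then obtain y where "y \<in> F" "z \<in> W y" by blast
    then show ?thesis using norm_triangle_ineq4[of "c0_apply g z" "c0_apply g y"] gle[of z] gle[of y]
      by (simp add: P' P_in)
  next
    case False
    then show ?thesis using gle[of z] by (simp add: P' P_out)
  qed
  then have "norm (g - c0_op_apply P' g) \<le> 2" by (intro norm_c0_le) simp
  then have "norm h \<le> 1" by (simp add: h_def)
  moreover have "c0_apply h y = 0" if "y \<in> F" for y
    using that W(1)[OF that] by (simp add: h_def P' P_in)
  ultimately show ?thesis using x that by blast
qed

text \<open>
  The functionals taking \<open>f\<close> to \<open>T f\<close> at \<open>x\<^sub>k\<close> are concentrated up to 1/8 on \<open>F\<^sub>k\<close>, while the
  functions \<open>h\<^sub>k\<close> at which they are large vanish on the earlier sets \<open>F\<^sub>j\<close>. The set \<open>H\<^sub>k\<close> collects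
  these.
\<close>

lemma concentrated_sequence:
  fixes T :: "('a, 'k::real_or_complex) c0_op"
  assumes ess: "1 < essential_norm T"
  obtains F :: "nat \<Rightarrow> 'a set" and h :: "nat \<Rightarrow> ('a, 'k) c0" and H :: "nat \<Rightarrow> 'a set" and x :: "nat \<Rightarrow> 'a"
  where "\<And>k. finite (F k)" "\<And>k. norm (h k) \<le> 1" "\<And>k y. y \<in> H k \<Longrightarrow> c0_apply (h k) y = 0"
    "\<And>k. 1 / 2 < norm (c0_apply (c0_op_apply T (h k)) (x k))"
    "\<And>k f. norm f \<le> 1 \<Longrightarrow> (\<And>y. y \<in> F k \<Longrightarrow> c0_apply f y = 0) \<Longrightarrow> norm (c0_apply (c0_op_apply T f) (x k)) \<le> 1 / 8"
    "\<And>k l. k < l \<Longrightarrow> F k \<subseteq> H l"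
proof -
  define P where "P s \<longleftrightarrow> (case s of (h, x, F, H) \<Rightarrow> finite F \<and> finite H \<and> norm h \<le> 1 \<and>
      (\<forall>y\<in>H. c0_apply h y = 0) \<and> 1 / 2 < norm (c0_apply (c0_op_apply T h) x) \<and>
      (\<forall>f. norm f \<le> 1 \<and> (\<forall>y\<in>F. c0_apply f y = 0) \<longrightarrow> norm (c0_apply (c0_op_apply T f) x) \<le> 1 / 8))"
    for s :: "('a, 'k) c0 \<times> 'a \<times> 'a set \<times> 'a set"
  have ex: "\<exists>h x F. P (h, x, F, H)" if H: "finite H" for H
  proof -
    obtain h x where h: "norm h \<le> 1" "\<And>y. y \<in> H \<Longrightarrow> c0_apply h y = 0"
      "1 / 2 < norm (c0_apply (c0_op_apply T h) x)"
      using large_off_finite_set[OF ess H] by blast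
    have "finitely_concentrated (\<lambda>f. c0_apply (c0_op_apply T f) x) UNIV"
      by (rule finitely_concentrated_UNIV[OF c0_functional_eval_op])
    then obtain F where "finite F"
      "\<And>f. norm f \<le> 1 \<Longrightarrow> (\<And>y. y \<notin> UNIV - F \<Longrightarrow> c0_apply f y = 0) \<Longrightarrow> norm (c0_apply (c0_op_apply T f) x) \<le> 1 / 8"
      using finitely_concentratedD[of _ UNIV "1/8"] by (metis zero_less_divide_1_iff zero_less_numeral)
    then have "P (h, x, F, H)" using h H by (simp add: P_def)
    then show ?thesis by blast
  qed
  obtain s where s: "\<And>n. P (s n)"
    "\<And>n. snd (snd (snd (s (Suc n)))) = snd (snd (snd (s n))) \<union> fst (snd (snd (s n)))"
  proof -
    have "\<exists>f. \<forall>n. P (f n) \<and> snd (snd (snd (f (Suc n)))) = snd (snd (snd (f n))) \<union> fst (snd (snd (f n)))"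
    proof (rule dependent_nat_choice[where P = "\<lambda>_. P"
          and Q = "\<lambda>_ s t. snd (snd (snd t)) = snd (snd (snd s)) \<union> fst (snd (snd s))"])
      show "\<exists>s. P s" using ex[of "{}"] by blast
      fix s and n :: nat assume "P s"
      then have "finite (snd (snd (snd s)) \<union> fst (snd (snd s)))" by (auto simp: P_def split: prod.splits)
      from ex[OF this] show "\<exists>t. P t \<and> snd (snd (snd t)) = snd (snd (snd s)) \<union> fst (snd (snd s))" by fastforce
    qed
    then show ?thesis using that by blast
  qed
  define h x F H where "h n = fst (s n)" "x n = fst (snd (s n))"
    "F n = fst (snd (snd (s n)))" "H n = snd (snd (snd (s n)))" for n
  have P: "P (h n, x n, F n, H n)" for n using s(1)[of n] by (simp add: h_x_F_H_def)
  have H: "H (Suc n) = H n \<union> F n" for n using s(2)[of n] by (simp add: h_x_F_H_def)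
  have "mono H" by (rule incseq_SucI) (simp add: H)
  then have "F k \<subseteq> H l" if "k < l" for k l
    using H[of k] monoD[of H "Suc k" l] that by auto
  then show ?thesis
    using P by (intro that[of F h H x]) (auto simp: P_def)
qed

text \<open>
  The norm of \<open>\<phi>\<close> on the functions supported in \<open>V\<close> is at most \<open>t\<close>.
\<close>

definition small_on :: "(('a, 'k::real_normed_field) c0 \<Rightarrow> 'k) \<Rightarrow> 'a set \<Rightarrow> real \<Rightarrow> bool" where
  "small_on \<phi> V t \<longleftrightarrow> (\<forall>f. norm f \<le> 1 \<and> (\<forall>y. y \<notin> V \<longrightarrow> c0_apply f y = 0) \<longrightarrow> norm (\<phi> f) \<le> t)"

lemma small_onD: "small_on \<phi> V t \<Longrightarrow> norm f \<le> 1 \<Longrightarrow> (\<And>y. y \<notin> V \<Longrightarrow> c0_apply f y = 0) \<Longrightarrow> norm (\<phi> f) \<le> t"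
  by (simp add: small_on_def)

lemma small_on_Un:
  assumes "c0_functional \<phi> B" "clopen_set V" "clopen_set U" "small_on \<phi> V s" "small_on \<phi> U t"
  shows "small_on \<phi> (V \<union> U) (s + t)"
  unfolding small_on_def
proof (intro allI impI, elim conjE)
  interpret c0_functional \<phi> B by fact
  fix f :: "('a, 'b) c0" assume f: "norm f \<le> 1" "\<forall>y. y \<notin> V \<union> U \<longrightarrow> c0_apply f y = 0"
  have c: "clopen_set (U - V)" using assms by (simp add: clopen_set_ops)
  note ap = restrict_c0_apply[OF assms(2)] restrict_c0_apply[OF c]
  have "norm (\<phi> (restrict_c0 V f)) \<le> s"
    by (rule small_onD[OF assms(4)]) (use f(1) norm_restrict_c0_le[OF assms(2), of f] in \<open>auto simp: ap\<close>)
  moreover have "norm (\<phi> (restrict_c0 (U - V) f)) \<le> t"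
    by (rule small_onD[OF assms(5)]) (use f(1) norm_restrict_c0_le[OF c, of f] in \<open>auto simp: ap\<close>)
  moreover have "f = restrict_c0 V f + restrict_c0 (U - V) f"
    using f by (intro restrict_c0_split assms) auto
  ultimately show "norm (\<phi> f) \<le> s + t" by (metis add norm_triangle_mono)
qed

text \<open>
  The set \<open>V\<close> contains the supports chosen so far, and all functionals with index in \<open>M\<close> are small
  on it. The finite sets \<open>G k = F k - H k\<close> are pairwise disjoint, so any \<open>N\<close> of them have disjoint
  neighbourhoods \<open>U k\<close>. On at least one of these, each functional has norm at most \<open>B / N\<close>, and
  by the pigeonhole principle the same \<open>U k\<close> serves for infinitely many functionals. It is added to
  \<open>V\<close>, and \<open>h k\<close>, restricted to its new part, is the next function.
\<close>

lemma gliding_hump_step: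
  fixes h :: "nat \<Rightarrow> ('a, 'k::real_or_complex) c0" and \<phi> :: "nat \<Rightarrow> ('a, 'k) c0 \<Rightarrow> 'k"
  assumes \<phi>: "\<And>k. c0_functional (\<phi> k) B"
    and F: "\<And>k. finite (F k)" and h1: "\<And>k. norm (h k) \<le> 1" and hH: "\<And>k y. y \<in> H k \<Longrightarrow> c0_apply (h k) y = 0"
    and big: "\<And>k. 1 / 2 < norm (\<phi> k (h k))"
    and conc: "\<And>k f. norm f \<le> 1 \<Longrightarrow> (\<And>y. y \<in> F k \<Longrightarrow> c0_apply f y = 0) \<Longrightarrow> norm (\<phi> k f) \<le> 1 / 8"
    and FH: "\<And>k l. k < l \<Longrightarrow> F k \<subseteq> H l"
    and M: "infinite M" and V: "compact V" "open V" and \<theta>: "\<theta> < 1 / 8"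
    and small: "\<And>k. k \<in> M \<Longrightarrow> small_on (\<phi> k) V \<theta>"
  obtains f k M' V' \<theta>' where "norm f \<le> 1" "1 / 4 \<le> norm (\<phi> k f)" "V \<subseteq> V'"
    "\<And>y. y \<notin> V' - V \<Longrightarrow> c0_apply f y = 0" "compact V'" "open V'" "infinite M'" "\<theta>' < 1 / 8"
    "\<And>k. k \<in> M' \<Longrightarrow> small_on (\<phi> k) V' \<theta>'"
proof -
  define G where "G k = F k - H k" for k
  have Gdisj: "G k \<inter> G l = {}" if "k \<noteq> l" for k l
    using FH[of k l] FH[of l k] that unfolding G_def by (cases k l rule: linorder_cases) auto
  have B0: "0 \<le> B" using \<phi> by (rule c0_functional.B_nonneg)
  \<comment> \<open>So large that the bound for the functionals in \<open>M\<close> stays below 1/8 when \<open>B / N\<close> is added.\<close>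
  obtain N :: nat where N: "B / (1 / 8 - \<theta>) < real N" using reals_Archimedean2 by blast
  have \<theta>0: "0 < 1 / 8 - \<theta>" using \<theta> by simp
  then have "0 < real N" using N B0 by (meson divide_nonneg_pos le_less_trans)
  then have BN: "\<theta> + B / real N < 1 / 8" using N \<theta>0 by (simp add: field_simps)
  obtain A where A: "A \<subseteq> M" "finite A" "card A = N" using infinite_arbitrarily_large[OF M] by blast
  have finG: "finite (\<Union>k\<in>A. G k)" using A F by (auto simp: G_def)
  obtain W where W: "\<And>y. y \<in> (\<Union>k\<in>A. G k) \<Longrightarrow> open (W y) \<and> compact (W y) \<and> y \<in> W y"
    "\<And>y z. y \<in> (\<Union>k\<in>A. G k) \<Longrightarrow> z \<in> (\<Union>k\<in>A. G k) \<Longrightarrow> y \<noteq> z \<Longrightarrow> W y \<inter> W z = {}"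
    using disjoint_compact_open_nbhds[OF finG] by metis
  define U where "U k = (\<Union>y\<in>G k. W y)" for k
  have Uco: "compact (U k)" "open (U k)" if "k \<in> A" for k
  proof -
    have "\<forall>y\<in>G k. open (W y) \<and> compact (W y)" "finite (G k)" using W that F by (auto simp: G_def)
    then show "compact (U k)" "open (U k)" unfolding U_def by (auto intro: compact_UN)
  qed
  have GU: "G k \<subseteq> U k" if "k \<in> A" for k using W(1) that unfolding U_def by blast
  have Udisj: "U k \<inter> U l = {}" if "k \<in> A" "l \<in> A" "k \<noteq> l" for k l
  proof -
    have "W y \<inter> W z = {}" if "y \<in> G k" "z \<in> G l" for y z
      using W(2)[of y z] that \<open>k \<in> A\<close> \<open>l \<in> A\<close> Gdisj[OF \<open>k \<noteq> l\<close>] by blast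
    then show ?thesis unfolding U_def by blast
  qed
  have "\<exists>k\<in>A. infinite {l \<in> M. small_on (\<phi> l) (U k) (B / N)}"
  proof (rule ccontr)
    assume "\<not> ?thesis"
    then have "finite (\<Union>k\<in>A. {l \<in> M. small_on (\<phi> l) (U k) (B / N)})" using A by simp
    then obtain l where l: "l \<in> M" "\<And>k. k \<in> A \<Longrightarrow> \<not> small_on (\<phi> l) (U k) (B / N)"
      using M finite_subset[of M "\<Union>k\<in>A. {l \<in> M. small_on (\<phi> l) (U k) (B / N)}"] by blast
    interpret c0_functional "\<phi> l" B by (rule \<phi>)
    have "\<exists>g. norm g \<le> 1 \<and> (\<forall>y. y \<notin> U k \<longrightarrow> c0_apply g y = 0) \<and> B / N < norm (\<phi> l g)" if "k \<in> A" for k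
      using l(2)[OF that] unfolding small_on_def by (meson not_le)
    then obtain g where g: "\<And>k. k \<in> A \<Longrightarrow> norm (g k) \<le> 1 \<and> (\<forall>y. y \<notin> U k \<longrightarrow> c0_apply (g k) y = 0) \<and> B / N < norm (\<phi> l (g k))"
      by metis
    have "(\<Sum>k\<in>A. norm (\<phi> l (g k))) \<le> B * 1"
    proof (rule sum_norm_disjoint_le)
      fix i j y assume "i \<in> A" "j \<in> A" "i \<noteq> j"
      then show "c0_apply (g i) y = 0 \<or> c0_apply (g j) y = 0" using g[of i] g[of j] Udisj[of i j] by blast
    qed (use g in auto)
    moreover have "(\<Sum>k\<in>A. B / N) < (\<Sum>k\<in>A. norm (\<phi> l (g k)))"
      using A g \<open>0 < real N\<close> by (intro sum_strict_mono) auto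
    ultimately show False using A \<open>0 < real N\<close> by simp
  qed
  then obtain k where k: "k \<in> A" "infinite {l \<in> M. small_on (\<phi> l) (U k) (B / N)}" by blast
  interpret c0_functional "\<phi> k" B by (rule \<phi>)
  note clV = compact_open_clopen[OF V] and clU = compact_open_clopen[OF Uco[OF k(1)]]
  note clUV = clopen_set_ops(3)[OF clU clV] and clC = clopen_set_ops(4)[OF clopen_set_ops(1)[OF clV clU]]
  note ap = restrict_c0_apply[OF clV] restrict_c0_apply[OF clUV] restrict_c0_apply[OF clC]
  let ?f = "restrict_c0 (U k - V) (h k)"
  have f1: "norm ?f \<le> 1" using norm_restrict_c0_le[OF clUV, of "h k"] h1[of k] by simp
  have 1: "norm (\<phi> k (restrict_c0 V (h k))) \<le> \<theta>"
  proof (rule small_onD[OF small])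
    show "k \<in> M" using k A by blast
    show "norm (restrict_c0 V (h k)) \<le> 1" using norm_restrict_c0_le[OF clV, of "h k"] h1[of k] by simp
  qed (simp add: ap)
  \<comment> \<open>On \<open>F k\<close> this part of \<open>h k\<close> vanishes: on \<open>H k\<close> since \<open>h k\<close> does, on \<open>G k\<close> since \<open>U k\<close> is cut out.\<close>
  have 3: "norm (\<phi> k (restrict_c0 (- (V \<union> U k)) (h k))) \<le> 1 / 8"
  proof (rule conc)
    show "norm (restrict_c0 (- (V \<union> U k)) (h k)) \<le> 1"
      using norm_restrict_c0_le[OF clC, of "h k"] h1[of k] by simp
    show "c0_apply (restrict_c0 (- (V \<union> U k)) (h k)) y = 0" if "y \<in> F k" for y
      using that hH[of y k] GU[OF k(1)] unfolding ap G_def by auto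
  qed
  have "h k = restrict_c0 V (h k) + ?f + restrict_c0 (- (V \<union> U k)) (h k)"
    by (rule c0_eqI) (unfold plus_c0.rep_eq ap, auto)
  then have "\<phi> k (h k) = \<phi> k (restrict_c0 V (h k)) + \<phi> k ?f + \<phi> k (restrict_c0 (- (V \<union> U k)) (h k))"
    by (metis add)
  then have "norm (\<phi> k (h k)) = norm (\<phi> k (restrict_c0 V (h k)) + \<phi> k ?f + \<phi> k (restrict_c0 (- (V \<union> U k)) (h k)))"
    by (rule arg_cong)
  then have "norm (\<phi> k (h k)) \<le> norm (\<phi> k (restrict_c0 V (h k))) + norm (\<phi> k ?f) + norm (\<phi> k (restrict_c0 (- (V \<union> U k)) (h k)))"
    using norm_triangle_ineq[of "\<phi> k (restrict_c0 V (h k)) + \<phi> k ?f" "\<phi> k (restrict_c0 (- (V \<union> U k)) (h k))"]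
      norm_triangle_ineq[of "\<phi> k (restrict_c0 V (h k))" "\<phi> k ?f"] by linarith
  then have 2: "1 / 4 \<le> norm (\<phi> k ?f)" using 1 3 \<theta> big[of k] by linarith
  show ?thesis
  proof (rule that[of ?f k "V \<union> U k" "{l \<in> M. small_on (\<phi> l) (U k) (B / N)}" "\<theta> + B / N"])
    show "small_on (\<phi> l) (V \<union> U k) (\<theta> + B / N)" if "l \<in> {l \<in> M. small_on (\<phi> l) (U k) (B / N)}" for l
      using that small by (intro small_on_Un[OF \<phi> clV clU]) auto
    show "compact (V \<union> U k)" "open (V \<union> U k)" using V Uco[OF k(1)] by (auto intro: compact_Un)
    show "c0_apply ?f y = 0" if "y \<notin> V \<union> U k - V" for y using that by (auto simp: ap)
  qed (use f1 2 k BN in auto)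
qed

lemma disjoint_bumps:
  fixes T :: "('a, 'k::real_or_complex) c0_op"
  assumes ess: "1 < essential_norm T"
  obtains f :: "nat \<Rightarrow> ('a, 'k) c0" and x :: "nat \<Rightarrow> 'a"
  where "\<And>n. norm (f n) \<le> 1" "\<And>n. 1 / 4 \<le> norm (c0_apply (c0_op_apply T (f n)) (x n))"
    "\<And>m n y. m \<noteq> n \<Longrightarrow> c0_apply (f m) y = 0 \<or> c0_apply (f n) y = 0"
proof (rule concentrated_sequence[OF ess])
  fix F :: "nat \<Rightarrow> 'a set" and h :: "nat \<Rightarrow> ('a, 'k) c0" and H :: "nat \<Rightarrow> 'a set" and x :: "nat \<Rightarrow> 'a"
  assume hx: "\<And>k. finite (F k)" "\<And>k. norm (h k) \<le> 1" "\<And>k y. y \<in> H k \<Longrightarrow> c0_apply (h k) y = 0"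
    "\<And>k. 1 / 2 < norm (c0_apply (c0_op_apply T (h k)) (x k))"
    "\<And>k f. norm f \<le> 1 \<Longrightarrow> (\<And>y. y \<in> F k \<Longrightarrow> c0_apply f y = 0) \<Longrightarrow> norm (c0_apply (c0_op_apply T f) (x k)) \<le> 1 / 8"
    "\<And>k l. k < l \<Longrightarrow> F k \<subseteq> H l"
  define \<phi> where "\<phi> k f = c0_apply (c0_op_apply T f) (x k)" for k f
  have \<phi>: "c0_functional (\<phi> k) (norm T)" for k
    unfolding \<phi>_def by (rule c0_functional_eval_op)
  define P where "P s \<longleftrightarrow> (case s of (f, k, M, V) \<Rightarrow> norm f \<le> 1 \<and> 1 / 4 \<le> norm (\<phi> k f) \<and>
      (\<forall>y. y \<notin> V \<longrightarrow> c0_apply f y = 0) \<and> compact V \<and> open V \<and> infinite M \<and>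
      (\<exists>\<theta><1/8. \<forall>k\<in>M. small_on (\<phi> k) V \<theta>))"
    for s :: "('a, 'k) c0 \<times> nat \<times> nat set \<times> 'a set"
  define Q where "Q s t \<longleftrightarrow> (case s of (f, k, M, V) \<Rightarrow> case t of (f', k', M', V') \<Rightarrow>
      V \<subseteq> V' \<and> (\<forall>y\<in>V. c0_apply f' y = 0))"
    for s t :: "('a, 'k) c0 \<times> nat \<times> nat set \<times> 'a set"
  have step: "\<exists>f' k' M' V'. P (f', k', M', V') \<and> V \<subseteq> V' \<and> (\<forall>y\<in>V. c0_apply f' y = 0)"
    if VM: "compact V" "open V" "infinite M" "\<theta> < 1/8" "\<And>k. k \<in> M \<Longrightarrow> small_on (\<phi> k) V \<theta>" for V M \<theta>
  proof (rule gliding_hump_step[of \<phi> "norm T" F h H M V \<theta>, OF \<phi> hx(1-3) hx(4-5)[folded \<phi>_def] hx(6) VM(3,1,2,4,5)])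
    fix f k M' V' \<theta>' assume *: "norm f \<le> 1" "1 / 4 \<le> norm (\<phi> k f)" "V \<subseteq> V'"
      "\<And>y. y \<notin> V' - V \<Longrightarrow> c0_apply f y = 0" "compact V'" "open V'" "infinite M'" "\<theta>' < 1 / 8"
      "\<And>k. k \<in> M' \<Longrightarrow> small_on (\<phi> k) V' \<theta>'"
    show ?thesis
    proof (intro exI conjI)
      show "P (f, k, M', V')" unfolding P_def prod.case using * by blast
    qed (use * in auto)
  qed
  have "\<exists>s. \<forall>n. P (s n) \<and> Q (s n) (s (Suc n))"
  proof (rule dependent_nat_choice[where P = "\<lambda>_. P" and Q = "\<lambda>_. Q"])
    have "small_on (\<phi> k) {} 0" for k
      using c0_functional.zero[OF \<phi>, of k] unfolding small_on_def
      by (metis c0_eqI empty_iff norm_zero order_refl zero_c0.rep_eq)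
    then show "\<exists>s. P s" using step[of "{}" UNIV 0] by force
    fix s and n :: nat assume "P s"
    obtain f k M V where s: "s = (f, k, M, V)" by (cases s) auto
    obtain \<theta> where "compact V" "open V" "infinite M" "\<theta> < 1/8" "\<And>k. k \<in> M \<Longrightarrow> small_on (\<phi> k) V \<theta>"
      using \<open>P s\<close> unfolding P_def s prod.case by blast
    from step[OF this] show "\<exists>t. P t \<and> Q s t" unfolding Q_def s by fastforce
  qed
  then obtain s where s: "\<And>n. P (s n)" "\<And>n. Q (s n) (s (Suc n))" by blast
  define f k V where "f n = fst (s n)" "k n = fst (snd (s n))" "V n = snd (snd (snd (s n)))" for n
  have P: "norm (f n) \<le> 1" "1 / 4 \<le> norm (\<phi> (k n) (f n))" "\<And>y. y \<notin> V n \<Longrightarrow> c0_apply (f n) y = 0" for n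
    using s(1)[of n] by (auto simp: P_def f_k_V_def split: prod.splits)
  have Q: "V n \<subseteq> V (Suc n)" "\<And>y. y \<in> V n \<Longrightarrow> c0_apply (f (Suc n)) y = 0" for n
    using s(2)[of n] by (auto simp: Q_def f_k_V_def split: prod.splits)
  have "mono V" by (rule incseq_SucI) (rule Q)
  have less: "c0_apply (f m) y = 0 \<or> c0_apply (f n) y = 0" if "m < n" for m n y
  proof (cases "y \<in> V m")
    case True
    obtain n' where n': "n = Suc n'" "m \<le> n'" using \<open>m < n\<close> by (cases n) auto
    then have "y \<in> V n'" using True \<open>mono V\<close> by (auto dest: monoD)
    then show ?thesis using Q(2) n' by simp
  qed (use P in simp)
  show ?thesis
  proof (rule that[of f "x \<circ> k"])
    show "c0_apply (f m) y = 0 \<or> c0_apply (f n) y = 0" if "m \<noteq> n" for m n y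
      using less[of m n y] less[of n m y] that by (cases m n rule: linorder_cases) auto
  qed (use P in \<open>auto simp: \<phi>_def\<close>)
qed

end

section \<open>Operators from and to the space of null sequences\<close>

text \<open>
  The space of null sequences is \<open>C\<^sub>0(K)\<close> for the discrete space \<open>K\<close> of natural numbers; these are
  its unit vectors.
\<close>

abbreviation unit_seq :: "nat \<Rightarrow> (nat, 'k::real_normed_field) c0" where
  "unit_seq j \<equiv> indicator_c0 {j}"

lemma unit_seq_apply [simp]: "c0_apply (unit_seq j) i = (if i = j then 1 else 0)"
  by (simp add: indicator_c0_apply open_discrete)

lemma norm_unit_seq: "norm (unit_seq j :: (nat, 'k::real_normed_field) c0) = 1"
proof (rule antisym)
  show "norm (unit_seq j :: (nat, 'k) c0) \<le> 1" by (rule norm_c0_le) simp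
  show "1 \<le> norm (unit_seq j :: (nat, 'k) c0)"
    using norm_c0_apply_le[of "unit_seq j :: (nat, 'k) c0" j] by simp
qed

lemma c0_nat_tendsto_0: "(\<lambda>j. c0_apply (a :: (nat, 'k::real_normed_field) c0) j) \<longlonglongrightarrow> 0"
proof (rule tendsto_norm_zero_cancel, rule order_tendstoI)
  show "\<forall>\<^sub>F j in sequentially. e < norm (c0_apply a j)" if "e < 0" for e
    using that by (intro always_eventually) (metis less_le_trans norm_ge_zero)
  show "\<forall>\<^sub>F j in sequentially. norm (c0_apply a j) < e" if "0 < e" for e
  proof -
    have "discrete {j. e \<le> norm (c0_apply a j)}"
      by (rule discreteI) (auto simp: isolated_in_def intro!: exI[of _ "{_}"] open_discrete)
    then have "finite {j. e \<le> norm (c0_apply a j)}"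
      using compact_c0_superlevel[OF that, of a] discrete_compact_finite_iff by blast
    then show ?thesis
      by (simp add: eventually_cofinite not_less flip: cofinite_eq_sequentially)
  qed
qed

lemma c0_apply_null_sequence:
  assumes "\<alpha> \<longlonglongrightarrow> (0::'k::real_normed_field)"
  shows "c0_apply (Abs_c0 \<alpha>) = \<alpha>"
proof (rule c0_apply_Abs)
  fix e :: real assume "e > 0"
  then have "\<forall>\<^sub>F j in sequentially. norm (\<alpha> j) < e"
    using order_tendstoD(2)[OF tendsto_norm_zero[OF assms]] by blast
  then have "finite {j. e \<le> norm (\<alpha> j)}"
    by (simp add: eventually_cofinite not_less flip: cofinite_eq_sequentially)
  then show "compact {j. e \<le> norm (\<alpha> j)}" by (rule finite_imp_compact)
qed (simp add: continuous_on_discrete)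

lemma unit_seq_expansion:
  fixes a :: "(nat, 'k::real_normed_field) c0"
  shows "(\<lambda>j. c0_scale (c0_apply a j) (unit_seq j)) sums a"
  unfolding sums_def
proof (rule metric_LIMSEQ_I)
  fix e :: real assume "e > 0"
  then have "\<forall>\<^sub>F j in sequentially. norm (c0_apply a j) < e / 2"
    using order_tendstoD(2)[OF tendsto_norm_zero[OF c0_nat_tendsto_0[of a]]] by (meson half_gt_zero)
  then obtain N where N: "\<And>j. j \<ge> N \<Longrightarrow> norm (c0_apply a j) < e / 2"
    by (auto simp: eventually_sequentially)
  have "dist (\<Sum>j<n. c0_scale (c0_apply a j) (unit_seq j)) a < e" if "n \<ge> N" for n
  proof -
    have "norm ((\<Sum>j<n. c0_scale (c0_apply a j) (unit_seq j)) - a) \<le> e / 2"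
    proof (rule norm_c0_le)
      fix i
      have "c0_apply (\<Sum>j<n. c0_scale (c0_apply a j) (unit_seq j)) i = (\<Sum>j<n. if j = i then c0_apply a i else 0)"
        unfolding c0_apply_sum by (rule sum.cong) auto
      also have "\<dots> = (if i < n then c0_apply a i else 0)" by simp
      finally show "norm (c0_apply ((\<Sum>j<n. c0_scale (c0_apply a j) (unit_seq j)) - a) i) \<le> e / 2"
        using N[of i] that \<open>e > 0\<close> by auto
    qed
    then show ?thesis using \<open>e > 0\<close> by (simp add: dist_norm)
  qed
  then show "\<exists>N. \<forall>n\<ge>N. dist (\<Sum>j<n. c0_scale (c0_apply a j) (unit_seq j)) a < e" by blast
qed

text \<open>
  Such an operator is the limit in norm of its compositions with the projections onto the first
  \<open>n\<close> coordinates.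
\<close>

lemma compact_map_if_summable:
  fixes U :: "(nat, 'k::real_or_complex) c0 \<Rightarrow>\<^sub>L ('b::topological_space, 'k) c0"
  assumes kl: "klinear U" and sm: "summable (\<lambda>j. norm (blinfun_apply U (unit_seq j)))"
  shows "compact_map U"
proof (rule compact_map_limit)
  let ?u = "\<lambda>j. norm (blinfun_apply U (unit_seq j))"
  fix e :: real assume "e > 0"
  then obtain n where n: "norm (\<Sum>i. ?u (i + n)) < e"
    using suminf_exist_split[OF \<open>e > 0\<close> sm] by blast
  define V where "V = (\<Sum>j<n. rank_one (\<lambda>a. c0_apply a j) (blinfun_apply U (unit_seq j)))"
  have V: "compact_map V" unfolding V_def
    by (intro compact_map_sum compact_rank_one[OF c0_functional_eval])
  have nn: "0 \<le> (\<Sum>i. ?u (i + n))"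
    by (intro suminf_nonneg summable_ignore_initial_segment sm norm_ge_zero)
  have "norm (U - V) \<le> (\<Sum>i. ?u (i + n))"
  proof (rule norm_blinfun_bound[OF nn])
    fix a :: "(nat, 'k) c0"
    let ?t = "\<lambda>j. c0_scale (c0_apply a j) (blinfun_apply U (unit_seq j))"
    have "(\<lambda>j. blinfun_apply U (c0_scale (c0_apply a j) (unit_seq j))) sums blinfun_apply U a"
      by (rule bounded_linear.sums[OF blinfun.bounded_linear_right unit_seq_expansion])
    then have t: "?t sums blinfun_apply U a" using kl by (simp add: klinear_def)
    have "blinfun_apply V a = (\<Sum>j<n. ?t j)"
      unfolding V_def blinfun.sum_left by (simp add: c0_functional.rank_one_apply[OF c0_functional_eval])
    then have "blinfun_apply (U - V) a = (\<Sum>j. ?t (j + n))"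
      using sums_split_initial_segment[OF t, of n] by (simp add: blinfun.diff_left sums_unique)
    also have "norm \<dots> \<le> (\<Sum>j. ?u (j + n) * norm a)"
    proof (rule norm_suminf_le)
      have "summable (\<lambda>j. ?u (j + n))" using sm by (rule summable_ignore_initial_segment)
      then show "summable (\<lambda>j. ?u (j + n) * norm a)" by (rule summable_mult2)
      show "norm (?t (j + n)) \<le> ?u (j + n) * norm a" for j
        unfolding norm_c0_scale mult.commute[of _ "norm a"]
        by (intro mult_right_mono norm_c0_apply_le norm_ge_zero)
    qed
    also have "\<dots> = (\<Sum>j. ?u (j + n)) * norm a"
      by (rule suminf_mult2[symmetric]) (rule summable_ignore_initial_segment[OF sm])
    finally show "norm (blinfun_apply (U - V) a) \<le> (\<Sum>j. ?u (j + n)) * norm a" .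
  qed
  then show "\<exists>S. compact_map S \<and> norm (U - S) \<le> e" using V n by (intro exI[of _ V]) auto
qed

lemma synthesis_operator:
  fixes g :: "nat \<Rightarrow> ('a::topological_space, 'k::real_or_complex) c0"
  assumes disj: "\<And>i j x. i \<noteq> j \<Longrightarrow> c0_apply (g i) x = 0 \<or> c0_apply (g j) x = 0"
    and bd: "\<And>i. norm (g i) \<le> C" and "0 \<le> C"
  obtains R where "klinear R" "norm R \<le> C" "\<And>j. blinfun_apply R (unit_seq j) = g j"
proof -
  let ?t = "\<lambda>a j. c0_scale (c0_apply a j) (g j)"
  have part: "norm (sum (?t a) J) \<le> C * m" if "\<And>j. j \<in> J \<Longrightarrow> norm (c0_apply a j) \<le> m" "0 \<le> m" for a J m
  proof (rule norm_disjoint_sum_le)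
    show "norm (?t a i) \<le> C * m" if "i \<in> J" for i
      using mult_mono[OF \<open>\<And>j. j \<in> J \<Longrightarrow> norm (c0_apply a j) \<le> m\<close>[OF that] bd[of i]] \<open>0 \<le> m\<close>
      by (simp add: norm_c0_scale mult.commute)
    show "c0_apply (?t a i) x = 0 \<or> c0_apply (?t a j) x = 0" if "i \<noteq> j" for i j x
      using disj[OF that, of x] by auto
  qed (use \<open>0 \<le> C\<close> \<open>0 \<le> m\<close> in simp)
  have sm: "summable (?t a)" for a
    unfolding summable_Cauchy
  proof (intro allI impI)
    fix e :: real assume e: "e > 0"
    define d where "d = e / (C + 1) / 2"
    have d: "d > 0" using e \<open>0 \<le> C\<close> by (simp add: d_def)
    have "C * d \<le> (C + 1) * d" using d by (simp add: algebra_simps)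
    also have "\<dots> = e / 2" using \<open>0 \<le> C\<close> unfolding d_def by (subst times_divide_eq_right) simp
    also have "\<dots> < e" using e by simp
    finally have Cd: "C * d < e" .
    from d have "\<forall>\<^sub>F j in sequentially. norm (c0_apply a j) < d"
      using order_tendstoD(2)[OF tendsto_norm_zero[OF c0_nat_tendsto_0[of a]]] by blast
    then obtain N where N: "\<And>j. j \<ge> N \<Longrightarrow> norm (c0_apply a j) < d"
      by (auto simp: eventually_sequentially)
    have "norm (sum (?t a) {m..<n}) < e" if "m \<ge> N" for m n
    proof -
      have "norm (sum (?t a) {m..<n}) \<le> C * d"
        by (rule part) (use N that d in \<open>auto intro!: less_imp_le\<close>)
      then show ?thesis using Cd by simp
    qed
    then show "\<exists>N. \<forall>m\<ge>N. \<forall>n. norm (sum (?t a) {m..<n}) < e" by blast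
  qed
  define R where "R = Blinfun (\<lambda>a. \<Sum>j. ?t a j)"
  have scaleR_scale: "r *\<^sub>R f = c0_scale (of_real r) f" for r and f :: "('a, 'k) c0"
    by (simp add: c0_scale_of_real)
  have "bounded_linear (\<lambda>a. \<Sum>j. ?t a j)"
  proof (rule bounded_linear_intro)
    show "(\<Sum>j. ?t (a + b) j) = (\<Sum>j. ?t a j) + (\<Sum>j. ?t b j)" for a b
      by (simp add: c0_scale_algebra suminf_add[OF sm sm])
    show "(\<Sum>j. ?t (r *\<^sub>R a) j) = r *\<^sub>R (\<Sum>j. ?t a j)" for r a
      using bounded_linear.suminf[OF bounded_linear_scaleR_right sm, of r a]
      by (simp add: scaleR_scale c0_scale_algebra scaleR_conv_of_real)
    show "norm (\<Sum>j. ?t a j) \<le> norm a * C" for a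
    proof (rule LIMSEQ_le_const2)
      show "(\<lambda>n. norm (\<Sum>j<n. ?t a j)) \<longlonglongrightarrow> norm (\<Sum>j. ?t a j)"
        by (intro tendsto_norm summable_LIMSEQ sm)
      show "\<exists>N. \<forall>n\<ge>N. norm (\<Sum>j<n. ?t a j) \<le> norm a * C"
        using part[of _ a "norm a"] norm_c0_apply_le[of a] by (simp add: mult.commute)
    qed
  qed
  then have R: "blinfun_apply R a = (\<Sum>j. ?t a j)" for a
    by (simp add: R_def bounded_linear_Blinfun_apply)
  have bl: "bounded_linear (c0_scale c :: ('a, 'k) c0 \<Rightarrow> _)" for c
    by (rule bounded_linear_intro[where K = "norm c"]) (auto simp: c0_scale_algebra norm_c0_scale)
  have "klinear R"
    unfolding klinear_def R using bounded_linear.suminf[OF bl sm] by (simp add: c0_scale_algebra)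
  moreover have "norm R \<le> C"
  proof (rule norm_blinfun_bound[OF \<open>0 \<le> C\<close>])
    fix a
    show "norm (blinfun_apply R a) \<le> C * norm a" unfolding R
    proof (rule LIMSEQ_le_const2)
      show "(\<lambda>n. norm (\<Sum>j<n. ?t a j)) \<longlonglongrightarrow> norm (\<Sum>j. ?t a j)"
        by (intro tendsto_norm summable_LIMSEQ sm)
      show "\<exists>N. \<forall>n\<ge>N. norm (\<Sum>j<n. ?t a j) \<le> C * norm a"
        using part[of _ a "norm a"] norm_c0_apply_le[of a] by simp
    qed
  qed
  moreover have "blinfun_apply R (unit_seq j) = g j" for j
  proof -
    have "(\<Sum>i. ?t (unit_seq j) i) = (\<Sum>i\<in>{j}. ?t (unit_seq j) i)"
      by (rule suminf_finite) (auto intro!: c0_eqI)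
    then show ?thesis by (simp add: R c0_scale_algebra)
  qed
  ultimately show ?thesis using that by blast
qed

lemma analysis_operator:
  fixes \<phi> :: "nat \<Rightarrow> ('a::topological_space, 'k::real_or_complex) c0 \<Rightarrow> 'k"
  assumes \<phi>: "\<And>i. c0_functional (\<phi> i) B" and null: "\<And>g. (\<lambda>i. \<phi> i g) \<longlonglongrightarrow> 0"
  obtains S :: "('a, 'k) c0 \<Rightarrow>\<^sub>L (nat, 'k) c0"
  where "klinear S" "norm S \<le> B" "\<And>g i. c0_apply (blinfun_apply S g) i = \<phi> i g"
proof -
  define S where "S = Blinfun (\<lambda>g. Abs_c0 (\<lambda>i. \<phi> i g))"
  note ap = c0_apply_null_sequence[OF null]
  have sc: "\<phi> i (r *\<^sub>R g) = r *\<^sub>R \<phi> i g" for i r g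
    using c0_functional.scale[OF \<phi>, of i "of_real r" g] by (simp add: c0_scale_of_real scaleR_conv_of_real)
  have nb: "norm (Abs_c0 (\<lambda>i. \<phi> i g)) \<le> B * norm g" for g
    by (rule norm_c0_le) (simp add: ap c0_functional.bound[OF \<phi>])
  have "bounded_linear (\<lambda>g. Abs_c0 (\<lambda>i. \<phi> i g))"
  proof (rule bounded_linear_intro)
    show "Abs_c0 (\<lambda>i. \<phi> i (f + g)) = Abs_c0 (\<lambda>i. \<phi> i f) + Abs_c0 (\<lambda>i. \<phi> i g)" for f g
      by (rule c0_eqI) (unfold plus_c0.rep_eq ap, rule c0_functional.add[OF \<phi>])
    show "Abs_c0 (\<lambda>i. \<phi> i (r *\<^sub>R g)) = r *\<^sub>R Abs_c0 (\<lambda>i. \<phi> i g)" for r g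
      by (rule c0_eqI) (unfold scaleR_c0.rep_eq ap, rule sc)
    show "norm (Abs_c0 (\<lambda>i. \<phi> i g)) \<le> norm g * B" for g
      using nb[of g] by (simp add: mult.commute)
  qed
  then have S: "blinfun_apply S g = Abs_c0 (\<lambda>i. \<phi> i g)" for g
    by (simp add: S_def bounded_linear_Blinfun_apply)
  show ?thesis
  proof (rule that)
    show "klinear S" unfolding klinear_def S
      by (intro allI c0_eqI) (unfold c0_scale.rep_eq ap, rule c0_functional.scale[OF \<phi>])
    show "norm S \<le> B"
      using nb c0_functional.B_nonneg[OF \<phi>] by (intro norm_blinfun_bound) (simp_all add: S)
    show "c0_apply (blinfun_apply S g) i = \<phi> i g" for g i by (simp add: S ap)
  qed
qed

text \<open>
  A matrix whose rows, columns and diagonal tend to zero has a submatrix with geometric decay.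
  The next index is chosen so large that the new entries in the earlier rows and on the diagonal
  are at most \<open>2\<^sup>-\<^sup>p\<^sup>-\<^sup>1\<close>, where \<open>p\<close> is the previous index, and those in each earlier column \<open>j\<close> at most \<open>2\<^sup>-\<^sup>j\<close>.
\<close>

lemma sparse_subsequence:
  fixes d :: "nat \<Rightarrow> nat \<Rightarrow> 'k::real_normed_vector"
  assumes rows: "\<And>i. (\<lambda>j. d i j) \<longlonglongrightarrow> 0" and cols: "\<And>j. (\<lambda>i. d i j) \<longlonglongrightarrow> 0"
    and diag: "(\<lambda>i. d i i) \<longlonglongrightarrow> 0"
  obtains r where "strict_mono r" "\<And>i j. norm (d (r i) (r j)) \<le> (1/2) ^ j"
proof -
  have ev: "\<forall>\<^sub>F n in sequentially. norm (f n) \<le> e" if "f \<longlonglongrightarrow> 0" "e > 0" for f :: "nat \<Rightarrow> 'k" and e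
    using order_tendstoD(2)[OF tendsto_norm_zero[OF that(1)] that(2)]
    by (rule eventually_mono) (rule less_imp_le)
  have "\<forall>\<^sub>F n in sequentially. p < n \<and> (\<forall>i\<in>{..p}. norm (d i n) \<le> (1/2) ^ Suc p) \<and>
      (\<forall>j\<in>{..p}. norm (d n j) \<le> (1/2) ^ j) \<and> norm (d n n) \<le> (1/2) ^ Suc p" for p
  proof (intro eventually_conj)
    show "\<forall>\<^sub>F n in sequentially. p < n" by (rule eventually_gt_at_top)
    show "\<forall>\<^sub>F n in sequentially. \<forall>i\<in>{..p}. norm (d i n) \<le> (1/2) ^ Suc p"
      by (intro eventually_ball_finite ballI ev[OF rows]) simp_all
    show "\<forall>\<^sub>F n in sequentially. \<forall>j\<in>{..p}. norm (d n j) \<le> (1/2) ^ j"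
      by (intro eventually_ball_finite ballI ev[OF cols]) simp_all
    show "\<forall>\<^sub>F n in sequentially. norm (d n n) \<le> (1/2) ^ Suc p"
      by (intro ev[OF diag]) simp
  qed
  then have "\<exists>n. p < n \<and> (\<forall>i\<in>{..p}. norm (d i n) \<le> (1/2) ^ Suc p) \<and>
      (\<forall>j\<in>{..p}. norm (d n j) \<le> (1/2) ^ j) \<and> norm (d n n) \<le> (1/2) ^ Suc p" for p
    by (rule eventually_happens'[OF sequentially_bot])
  then obtain f where f: "\<And>p. p < f p" "\<And>p i. i \<le> p \<Longrightarrow> norm (d i (f p)) \<le> (1/2) ^ Suc p"
    "\<And>p j. j \<le> p \<Longrightarrow> norm (d (f p) j) \<le> (1/2) ^ j" "\<And>p. norm (d (f p) (f p)) \<le> (1/2) ^ Suc p"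
    unfolding atMost_iff Ball_def by metis
  define r where "r n = (f ^^ n) (f 0)" for n
  have rSuc: "r (Suc n) = f (r n)" for n by (simp add: r_def)
  have mono: "strict_mono r" by (rule strict_mono_Suc_iff[THEN iffD2]) (simp add: rSuc f)
  have ge: "n \<le> r n" for n using mono by (rule strict_mono_imp_increasing)
  have pow: "(1/2::real) ^ m \<le> (1/2) ^ n" if "n \<le> m" for m n
    using that by (intro power_decreasing) auto
  have "norm (d (r i) (r j)) \<le> (1/2) ^ j" for i j
  proof (cases i j rule: linorder_cases)
    case less
    then obtain j' where j': "j = Suc j'" "i \<le> j'" by (cases j) auto
    then have "r i \<le> r j'" using mono by (simp add: strict_mono_less_eq)
    then have "norm (d (r i) (r j)) \<le> (1/2) ^ Suc (r j')" using f(2) j' by (simp add: rSuc)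
    also have "\<dots> \<le> (1/2) ^ j" using ge[of j'] j' by (intro pow) simp
    finally show ?thesis .
  next
    case greater
    then obtain i' where i': "i = Suc i'" "j \<le> i'" by (cases i) auto
    then have "r j \<le> r i'" using mono by (simp add: strict_mono_less_eq)
    then have "norm (d (r i) (r j)) \<le> (1/2) ^ r j" using f(3) i' by (simp add: rSuc)
    also have "\<dots> \<le> (1/2) ^ j" using ge by (rule pow)
    finally show ?thesis .
  next
    case equal
    show ?thesis
    proof (cases j)
      case 0
      then show ?thesis using equal f(4)[of 0] by (simp add: r_def)
    next
      case (Suc j')
      then have "norm (d (r i) (r j)) \<le> (1/2) ^ Suc (r j')" using f(4) equal by (simp add: rSuc)
      also have "\<dots> \<le> (1/2) ^ j" using ge[of j'] Suc by (intro pow) simp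
      finally show ?thesis .
    qed
  qed
  then show ?thesis using mono that by blast
qed

section \<open>Factoring the identity of the space of null sequences\<close>

context scattered_lc_space
begin

text \<open>
  The limit \<open>L\<close> is the evaluation at the limit of the points, or zero if they tend to infinity.
\<close>

lemma subsequence_of_evaluations_converges:
  fixes x :: "nat \<Rightarrow> 'a"
  obtains r L where "strict_mono (r :: nat \<Rightarrow> nat)" "c0_functional (L :: ('a, 'k::real_normed_field) c0 \<Rightarrow> 'k) 1"
    "\<And>g. (\<lambda>n. c0_apply g (x (r n))) \<longlonglongrightarrow> L g"
proof (cases rule: convergent_subsequence_or_escaping[of x])
  case (limit y r)
  show ?thesis
  proof (rule that)
    show "c0_functional (\<lambda>g. c0_apply g y) 1" by (rule c0_functional_eval)
    fix g :: "('a, 'k) c0"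
    have "isCont (c0_apply g) y"
      using continuous_on_c0_apply[of g] by (simp add: continuous_on_eq_continuous_at)
    then show "(\<lambda>n. c0_apply g (x (r n))) \<longlonglongrightarrow> c0_apply g y"
      using isCont_tendsto_compose limit(2) by (fastforce simp: o_def)
  qed (rule limit(1))
next
  case escape
  show ?thesis
  proof (rule that)
    show "strict_mono (id :: nat \<Rightarrow> nat)" by (simp add: strict_mono_def)
    show "c0_functional (\<lambda>g :: ('a, 'k) c0. 0) 1" by unfold_locales auto
    fix g :: "('a, 'k) c0"
    show "(\<lambda>n. c0_apply g (x (id n))) \<longlonglongrightarrow> 0"
    proof (rule tendsto_norm_zero_cancel, rule order_tendstoI)
      show "\<forall>\<^sub>F j in sequentially. e < norm (c0_apply g (x (id j)))" if "e < 0" for e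
        using that by (intro always_eventually) (metis less_le_trans norm_ge_zero)
      show "\<forall>\<^sub>F j in sequentially. norm (c0_apply g (x (id j))) < e" if "0 < e" for e
        using escape[OF compact_c0_superlevel[OF that, of g]] by eventually_elim simp
    qed
  qed
qed

text \<open>
  Let \<open>g\<^sub>j\<close> be the disjoint bumps, normalised so that \<open>T g\<^sub>j\<close> has value 1 at \<open>x\<^sub>j\<close>, and let \<open>L\<close> be the
  limit of the evaluations at \<open>x\<^sub>i\<close>. Then \<open>R\<close> maps the unit vectors to the \<open>g\<^sub>j\<close>, and \<open>S h\<close> is the
  null sequence of the numbers \<open>h(x\<^sub>i) - L(h)\<close>. The matrix \<open>d\<close> of \<open>S T R - I\<close> satisfies the
  conditions of \<open>sparse_subsequence\<close>: its rows tend to zero since functionals tend to zero along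
  disjoint bumps, its columns by the choice of \<open>L\<close>.
\<close>

theorem identity_factors_modulo_compact:
  fixes T :: "('a, 'k::real_or_complex) c0_op"
  assumes ess: "1 < essential_norm T"
  obtains R :: "(nat, 'k) c0 \<Rightarrow>\<^sub>L ('a, 'k) c0" and S :: "('a, 'k) c0 \<Rightarrow>\<^sub>L (nat, 'k) c0"
  where "klinear R" "klinear S" "norm R \<le> 4" "norm S \<le> 2"
    "compact_map ((S o\<^sub>L c0_op_blinfun T o\<^sub>L R) - id_blinfun)"
proof (rule disjoint_bumps[OF ess])
  fix f0 :: "nat \<Rightarrow> ('a, 'k) c0" and x0 :: "nat \<Rightarrow> 'a"
  assume f0: "\<And>n. norm (f0 n) \<le> 1" "\<And>n. 1 / 4 \<le> norm (c0_apply (c0_op_apply T (f0 n)) (x0 n))"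
    "\<And>m n y. m \<noteq> n \<Longrightarrow> c0_apply (f0 m) y = 0 \<or> c0_apply (f0 n) y = 0"
  obtain s and L :: "('a, 'k) c0 \<Rightarrow> 'k" where s: "strict_mono (s :: nat \<Rightarrow> nat)" "c0_functional L 1"
    "\<And>g. (\<lambda>n. c0_apply g (x0 (s n))) \<longlonglongrightarrow> L g"
    using subsequence_of_evaluations_converges[of x0] by metis
  interpret L: c0_functional L 1 by (rule s)
  define x where "x n = x0 (s n)" for n
  define c where "c n = c0_apply (c0_op_apply T (f0 (s n))) (x n)" for n
  have c: "1 / 4 \<le> norm (c n)" for n using f0(2) by (simp add: c_def x_def)
  have c0: "c n \<noteq> 0" for n using c[of n] by auto
  define g where "g n = c0_scale (inverse (c n)) (f0 (s n))" for n
  have g_norm: "norm (g n) \<le> 4" for n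
  proof -
    have "inverse (norm (c n)) \<le> 4" using c[of n] le_imp_inverse_le[of "1/4" "norm (c n)"] by simp
    then have "inverse (norm (c n)) * norm (f0 (s n)) \<le> 4 * 1"
      using f0(1) by (intro mult_mono) auto
    then show ?thesis by (simp add: g_def norm_c0_scale norm_inverse)
  qed
  have g_disj: "c0_apply (g m) y = 0 \<or> c0_apply (g n) y = 0" if "m \<noteq> n" for m n y
  proof -
    have "s m \<noteq> s n" using that s(1) by (simp add: strict_mono_eq)
    then show ?thesis using f0(3)[of "s m" "s n" y] by (auto simp: g_def)
  qed
  have g_diag: "c0_apply (c0_op_apply T (g n)) (x n) = 1" for n
    using c0[of n] by (simp add: g_def) (simp add: c_def)
  have LT: "c0_functional (\<lambda>f. L (c0_op_apply T f)) (norm T)"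
  proof
    show "norm (L (c0_op_apply T f)) \<le> norm T * norm f" for f
      using L.bound[of "c0_op_apply T f"] norm_c0_op_apply_le[of T f] by simp
  qed (simp_all add: L.add L.scale linear_simps[OF bounded_linear_c0_op_apply])
  define d where "d i j = c0_apply (c0_op_apply T (g j)) (x i) - L (c0_op_apply T (g j)) - (if i = j then 1 else 0)" for i j
  have LT0: "(\<lambda>j. L (c0_op_apply T (g j))) \<longlonglongrightarrow> 0"
    using g_disj g_norm by (intro c0_functional.disjoint_tendsto_0[OF LT, of g 4]) auto
  have rows: "(\<lambda>j. d i j) \<longlonglongrightarrow> 0" for i
  proof -
    have "(\<lambda>j. c0_apply (c0_op_apply T (g j)) (x i)) \<longlonglongrightarrow> 0"
      using g_disj g_norm by (intro c0_functional.disjoint_tendsto_0[OF c0_functional_eval_op, of g 4]) auto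
    moreover have "(\<lambda>j. if i = j then 1 else 0 :: 'k) \<longlonglongrightarrow> 0"
      by (rule tendsto_eventually) (auto intro: eventually_mono[OF eventually_gt_at_top[of i]])
    ultimately show ?thesis unfolding d_def using LT0 by (auto intro!: tendsto_eq_intros)
  qed
  have cols: "(\<lambda>i. d i j) \<longlonglongrightarrow> 0" for j
  proof -
    have "(\<lambda>i. if i = j then 1 else 0 :: 'k) \<longlonglongrightarrow> 0"
      by (rule tendsto_eventually) (auto intro: eventually_mono[OF eventually_gt_at_top[of j]])
    moreover have "(\<lambda>i. c0_apply (c0_op_apply T (g j)) (x i)) \<longlonglongrightarrow> L (c0_op_apply T (g j))"
      unfolding x_def by (rule s(3))
    ultimately show ?thesis unfolding d_def by (auto intro!: tendsto_eq_intros)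
  qed
  have diag: "(\<lambda>i. d i i) \<longlonglongrightarrow> 0"
    using tendsto_minus[OF LT0] by (simp add: d_def g_diag)
  obtain r where r: "strict_mono r" "\<And>i j. norm (d (r i) (r j)) \<le> (1/2) ^ j"
    using sparse_subsequence[OF rows cols diag] by blast
  have r_eq: "r i = r j \<longleftrightarrow> i = j" for i j using r(1) by (simp add: strict_mono_eq)
  obtain R where R: "klinear R" "norm R \<le> 4" "\<And>j. blinfun_apply R (unit_seq j) = g (r j)"
    by (rule synthesis_operator[of "\<lambda>j. g (r j)" 4]) (use g_disj g_norm r_eq in auto)
  have fun2: "c0_functional (\<lambda>h. c0_apply h (x (r i)) - L h) 2" for i
  proof
    show "norm (c0_apply h (x (r i)) - L h) \<le> 2 * norm h" for h
      using norm_triangle_ineq4[of "c0_apply h (x (r i))" "L h"] norm_c0_apply_le[of h "x (r i)"] L.bound[of h] by simp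
  qed (simp_all add: L.add L.scale algebra_simps)
  have null: "(\<lambda>i. c0_apply h (x (r i)) - L h) \<longlonglongrightarrow> 0" for h
    using LIMSEQ_subseq_LIMSEQ[OF s(3)[of h] r(1)] by (simp add: x_def o_def LIM_zero)
  obtain S :: "('a, 'k) c0 \<Rightarrow>\<^sub>L (nat, 'k) c0" where S: "klinear S" "norm S \<le> 2"
    "\<And>h i. c0_apply (blinfun_apply S h) i = c0_apply h (x (r i)) - L h"
    by (rule analysis_operator[where \<phi> = "\<lambda>i h. c0_apply h (x (r i)) - L h", OF fun2 null]) blast
  let ?U = "(S o\<^sub>L c0_op_blinfun T o\<^sub>L R) - id_blinfun"
  have "compact_map ?U"
  proof (rule compact_map_if_summable)
    show "klinear ?U" by (intro klinear_ops S R klinear_c0_op_blinfun)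
    have "norm (blinfun_apply ?U (unit_seq j)) \<le> (1/2) ^ j" for j
    proof (rule norm_c0_le)
      fix i
      have "c0_apply (blinfun_apply ?U (unit_seq j)) i = d (r i) (r j)"
        by (simp add: blinfun.diff_left R S d_def r_eq flip: c0_op_apply.rep_eq)
      then show "norm (c0_apply (blinfun_apply ?U (unit_seq j)) i) \<le> (1/2) ^ j" using r(2) by simp
    qed
    then show "summable (\<lambda>j. norm (blinfun_apply ?U (unit_seq j)))"
      by (intro summable_comparison_test'[OF summable_geometric[of "1/2::real"], of 0]) auto
  qed
  then show ?thesis using that[of R S] R S by blast
qed

end

section \<open>The essential norm is a complete algebra norm\<close>

lemma norm_c0_op_scale: "norm (c0_op_scale c T) \<le> norm c * norm T"
proof -
  have "norm (blinfun_apply (c0_op_blinfun (c0_op_scale c T)) f) \<le> norm c * norm T * norm f" for f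
    using mult_left_mono[OF norm_c0_op_apply_le[of T f] norm_ge_zero[of c]]
    by (simp add: norm_c0_scale mult.assoc flip: c0_op_apply.rep_eq)
  then show ?thesis unfolding norm_c0_op.rep_eq[of "c0_op_scale c T"]
    by (intro norm_blinfun_bound mult_nonneg_nonneg norm_ge_zero)
qed

lemma essential_norm_approx:
  assumes "e > 0"
  obtains S where "compact_op S" "norm (T - S) < essential_norm T + e"
proof -
  have "{norm (T - S) |S. compact_op S} \<noteq> {}" by (auto intro: exI[of _ 0])
  then obtain s where "s \<in> {norm (T - S) |S. compact_op S}" "s < essential_norm T + e"
    using cInf_lessD[of "{norm (T - S) |S. compact_op S}" "essential_norm T + e"] assms
    unfolding essential_norm_def by auto
  then show ?thesis using that by blast
qed

lemma essential_norm_eq_0_iff: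
  fixes T :: "('a::topological_space, 'k::real_or_complex) c0_op"
  shows "essential_norm T = 0 \<longleftrightarrow> compact_op T"
proof
  assume T: "essential_norm T = 0"
  show "compact_op T" unfolding compact_op_iff
  proof (rule compact_map_limit)
    fix e :: real assume "e > 0"
    then obtain S where "compact_op S" "norm (T - S) < e"
      using essential_norm_approx[of e T] T by auto
    then show "\<exists>S. compact_map S \<and> norm (c0_op_blinfun T - S) \<le> e"
      by (intro exI[of _ "c0_op_blinfun S"])
        (simp add: compact_op_iff norm_c0_op.rep_eq minus_c0_op.rep_eq)
  qed
next
  assume "compact_op T"
  then show "essential_norm T = 0"
    using essential_norm_le[of T T] essential_norm_nonneg[of T] by simp
qed

lemma essential_norm_add: "essential_norm (S + T) \<le> essential_norm S + essential_norm T"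
proof (rule field_le_epsilon)
  fix e :: real assume "e > 0"
  then have "e / 2 > 0" by simp
  obtain A where A: "compact_op A" "norm (S - A) < essential_norm S + e / 2"
    using essential_norm_approx[OF \<open>e / 2 > 0\<close>] by blast
  obtain B where B: "compact_op B" "norm (T - B) < essential_norm T + e / 2"
    using essential_norm_approx[OF \<open>e / 2 > 0\<close>] by blast
  have "essential_norm (S + T) \<le> norm ((S + T) - (A + B))"
    by (intro essential_norm_le compact_op_add A B)
  also have "\<dots> = norm ((S - A) + (T - B))" by (simp add: algebra_simps)
  also have "\<dots> \<le> norm (S - A) + norm (T - B)" by (rule norm_triangle_ineq)
  finally show "essential_norm (S + T) \<le> essential_norm S + essential_norm T + e"
    using A B by simp
qed

lemma essential_norm_mult: "essential_norm (S * T) \<le> essential_norm S * essential_norm T"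
proof -
  let ?s = "essential_norm S" and ?t = "essential_norm T"
  have le: "essential_norm (S * T) \<le> (?s + e) * (?t + e)" if e: "e > 0" for e
  proof -
    obtain A where A: "compact_op A" "norm (S - A) < ?s + e"
      using essential_norm_approx[OF e] by blast
    obtain B where B: "compact_op B" "norm (T - B) < ?t + e"
      using essential_norm_approx[OF e] by blast
    \<comment> \<open>\<open>(S - A) (T - B)\<close> differs from \<open>S T\<close> by this operator.\<close>
    have "compact_op (A * T + (S - A) * B)"
      by (intro compact_op_add compact_op_mult_left compact_op_mult_right A B)
    then have "essential_norm (S * T) \<le> norm (S * T - (A * T + (S - A) * B))"
      by (rule essential_norm_le)
    also have "\<dots> = norm ((S - A) * (T - B))" by (simp add: algebra_simps)
    also have "\<dots> \<le> norm (S - A) * norm (T - B)" by (rule norm_mult_ineq)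
    also have "\<dots> \<le> (?s + e) * (?t + e)"
      using A B essential_norm_nonneg[of S] e by (intro mult_mono) auto
    finally show ?thesis .
  qed
  have "((\<lambda>e. (?s + e) * (?t + e)) \<longlongrightarrow> (?s + 0) * (?t + 0)) (at_right 0)"
    by (intro tendsto_intros)
  then have "essential_norm (S * T) \<le> (?s + 0) * (?t + 0)"
    by (rule tendsto_lowerbound) (auto simp: eventually_at_right_less le eventually_at_filter)
  then show ?thesis by simp
qed

lemma essential_norm_scale: "essential_norm (c0_op_scale c T) = norm c * essential_norm T"
proof -
  have le: "essential_norm (c0_op_scale c T) \<le> norm c * essential_norm T" for c T
  proof (rule field_le_epsilon)
    fix e :: real assume e: "e > 0"
    then have "e / (norm c + 1) > 0" by (simp add: add_nonneg_pos)
    then obtain A where A: "compact_op A" "norm (T - A) < essential_norm T + e / (norm c + 1)"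
      using essential_norm_approx by blast
    have "essential_norm (c0_op_scale c T) \<le> norm (c0_op_scale c T - c0_op_scale c A)"
      by (intro essential_norm_le compact_op_scale A)
    also have "c0_op_scale c T - c0_op_scale c A = c0_op_scale c (T - A)"
      by (rule c0_op_eqI) (simp add: c0_scale_algebra)
    also have "norm \<dots> \<le> norm c * norm (T - A)" by (rule norm_c0_op_scale)
    also have "\<dots> \<le> norm c * (essential_norm T + e / (norm c + 1))"
      using A by (intro mult_left_mono) auto
    also have "\<dots> = norm c * essential_norm T + e * (norm c / (norm c + 1))"
      by (simp add: algebra_simps)
    also have "\<dots> \<le> norm c * essential_norm T + e * 1"
      using e by (intro add_left_mono mult_left_mono) (auto simp: divide_le_eq_1 add_nonneg_pos)
    finally show "essential_norm (c0_op_scale c T) \<le> norm c * essential_norm T + e" by simp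
  qed
  show ?thesis
  proof (cases "c = 0")
    case True
    then show ?thesis using le[of c T] essential_norm_nonneg[of "c0_op_scale c T"] by simp
  next
    case False
    then have "essential_norm T \<le> inverse (norm c) * essential_norm (c0_op_scale c T)"
      using le[of "inverse c" "c0_op_scale c T"] by (simp add: c0_op_scale_algebra norm_inverse)
    then have "norm c * essential_norm T \<le> essential_norm (c0_op_scale c T)"
      using False by (simp add: field_simps)
    then show ?thesis using le[of c T] by simp
  qed
qed

lemma calkin_cases: obtains T where "x = to_calkin T"
  by (metis Quotient_abs_rep Quotient_calkin)

lemma to_calkin_ops:
  "to_calkin (S + T) = to_calkin S + to_calkin T"
  "to_calkin (S - T) = to_calkin S - to_calkin T"
  "to_calkin (S * T) = to_calkin S * to_calkin T"
  "to_calkin (c0_op_scale c T) = calkin_scale c (to_calkin T)"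
  "to_calkin 0 = 0"
  by (simp_all add: plus_calkin.abs_eq minus_calkin.abs_eq times_calkin.abs_eq calkin_scale.abs_eq zero_calkin_def)

lemma to_calkin_eq_0_iff: "to_calkin T = 0 \<longleftrightarrow> compact_op T"
  using to_calkin_eq_iff[of T 0] by (simp add: to_calkin_ops)

theorem algebra_norm_calkin_norm:
  "algebra_norm calkin_scale (calkin_norm :: ('a::topological_space, 'k::real_or_complex) calkin \<Rightarrow> real)"
  unfolding algebra_norm_def
proof (intro conjI allI)
  fix x y :: "('a, 'k) calkin" and c :: 'k
  obtain S T where xy: "x = to_calkin S" "y = to_calkin T" by (metis calkin_cases)
  show "0 \<le> calkin_norm x" by (simp add: xy essential_norm_nonneg)
  show "calkin_norm x = 0 \<longleftrightarrow> x = 0" by (simp add: xy essential_norm_eq_0_iff to_calkin_eq_0_iff)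
  show "calkin_norm (x + y) \<le> calkin_norm x + calkin_norm y"
    by (simp add: xy essential_norm_add flip: to_calkin_ops)
  show "calkin_norm (x * y) \<le> calkin_norm x * calkin_norm y"
    by (simp add: xy essential_norm_mult flip: to_calkin_ops)
  show "calkin_norm (calkin_scale c x) = norm c * calkin_norm x"
    by (simp add: xy essential_norm_scale flip: to_calkin_ops)
qed

lemma klinear_limit:
  fixes X :: "nat \<Rightarrow> ('a::topological_space, 'k::real_normed_field) c0 \<Rightarrow>\<^sub>L ('b::topological_space, 'k) c0"
  assumes "\<And>n. klinear (X n)" "X \<longlonglongrightarrow> T"
  shows "klinear T"
  unfolding klinear_def
proof (intro allI)
  fix c :: 'k and f :: "('a, 'k) c0"
  have lim: "(\<lambda>n. blinfun_apply (X n) g) \<longlonglongrightarrow> blinfun_apply T g" for g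
    by (intro bounded_linear.tendsto[OF blinfun.bounded_linear_left] assms)
  have "bounded_linear (c0_scale c :: ('b, 'k) c0 \<Rightarrow> _)"
    by (rule bounded_linear_intro[where K = "norm c"]) (auto simp: c0_scale_algebra norm_c0_scale)
  then have "(\<lambda>n. c0_scale c (blinfun_apply (X n) f)) \<longlonglongrightarrow> c0_scale c (blinfun_apply T f)"
    by (rule bounded_linear.tendsto) (rule lim)
  then show "blinfun_apply T (c0_scale c f) = c0_scale c (blinfun_apply T f)"
    using lim[of "c0_scale c f"] assms(1) LIMSEQ_unique unfolding klinear_def by fastforce
qed

instance c0_op :: (topological_space, real_or_complex) banach
proof
  fix X :: "nat \<Rightarrow> ('a, 'b) c0_op"
  assume X: "Cauchy X"
  have d: "dist (c0_op_blinfun S) (c0_op_blinfun T) = dist S T" for S T :: "('a, 'b) c0_op"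
    by (simp add: dist_norm dist_c0_op_def norm_c0_op.rep_eq minus_c0_op.rep_eq)
  have "Cauchy (\<lambda>n. c0_op_blinfun (X n))" using X by (simp add: Cauchy_def d)
  then obtain T where T: "(\<lambda>n. c0_op_blinfun (X n)) \<longlonglongrightarrow> T"
    using Cauchy_convergent_iff convergent_def by blast
  then have "klinear T" by (rule klinear_limit[rotated]) (rule klinear_c0_op_blinfun)
  then have "T = c0_op_blinfun (Abs_c0_op T)" by (simp add: c0_op_blinfun_inverse_klinear)
  then have "X \<longlonglongrightarrow> Abs_c0_op T"
    using T d by (metis (no_types, lifting) LIMSEQ_def)
  then show "convergent X" by (rule convergentI)
qed

lemma algebra_normD:
  assumes "algebra_norm smul p"
  shows "0 \<le> p x" "p x = 0 \<longleftrightarrow> x = 0" "p (x + y) \<le> p x + p y"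
    "p (smul c x) = norm c * p x" "p (x * y) \<le> p x * p y"
  using assms unfolding algebra_norm_def by blast+

lemma calkin_algebra_norm_minus:
  assumes "algebra_norm calkin_scale p"
  shows "p (x - y) = p (y - x)"
proof -
  obtain S T where "x = to_calkin S" "y = to_calkin T" by (metis calkin_cases)
  moreover have "c0_op_scale (- 1) (S - T) = T - S" by (rule c0_op_eqI, rule c0_eqI) simp
  ultimately have "y - x = calkin_scale (- 1) (x - y)" by (simp flip: to_calkin_ops)
  then show ?thesis using algebra_normD(4)[OF assms, of "- 1" "x - y"] by simp
qed

text \<open>
  The usual argument for quotients: lift the differences of a rapidly converging subsequence to
  operators with summable norms.
\<close>

theorem complete_norm_calkin_norm:
  "complete_norm (calkin_norm :: ('a::topological_space, 'k::real_or_complex) calkin \<Rightarrow> real)"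
  unfolding complete_norm_def
proof (intro allI impI)
  fix X :: "nat \<Rightarrow> ('a, 'k) calkin"
  assume X: "\<forall>e>0. \<exists>N. \<forall>m\<ge>N. \<forall>n\<ge>N. calkin_norm (X m - X n) < e"
  note nrm = algebra_normD[OF algebra_norm_calkin_norm]
  have "\<exists>N. \<forall>m\<ge>N. \<forall>n\<ge>N. calkin_norm (X m - X n) < (1/2) ^ k" for k using X by simp
  then obtain N where N: "\<And>k m n. m \<ge> N k \<Longrightarrow> n \<ge> N k \<Longrightarrow> calkin_norm (X m - X n) < (1/2) ^ k" by metis
  define r where "r k = (\<Sum>i\<le>k. N i)" for k
  have r: "r l \<ge> N k" if "k \<le> l" for k l
    unfolding r_def using that by (intro member_le_sum) auto
  have "\<exists>D. to_calkin D = X (r (Suc k)) - X (r k) \<and> norm D < (1/2) ^ k" for k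
  proof -
    obtain D0 where D0: "X (r (Suc k)) - X (r k) = to_calkin D0" by (rule calkin_cases)
    have "essential_norm D0 < (1/2) ^ k" using N[OF r r, of k "Suc k" k] by (simp add: D0)
    then obtain S where S: "compact_op S" "norm (D0 - S) < (1/2) ^ k"
      using essential_norm_approx[of "(1/2) ^ k - essential_norm D0" D0] by auto
    have "to_calkin (D0 - S) = to_calkin D0"
      using compact_op_uminus[OF S(1)] by (simp add: to_calkin_eq_iff)
    then show ?thesis using S D0 by metis
  qed
  then obtain D where D: "\<And>k. to_calkin (D k) = X (r (Suc k)) - X (r k)" "\<And>k. norm (D k) < (1/2) ^ k" by metis
  have sm: "summable D"
    by (rule summable_norm_cancel, rule summable_comparison_test'[OF summable_geometric[of "1/2::real"], of 0])
      (use D(2) in \<open>auto intro: less_imp_le\<close>)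
  define x where "x = X (r 0) + to_calkin (suminf D)"
  have part: "X (r n) = X (r 0) + to_calkin (\<Sum>k<n. D k)" for n
    by (induction n) (simp_all add: to_calkin_ops D)
  have le: "calkin_norm (X (r n) - x) \<le> norm ((\<Sum>k<n. D k) - suminf D)" for n
  proof -
    have "X (r n) - x = to_calkin ((\<Sum>k<n. D k) - suminf D)"
      unfolding part[of n] x_def to_calkin_ops by simp
    then show ?thesis using essential_norm_le[of 0 "(\<Sum>k<n. D k) - suminf D"] by simp
  qed
  have "(\<lambda>n. calkin_norm (X n - x)) \<longlonglongrightarrow> 0"
  proof (rule LIMSEQ_I)
    fix e :: real assume "e > 0"
    then have "e / 2 > 0" by simp
    obtain M where M: "\<And>m n. m \<ge> M \<Longrightarrow> n \<ge> M \<Longrightarrow> calkin_norm (X m - X n) < e / 2"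
      using X \<open>e / 2 > 0\<close> by blast
    obtain n1 where n1: "\<And>n. n \<ge> n1 \<Longrightarrow> norm ((\<Sum>k<n. D k) - suminf D) < e / 2"
      using LIMSEQ_D[OF summable_LIMSEQ[OF sm] \<open>e / 2 > 0\<close>] by blast
    obtain k0 where k0: "(1/2::real) ^ k0 < e / 2"
      using real_arch_pow_inv[OF \<open>e / 2 > 0\<close>, of "1/2"] by auto
    let ?n = "max n1 k0"
    have "norm (calkin_norm (X m - x) - 0) < e" if m: "m \<ge> N k0" for m
    proof -
      have "N k0 \<le> r ?n" by (intro r) simp
      then have "calkin_norm (X m - X (r ?n)) < e / 2" using N[OF m] k0 by (meson less_trans)
      moreover have "calkin_norm (X (r ?n) - x) < e / 2"
        using le[of ?n] n1[of ?n] by simp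
      moreover have "calkin_norm (X m - x) \<le> calkin_norm (X m - X (r ?n)) + calkin_norm (X (r ?n) - x)"
        using nrm(3)[of "X m - X (r ?n)" "X (r ?n) - x"] by simp
      ultimately show ?thesis using nrm(1)[of "X m - x"] by simp
    qed
    then show "\<exists>no. \<forall>n\<ge>no. norm (calkin_norm (X n - x) - 0) < e" by blast
  qed
  then show "\<exists>x. (\<lambda>n. calkin_norm (X n - x)) \<longlonglongrightarrow> 0" by blast
qed

section \<open>Countably subadditive seminorms\<close>

text \<open>
  Zabreiko's lemma. By Baire's theorem some set \<open>{x. p x \<le> n}\<close> is dense in a ball. By scaling, each
  \<open>y\<close> is approximated to any accuracy by vectors \<open>z\<close> with \<open>p z \<le> c * norm y\<close>. Repeated approximation of
  the remainder writes \<open>x\<close> as a series to which countable subadditivity applies.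
\<close>

lemma countably_subadditive_seminorm_bounded:
  fixes p :: "'x::banach \<Rightarrow> real"
  assumes nonneg: "\<And>x. 0 \<le> p x" and add: "\<And>x y. p (x + y) \<le> p x + p y"
    and scale: "\<And>r x. p (r *\<^sub>R x) = \<bar>r\<bar> * p x"
    and csub: "\<And>f. summable (\<lambda>n. norm (f n)) \<Longrightarrow> summable (\<lambda>n. p (f n)) \<Longrightarrow> p (\<Sum>n. f n) \<le> (\<Sum>n. p (f n))"
  obtains C where "\<And>x. p x \<le> C * norm x"
proof -
  define A where "A n = closure {x. p x \<le> real n}" for n
  have "\<exists>n. interior (A n) \<noteq> {}"
  proof (rule ccontr)
    assume neg: "\<not> ?thesis"
    have "euclidean interior_of \<Union> (range A) = {}"
    proof (rule Baire_category_alt)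
      show "completely_metrizable_space (euclidean :: 'x topology) \<or> locally_compact_space (euclidean :: 'x topology) \<and> regular_space (euclidean :: 'x topology)"
        by (simp add: completely_metrizable_space_euclidean)
      show "closedin euclidean T \<and> euclidean interior_of T = {}" if "T \<in> range A" for T
        using that neg by (auto simp: A_def)
    qed simp
    moreover have "\<Union> (range A) = UNIV"
    proof -
      have "x \<in> A (nat \<lceil>p x\<rceil>)" for x
        unfolding A_def by (rule subsetD[OF closure_subset]) (simp add: of_nat_ceiling)
      then show ?thesis by blast
    qed
    ultimately show False by simp
  qed
  then obtain n a where "a \<in> interior (A n)" by blast
  then obtain r where r: "r > 0" "ball a r \<subseteq> A n" by (meson mem_interior)
  define c where "c = 2 * (2 * real n + 1) / r"
  have c: "c > 0" using r by (simp add: c_def add_nonneg_pos)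
  have pm: "p (- x) = p x" for x using scale[of "- 1" x] by simp
  have p0: "p 0 = 0" using scale[of 0 0] by simp
  have small: "\<exists>z. p z \<le> 2 * real n + 1 \<and> norm (y - z) < d" if "norm y < r" "d > 0" for y d
  proof -
    have "a + y \<in> A n" "a \<in> A n" using r that(1) by (auto simp: dist_norm)
    then obtain u v where u: "p u \<le> real n" "dist u (a + y) < d / 2" and v: "p v \<le> real n" "dist v a < d / 2"
      unfolding A_def closure_approachable using \<open>d > 0\<close> by (metis half_gt_zero mem_Collect_eq)
    have "p (u - v) \<le> 2 * real n + 1" using add[of u "- v"] pm[of v] u v by simp
    moreover have "norm (y - (u - v)) < d"
    proof -
      have "y - (u - v) = (a + y - u) - (a - v)" by simp
      then have "norm (y - (u - v)) \<le> norm (a + y - u) + norm (a - v)" by (metis norm_triangle_ineq4)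
      then show ?thesis using u v by (simp add: dist_norm norm_minus_commute)
    qed
    ultimately show ?thesis by blast
  qed
  have approx: "\<exists>z. p z \<le> c * norm y \<and> norm (y - z) < d" if "d > 0" for y d
  proof (cases "y = 0")
    case True
    then show ?thesis using that p0 by (intro exI[of _ 0]) simp
  next
    case False
    define t where "t = r / (2 * norm y)"
    have t: "t > 0" using r False by (simp add: t_def)
    have "norm (t *\<^sub>R y) < r" using r False by (simp add: t_def)
    moreover have "t * d > 0" using t that by simp
    ultimately obtain z where z: "p z \<le> 2 * real n + 1" "norm (t *\<^sub>R y - z) < t * d" using small by blast
    have "p (inverse t *\<^sub>R z) \<le> inverse t * (2 * real n + 1)"
      using z t by (simp add: scale)
    also have "\<dots> = c * norm y" by (simp add: t_def c_def)
    finally have 1: "p (inverse t *\<^sub>R z) \<le> c * norm y" .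
    have "y - inverse t *\<^sub>R z = inverse t *\<^sub>R (t *\<^sub>R y - z)" using t by (simp add: scaleR_diff_right)
    then have "norm (y - inverse t *\<^sub>R z) = inverse t * norm (t *\<^sub>R y - z)" using t by simp
    also have "\<dots> < inverse t * (t * d)" using z t by (intro mult_strict_left_mono) auto
    also have "\<dots> = d" using t by simp
    finally show ?thesis using 1 by blast
  qed
  have "p x \<le> (2 * c) * norm x" for x
  proof (cases "x = 0")
    case False
    then have nx: "norm x > 0" by simp
    have "\<exists>z. p z \<le> c * norm y \<and> norm (y - z) < (1/2) ^ Suc k * norm x" for y k
      using nx by (intro approx) simp
    then obtain Z where Z: "\<And>y k. p (Z y k) \<le> c * norm y" "\<And>y k. norm (y - Z y k) < (1/2) ^ Suc k * norm x"
      by metis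
    define Y where "Y = rec_nat x (\<lambda>k y. y - Z y k)"
    have Y: "Y 0 = x" "Y (Suc k) = Y k - Z (Y k) k" for k by (simp_all add: Y_def)
    define f where "f k = Z (Y k) k" for k
    have Yn: "norm (Y k) \<le> (1/2) ^ k * norm x" for k
      using Z(2)[of "Y (k - 1)" "k - 1"] by (cases k) (simp_all add: Y less_imp_le)
    have fs: "(\<Sum>k<m. f k) = x - Y m" for m by (induction m) (simp_all add: Y f_def)
    have geo: "summable (\<lambda>k. (1/2::real) ^ k * norm x)" by (intro summable_mult2 summable_geometric) simp
    then have "Y \<longlonglongrightarrow> 0"
      using Yn by (intro Lim_null_comparison[OF _ summable_LIMSEQ_zero[OF geo]] always_eventually) auto
    then have "(\<lambda>m. \<Sum>k<m. f k) \<longlonglongrightarrow> x" unfolding fs by (auto intro: tendsto_eq_intros)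
    then have x: "x = (\<Sum>k. f k)" by (simp add: sums_unique sums_def)
    have pf: "p (f k) \<le> c * ((1/2) ^ k * norm x)" for k
      using Z(1)[of "Y k" k] mult_left_mono[OF Yn[of k], of c] c unfolding f_def by linarith
    have geo': "summable (\<lambda>k. c * ((1/2) ^ k * norm x))" by (intro summable_mult geo)
    have smp: "summable (\<lambda>k. p (f k))"
      by (rule summable_comparison_test'[OF geo', of 0]) (use pf nonneg in auto)
    have "norm (f k) \<le> 2 * ((1/2) ^ k * norm x)" for k
    proof -
      have "f k = Y k - Y (Suc k)" by (simp add: Y f_def)
      then have "norm (f k) \<le> norm (Y k) + norm (Y (Suc k))" by (metis norm_triangle_ineq4)
      moreover have "(1/2) ^ Suc k * norm x \<le> (1/2) ^ k * norm x" using nx by simp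
      ultimately show ?thesis using Yn[of k] Yn[of "Suc k"] by linarith
    qed
    then have "summable (\<lambda>k. norm (f k))"
      by (intro summable_comparison_test'[OF summable_mult[OF geo, of 2], of 0]) auto
    then have "p x \<le> (\<Sum>k. p (f k))" unfolding x using smp by (rule csub)
    also have "\<dots> \<le> (\<Sum>k. c * ((1/2) ^ k * norm x))" by (intro suminf_le pf smp geo')
    also have "\<dots> = c * ((\<Sum>k. (1/2) ^ k) * norm x)"
      by (simp add: suminf_mult suminf_mult2[symmetric] geo summable_geometric)
    also have "(\<Sum>k. (1/2::real) ^ k) = 2" by (simp add: suminf_geometric)
    finally show ?thesis by simp
  qed (simp add: p0)
  then show ?thesis using that by blast
qed

section \<open>Splitting the space of null sequences into infinitely many copies of itself\<close>

lemma klinear_eqI: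
  fixes U V :: "(nat, 'k::real_or_complex) c0 \<Rightarrow>\<^sub>L ('b::topological_space, 'k) c0"
  assumes "klinear U" "klinear V" "\<And>j. blinfun_apply U (unit_seq j) = blinfun_apply V (unit_seq j)"
  shows "U = V"
proof (rule blinfun_eqI)
  fix a :: "(nat, 'k) c0"
  have "(\<lambda>j. blinfun_apply W (c0_scale (c0_apply a j) (unit_seq j))) sums blinfun_apply W a"
    for W :: "(nat, 'k) c0 \<Rightarrow>\<^sub>L ('b, 'k) c0"
    by (rule bounded_linear.sums[OF blinfun.bounded_linear_right unit_seq_expansion])
  from this[of U] this[of V] show "blinfun_apply U a = blinfun_apply V a"
    using assms by (simp add: klinear_def sums_unique2)
qed

text \<open>
  \<open>J n\<close> embeds the space of null sequences as the \<open>n\<close>-th block of coordinates, and \<open>F n\<close> restricts a sequence to that block.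
\<close>

lemma block_operators:
  obtains J F :: "nat \<Rightarrow> (nat, 'k::real_or_complex) c0 \<Rightarrow>\<^sub>L (nat, 'k) c0"
  where "\<And>n. klinear (J n)" "\<And>n. klinear (F n)" "\<And>n. norm (J n) \<le> 1" "\<And>n. norm (F n) \<le> 1"
    "\<And>m n. F m o\<^sub>L J n = (if m = n then id_blinfun else 0)"
proof -
  have "\<exists>J. klinear J \<and> norm J \<le> 1 \<and> (\<forall>j. blinfun_apply J (unit_seq j) = (unit_seq (prod_encode (n, j)) :: (nat, 'k) c0))" for n
  proof (rule synthesis_operator[of "\<lambda>j. unit_seq (prod_encode (n, j)) :: (nat, 'k) c0" 1])
    fix J assume "klinear J" "norm J \<le> 1" "\<And>j. blinfun_apply J (unit_seq j) = (unit_seq (prod_encode (n, j)) :: (nat, 'k) c0)"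
    then show ?thesis by blast
  qed (auto simp: norm_unit_seq)
  then obtain J where J: "\<And>n. klinear (J n)" "\<And>n. norm (J n) \<le> 1"
    "\<And>n j. blinfun_apply (J n) (unit_seq j) = (unit_seq (prod_encode (n, j)) :: (nat, 'k) c0)" by metis
  have "\<exists>F. klinear F \<and> norm F \<le> 1 \<and> (\<forall>a k. c0_apply (blinfun_apply F a) k = c0_apply (a :: (nat, 'k) c0) (prod_encode (n, k)))" for n
  proof (rule analysis_operator[of "\<lambda>k a. c0_apply (a :: (nat, 'k) c0) (prod_encode (n, k))" 1])
    show "c0_functional (\<lambda>a :: (nat, 'k) c0. c0_apply a (prod_encode (n, k))) 1" for k by (rule c0_functional_eval)
    have "filterlim (\<lambda>k. prod_encode (n, k)) sequentially sequentially"
      by (rule filterlim_at_top_mono[OF filterlim_ident]) (simp add: le_prod_encode_2)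
    then show "(\<lambda>k. c0_apply (a :: (nat, 'k) c0) (prod_encode (n, k))) \<longlonglongrightarrow> 0" for a
      by (rule filterlim_compose[OF c0_nat_tendsto_0])
    fix F assume "klinear F" "norm F \<le> 1" "\<And>a k. c0_apply (blinfun_apply F a) k = c0_apply (a :: (nat, 'k) c0) (prod_encode (n, k))"
    then show ?thesis by blast
  qed
  then obtain F where F: "\<And>n. klinear (F n)" "\<And>n. norm (F n) \<le> 1"
    "\<And>n a k. c0_apply (blinfun_apply (F n) a) k = c0_apply (a :: (nat, 'k) c0) (prod_encode (n, k))" by metis
  have "F m o\<^sub>L J n = (if m = n then id_blinfun else 0)" for m n
  proof (rule klinear_eqI)
    show "klinear (F m o\<^sub>L J n)" by (intro klinear_ops F J)
    show "klinear (if m = n then id_blinfun else 0 :: (nat, 'k) c0 \<Rightarrow>\<^sub>L (nat, 'k) c0)"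
      by (simp add: klinear_def c0_scale_algebra)
    show "blinfun_apply (F m o\<^sub>L J n) (unit_seq j) = blinfun_apply (if m = n then id_blinfun else 0) (unit_seq j)" for j
      by (rule c0_eqI) (simp add: J F)
  qed
  then show ?thesis using that J F by blast
qed

lemma not_compact_map_id: "\<not> compact_map (id_blinfun :: (nat, 'k::real_or_complex) c0 \<Rightarrow>\<^sub>L (nat, 'k) c0)"
proof
  assume "compact_map (id_blinfun :: (nat, 'k) c0 \<Rightarrow>\<^sub>L (nat, 'k) c0)"
  then have "compact (cball 0 1 :: (nat, 'k) c0 set)" by (simp add: compact_map_def)
  moreover have "unit_seq j \<in> cball (0 :: (nat, 'k) c0) 1" for j by (simp add: norm_unit_seq)
  ultimately obtain l :: "(nat, 'k) c0" and r where r: "strict_mono r" "(unit_seq \<circ> r) \<longlonglongrightarrow> l"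
    unfolding compact_def by metis
  then have "Cauchy (\<lambda>n. unit_seq (r n) :: (nat, 'k) c0)" using LIMSEQ_imp_Cauchy by (auto simp: o_def)
  then obtain M where M: "\<And>m n. m \<ge> M \<Longrightarrow> n \<ge> M \<Longrightarrow> norm (unit_seq (r m) - unit_seq (r n) :: (nat, 'k) c0) < 1"
    unfolding Cauchy_def dist_norm by (metis zero_less_one)
  have "r M \<noteq> r (Suc M)" using r(1) by (simp add: strict_mono_eq)
  then have "norm (c0_apply (unit_seq (r M) - unit_seq (r (Suc M)) :: (nat, 'k) c0) (r M)) = 1" by simp
  then show False
    using M[of M "Suc M"] norm_c0_apply_le[of "unit_seq (r M) - unit_seq (r (Suc M)) :: (nat, 'k) c0" "r M"] by simp
qed

lemma compact_map_diff_compose: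
  assumes "compact_map (X - Y)"
  shows "compact_map ((U o\<^sub>L X o\<^sub>L V) - (U o\<^sub>L Y o\<^sub>L V))"
proof -
  have "(U o\<^sub>L X o\<^sub>L V) - (U o\<^sub>L Y o\<^sub>L V) = U o\<^sub>L (X - Y) o\<^sub>L V"
    by (rule blinfun_eqI) (simp add: blinfun.bilinear_simps)
  then show ?thesis using assms by (simp add: compact_map_compose_left compact_map_compose_right)
qed

lemma compact_map_diff_trans:
  assumes "compact_map (X - Y)" "compact_map (Y - Z)"
  shows "compact_map (X - Z)"
  using compact_map_add[OF assms] by simp

lemma klinear_suminf:
  fixes X :: "nat \<Rightarrow> ('a::topological_space, 'k::real_or_complex) c0 \<Rightarrow>\<^sub>L ('b::topological_space, 'k) c0"
  assumes "\<And>n. klinear (X n)" "summable X"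
  shows "klinear (suminf X)"
proof (rule klinear_limit)
  show "klinear (\<Sum>k<n. X k)" for n by (intro klinear_sum assms)
  show "(\<lambda>n. \<Sum>k<n. X k) \<longlonglongrightarrow> suminf X" by (rule summable_LIMSEQ[OF assms(2)])
qed

lemma summable_weighted:
  fixes X :: "nat \<Rightarrow> 'x::banach"
  assumes "\<And>n. norm (X n) \<le> C"
  shows "summable (\<lambda>n. (1/2) ^ n *\<^sub>R X n)"
proof (rule summable_norm_cancel, rule summable_comparison_test')
  show "summable (\<lambda>n. (1/2::real) ^ n * C)" by (intro summable_mult2 summable_geometric) simp
  show "norm (norm ((1/2) ^ n *\<^sub>R X n)) \<le> (1/2) ^ n * C" if "n \<ge> 0" for n
    using assms[of n] by (simp add: mult_left_mono)
qed

section \<open>Minimality of the essential norm\<close>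

context scattered_lc_space
begin

text \<open>
  In the notation of the proof, \<open>RR\<close> and \<open>SS\<close> are the operators glued from the \<open>R n\<close> and \<open>S n\<close>, with
  \<open>RR J n = 2\<^sup>-\<^sup>n R n\<close> and \<open>F n SS = 2\<^sup>-\<^sup>n S n\<close>. As \<open>B A\<close> and \<open>S n T n R n\<close> are the identity modulo compact
  operators, \<open>E n (A SS) T n (RR B) E n\<close> is \<open>4\<^sup>-\<^sup>n E n\<close> modulo compact operators.
\<close>

theorem essential_norm_minimal:
  fixes p :: "('a, 'k::real_or_complex) calkin \<Rightarrow> real"
  assumes p: "algebra_norm calkin_scale p"
  shows "\<exists>c>0. \<forall>T. c * essential_norm T \<le> p (to_calkin T)"
proof (rule ccontr)
  assume neg: "\<not> ?thesis"
  note pD = algebra_normD[OF p]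
  have small: "\<exists>T :: ('a, 'k) c0_op. 1 < essential_norm T \<and> p (to_calkin T) < c" if "c > 0" for c
  proof -
    have "c / 2 > 0" using that by simp
    with neg obtain T :: "('a, 'k) c0_op" where T: "p (to_calkin T) < c / 2 * essential_norm T"
      by (meson not_le)
    have pos: "essential_norm T > 0"
    proof (rule ccontr)
      assume "\<not> essential_norm T > 0"
      then have "essential_norm T = 0" using essential_norm_nonneg[of T] by simp
      then show False using T pD(1)[of "to_calkin T"] by simp
    qed
    define u :: 'k where "u = of_real (2 / essential_norm T)"
    have u: "norm u = 2 / essential_norm T" using pos unfolding u_def norm_of_real by simp
    have "essential_norm (c0_op_scale u T) = 2" using pos by (simp add: essential_norm_scale u)
    moreover have "p (to_calkin (c0_op_scale u T)) < c"
      using T pos by (simp add: to_calkin_ops pD(4) u field_simps)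
    ultimately show ?thesis by (intro exI[of _ "c0_op_scale u T"]) simp
  qed
  \<comment> \<open>The norm \<open>p\<close> as a function of operators, so that products can pass through the null sequences.\<close>
  define q where "q X = p (to_calkin (Abs_c0_op X))" for X :: "('a, 'k) c0 \<Rightarrow>\<^sub>L ('a, 'k) c0"
  have q_T: "q (c0_op_blinfun T) = p (to_calkin T)" for T by (simp add: q_def c0_op_blinfun_inverse)
  have q_eq: "q X = q Y" if "klinear X" "klinear Y" "compact_map (X - Y)" for X Y
  proof -
    have "compact_op (Abs_c0_op X - Abs_c0_op Y)"
      using that by (simp add: compact_op_iff minus_c0_op.rep_eq c0_op_blinfun_inverse_klinear)
    then show ?thesis by (simp add: q_def to_calkin_eq_iff[symmetric])
  qed
  have q_mult: "q (X o\<^sub>L Y) \<le> q X * q Y" if "klinear X" "klinear Y" for X Y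
  proof -
    have "Abs_c0_op (X o\<^sub>L Y) = Abs_c0_op X * Abs_c0_op Y"
      by (metis c0_op_blinfun_inverse c0_op_blinfun_inverse_klinear klinear_c0_op_blinfun that times_c0_op.rep_eq)
    then show ?thesis by (simp add: q_def to_calkin_ops pD(5))
  qed
  have q_scale: "q (r *\<^sub>R X) = \<bar>r\<bar> * q X" if "klinear X" for r X
  proof -
    have "Abs_c0_op (r *\<^sub>R X) = c0_op_scale (of_real r) (Abs_c0_op X)"
    proof (rule c0_op_eqI)
      show "c0_op_apply (Abs_c0_op (r *\<^sub>R X)) f = c0_op_apply (c0_op_scale (of_real r) (Abs_c0_op X)) f" for f
        using that by (simp add: c0_op_apply.rep_eq[of "Abs_c0_op _"] c0_op_blinfun_inverse_klinear klinear_ops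
            c0_scale_of_real blinfun.scaleR_left)
    qed
    then show ?thesis by (simp add: q_def to_calkin_ops pD(4))
  qed
  have q_pos: "q X > 0" if "klinear X" "\<not> compact_map X" for X
  proof -
    have "to_calkin (Abs_c0_op X) \<noteq> 0"
      using that by (simp add: to_calkin_eq_0_iff compact_op_iff c0_op_blinfun_inverse_klinear)
    then show ?thesis using pD(1,2) unfolding q_def by (metis less_le)
  qed
  have "\<exists>T R S. klinear R \<and> klinear S \<and> norm R \<le> 4 \<and> norm S \<le> 2 \<and>
      compact_map ((S o\<^sub>L c0_op_blinfun T o\<^sub>L R) - (id_blinfun :: (nat, 'k) c0 \<Rightarrow>\<^sub>L _)) \<and> p (to_calkin T) < c"
    if c: "c > 0" for c
  proof -
    obtain T where T: "1 < essential_norm T" "p (to_calkin T) < c" using small[OF c] by blast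
    show ?thesis by (rule identity_factors_modulo_compact[OF T(1)]) (use T(2) in blast)
  qed
  then have fact: "\<exists>T R S. klinear T \<and> klinear R \<and> klinear S \<and> norm R \<le> 4 \<and> norm S \<le> 2 \<and>
      compact_map ((S o\<^sub>L T o\<^sub>L R) - (id_blinfun :: (nat, 'k) c0 \<Rightarrow>\<^sub>L _)) \<and> q T < c" if "c > 0" for c
    using that q_T klinear_c0_op_blinfun by metis
  obtain T0 and A :: "(nat, 'k) c0 \<Rightarrow>\<^sub>L ('a, 'k) c0" and S0 :: "('a, 'k) c0 \<Rightarrow>\<^sub>L (nat, 'k) c0"
    where A: "klinear A" and S0: "klinear S0" and T0: "klinear T0"
      and AS0: "compact_map ((S0 o\<^sub>L T0 o\<^sub>L A) - id_blinfun)"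
    using fact[OF zero_less_one] by blast
  \<comment> \<open>One fixed factorization, with \<open>B A\<close> equal to the identity modulo compact operators.\<close>
  define B where "B = S0 o\<^sub>L T0"
  have B: "klinear B" unfolding B_def by (intro klinear_ops S0 T0)
  have BA: "compact_map ((B o\<^sub>L A) - id_blinfun)" using AS0 by (simp add: B_def)
  obtain J F :: "nat \<Rightarrow> (nat, 'k) c0 \<Rightarrow>\<^sub>L (nat, 'k) c0"
    where JF: "\<And>n. klinear (J n)" "\<And>n. klinear (F n)" "\<And>n. norm (J n) \<le> 1" "\<And>n. norm (F n) \<le> 1"
    "\<And>m n. F m o\<^sub>L J n = (if m = n then id_blinfun else 0)"
    by (rule block_operators) blast
  have FJ: "blinfun_apply (F m) (blinfun_apply (J n) a) = (if m = n then a else 0)" for m n a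
    using arg_cong[OF JF(5)[of m n], of "\<lambda>W. blinfun_apply W a"] by (simp split: if_splits)
  define E where "E n = A o\<^sub>L J n o\<^sub>L F n o\<^sub>L B" for n
  have E: "klinear (E n)" for n unfolding E_def by (intro klinear_ops A B JF)
  have "\<not> compact_map (E n)" for n
  proof
    assume c: "compact_map (E n)"
    \<comment> \<open>\<open>M\<close> is the identity modulo compact operators, but \<open>M M\<close> factors through \<open>E n\<close>.\<close>
    define M where "M = F n o\<^sub>L (B o\<^sub>L A) o\<^sub>L J n"
    have "compact_map (M - (F n o\<^sub>L id_blinfun o\<^sub>L J n))"
      unfolding M_def by (rule compact_map_diff_compose[OF BA])
    moreover have "F n o\<^sub>L id_blinfun o\<^sub>L J n = id_blinfun" by (rule blinfun_eqI) (simp add: FJ)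
    ultimately have M: "compact_map (M - id_blinfun)" by simp
    have "compact_map ((F n o\<^sub>L B) o\<^sub>L (E n) o\<^sub>L (A o\<^sub>L J n))"
      by (intro compact_map_compose_left compact_map_compose_right c)
    also have "(F n o\<^sub>L B) o\<^sub>L (E n) o\<^sub>L (A o\<^sub>L J n) = M o\<^sub>L M"
      by (rule blinfun_eqI) (simp add: E_def M_def)
    finally have MM: "compact_map (M o\<^sub>L M)" .
    have "compact_map (((M - id_blinfun) o\<^sub>L M) + (M - id_blinfun))"
      by (intro compact_map_add compact_map_compose_right M)
    also have "((M - id_blinfun) o\<^sub>L M) + (M - id_blinfun) = (M o\<^sub>L M) - id_blinfun"
      by (rule blinfun_eqI) (simp add: blinfun.bilinear_simps)
    finally have "compact_map ((- id_blinfun) o\<^sub>L ((M o\<^sub>L M) - id_blinfun))"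
      by (rule compact_map_compose_left)
    also have "(- id_blinfun) o\<^sub>L ((M o\<^sub>L M) - id_blinfun) = id_blinfun - (M o\<^sub>L M)"
      by (rule blinfun_eqI) (simp add: blinfun.bilinear_simps)
    finally have "compact_map ((id_blinfun :: (nat, 'k) c0 \<Rightarrow>\<^sub>L (nat, 'k) c0) - (M o\<^sub>L M))" .
    from compact_map_add[OF this MM] show False by (simp add: not_compact_map_id)
  qed
  then have qE: "q (E n) > 0" for n using q_pos E by blast
  \<comment> \<open>The operators \<open>E n\<close> are known before the \<open>T n\<close> are chosen, so \<open>q (T n)\<close> may depend on \<open>q (E n)\<close>.\<close>
  have "(1/4) ^ n / ((real n + 1) * q (E n)) > 0" for n using qE[of n] by (simp add: add_nonneg_pos)
  from fact[OF this] obtain T R S where TRS: "\<And>n. klinear (T n)" "\<And>n. klinear (R n)" "\<And>n. klinear (S n)"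
    "\<And>n. norm (R n) \<le> 4" "\<And>n. norm (S n) \<le> 2"
    "\<And>n. compact_map ((S n o\<^sub>L T n o\<^sub>L R n) - (id_blinfun :: (nat, 'k) c0 \<Rightarrow>\<^sub>L _))"
    and qT: "\<And>n. q (T n) < (1/4) ^ n / ((real n + 1) * q (E n))" by metis
  define RR where "RR = (\<Sum>n. (1/2) ^ n *\<^sub>R (R n o\<^sub>L F n))"
  define SS where "SS = (\<Sum>n. (1/2) ^ n *\<^sub>R (J n o\<^sub>L S n))"
  have "norm (R n o\<^sub>L F n) \<le> 4" for n
    using norm_blinfun_compose[of "R n" "F n"] mult_mono[OF TRS(4) JF(4), of n n] by simp
  then have smR: "summable (\<lambda>n. (1/2) ^ n *\<^sub>R (R n o\<^sub>L F n))" by (rule summable_weighted)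
  have "norm (J n o\<^sub>L S n) \<le> 2" for n
    using norm_blinfun_compose[of "J n" "S n"] mult_mono[OF JF(3) TRS(5), of n n] by simp
  then have smS: "summable (\<lambda>n. (1/2) ^ n *\<^sub>R (J n o\<^sub>L S n))" by (rule summable_weighted)
  have kR: "klinear RR" unfolding RR_def by (intro klinear_suminf smR klinear_ops TRS JF)
  have kS: "klinear SS" unfolding SS_def by (intro klinear_suminf smS klinear_ops TRS JF)
  have RJ: "RR o\<^sub>L J n = (1/2) ^ n *\<^sub>R R n" for n
  proof (rule blinfun_eqI)
    fix a
    have "blinfun_apply RR (blinfun_apply (J n) a) = (\<Sum>m. blinfun_apply ((1/2) ^ m *\<^sub>R (R m o\<^sub>L F m)) (blinfun_apply (J n) a))"
      unfolding RR_def by (rule bounded_linear.suminf[OF blinfun.bounded_linear_left smR])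
    also have "\<dots> = (\<Sum>m\<in>{n}. blinfun_apply ((1/2) ^ m *\<^sub>R (R m o\<^sub>L F m)) (blinfun_apply (J n) a))"
      by (rule suminf_finite) (auto simp: FJ blinfun.bilinear_simps)
    finally show "blinfun_apply (RR o\<^sub>L J n) a = blinfun_apply ((1/2) ^ n *\<^sub>R R n) a"
      by (simp add: FJ blinfun.bilinear_simps)
  qed
  have FS: "F n o\<^sub>L SS = (1/2) ^ n *\<^sub>R S n" for n
  proof (rule blinfun_eqI)
    fix a
    have "blinfun_apply SS a = (\<Sum>m. blinfun_apply ((1/2) ^ m *\<^sub>R (J m o\<^sub>L S m)) a)"
      unfolding SS_def by (rule bounded_linear.suminf[OF blinfun.bounded_linear_left smS])
    then have "blinfun_apply (F n) (blinfun_apply SS a) = (\<Sum>m. blinfun_apply (F n) (blinfun_apply ((1/2) ^ m *\<^sub>R (J m o\<^sub>L S m)) a))"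
      using bounded_linear.suminf[OF blinfun.bounded_linear_right bounded_linear.summable[OF blinfun.bounded_linear_left smS]]
      by simp
    also have "\<dots> = (\<Sum>m\<in>{n}. blinfun_apply (F n) (blinfun_apply ((1/2) ^ m *\<^sub>R (J m o\<^sub>L S m)) a))"
      by (rule suminf_finite) (auto simp: FJ blinfun.bilinear_simps)
    finally show "blinfun_apply (F n o\<^sub>L SS) a = blinfun_apply ((1/2) ^ n *\<^sub>R S n) a"
      by (simp add: FJ blinfun.bilinear_simps)
  qed
  define P where "P = q (A o\<^sub>L SS) * q (RR o\<^sub>L B)"
  have q0: "0 \<le> q X" for X by (simp add: q_def pD(1))
  have P0: "P \<ge> 0" by (simp add: P_def q0)
  have bound: "real n + 1 \<le> P" for n
  proof -
    let ?W = "SS o\<^sub>L T n o\<^sub>L RR"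
    let ?X = "E n o\<^sub>L (A o\<^sub>L SS) o\<^sub>L T n o\<^sub>L (RR o\<^sub>L B) o\<^sub>L E n"
    let ?I = "id_blinfun :: (nat, 'k) c0 \<Rightarrow>\<^sub>L (nat, 'k) c0"
    have 1: "compact_map (((A o\<^sub>L J n o\<^sub>L F n) o\<^sub>L (B o\<^sub>L A) o\<^sub>L (?W o\<^sub>L (B o\<^sub>L A) o\<^sub>L J n o\<^sub>L F n o\<^sub>L B))
        - ((A o\<^sub>L J n o\<^sub>L F n) o\<^sub>L ?I o\<^sub>L (?W o\<^sub>L (B o\<^sub>L A) o\<^sub>L J n o\<^sub>L F n o\<^sub>L B)))"
      by (rule compact_map_diff_compose[OF BA])
    have 2: "compact_map (((A o\<^sub>L J n o\<^sub>L F n o\<^sub>L ?W) o\<^sub>L (B o\<^sub>L A) o\<^sub>L (J n o\<^sub>L F n o\<^sub>L B))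
        - ((A o\<^sub>L J n o\<^sub>L F n o\<^sub>L ?W) o\<^sub>L ?I o\<^sub>L (J n o\<^sub>L F n o\<^sub>L B)))"
      by (rule compact_map_diff_compose[OF BA])
    have 3: "compact_map ((((1/4) ^ n *\<^sub>R (A o\<^sub>L J n)) o\<^sub>L (S n o\<^sub>L T n o\<^sub>L R n) o\<^sub>L (F n o\<^sub>L B))
        - (((1/4) ^ n *\<^sub>R (A o\<^sub>L J n)) o\<^sub>L ?I o\<^sub>L (F n o\<^sub>L B)))"
      by (rule compact_map_diff_compose[OF TRS(6)])
    have e1: "(A o\<^sub>L J n o\<^sub>L F n) o\<^sub>L (B o\<^sub>L A) o\<^sub>L (?W o\<^sub>L (B o\<^sub>L A) o\<^sub>L J n o\<^sub>L F n o\<^sub>L B) = ?X"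
      by (rule blinfun_eqI) (simp add: E_def)
    have e2: "(A o\<^sub>L J n o\<^sub>L F n) o\<^sub>L ?I o\<^sub>L (?W o\<^sub>L (B o\<^sub>L A) o\<^sub>L J n o\<^sub>L F n o\<^sub>L B)
        = (A o\<^sub>L J n o\<^sub>L F n o\<^sub>L ?W) o\<^sub>L (B o\<^sub>L A) o\<^sub>L (J n o\<^sub>L F n o\<^sub>L B)"
      by (rule blinfun_eqI) simp
    have FSa: "blinfun_apply (F n) (blinfun_apply SS a) = (1/2) ^ n *\<^sub>R blinfun_apply (S n) a" for a
      using arg_cong[OF FS[of n], of "\<lambda>W. blinfun_apply W a"] by (simp add: blinfun.bilinear_simps)
    have RJa: "blinfun_apply RR (blinfun_apply (J n) a) = (1/2) ^ n *\<^sub>R blinfun_apply (R n) a" for a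
      using arg_cong[OF RJ[of n], of "\<lambda>W. blinfun_apply W a"] by (simp add: blinfun.bilinear_simps)
    have pow: "(1/2) ^ n * (1/2) ^ n = (1/4 :: real) ^ n" by (simp flip: power_mult_distrib)
    have e3: "(A o\<^sub>L J n o\<^sub>L F n o\<^sub>L ?W) o\<^sub>L ?I o\<^sub>L (J n o\<^sub>L F n o\<^sub>L B)
        = ((1/4) ^ n *\<^sub>R (A o\<^sub>L J n)) o\<^sub>L (S n o\<^sub>L T n o\<^sub>L R n) o\<^sub>L (F n o\<^sub>L B)"
      by (rule blinfun_eqI) (simp add: FSa RJa blinfun.bilinear_simps pow[symmetric])
    have e4: "((1/4) ^ n *\<^sub>R (A o\<^sub>L J n)) o\<^sub>L ?I o\<^sub>L (F n o\<^sub>L B) = (1/4) ^ n *\<^sub>R E n"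
      by (rule blinfun_eqI) (simp add: E_def blinfun.bilinear_simps)
    have "compact_map (?X - (1/4) ^ n *\<^sub>R E n)"
      using compact_map_diff_trans[OF compact_map_diff_trans[OF 1[unfolded e1 e2] 2[unfolded e3]] 3[unfolded e4]] .
    then have "q ((1/4) ^ n *\<^sub>R E n) = q ?X"
      by (intro q_eq[symmetric] klinear_ops E A B TRS kR kS)
    also have "\<dots> \<le> q (E n o\<^sub>L (A o\<^sub>L SS) o\<^sub>L T n o\<^sub>L (RR o\<^sub>L B)) * q (E n)"
      by (intro q_mult klinear_ops E A B TRS kR kS)
    also have "\<dots> \<le> (q (E n o\<^sub>L (A o\<^sub>L SS) o\<^sub>L T n) * q (RR o\<^sub>L B)) * q (E n)"
      by (intro mult_right_mono q_mult q0 klinear_ops E A B TRS kR kS)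
    also have "\<dots> \<le> ((q (E n o\<^sub>L (A o\<^sub>L SS)) * q (T n)) * q (RR o\<^sub>L B)) * q (E n)"
      by (intro mult_right_mono q_mult q0 klinear_ops E A B TRS kR kS)
    also have "\<dots> \<le> (((q (E n) * q (A o\<^sub>L SS)) * q (T n)) * q (RR o\<^sub>L B)) * q (E n)"
      by (intro mult_right_mono q_mult q0 klinear_ops E A B TRS kR kS)
    also have "\<dots> = (P * (q (E n) * q (E n))) * q (T n)" by (simp add: P_def mult_ac)
    also have "\<dots> \<le> (P * (q (E n) * q (E n))) * ((1/4) ^ n / ((real n + 1) * q (E n)))"
      using qT[of n] P0 q0 by (intro mult_left_mono mult_nonneg_nonneg) auto
    also have "\<dots> = (1/4) ^ n * q (E n) * (P / (real n + 1))"
    proof -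
      have gen: "(P * (b * b)) * (t / (N * b)) = t * b * (P / N)" if "N > 0" "b > 0" for N b t :: real
        using that by (simp add: field_simps)
      show ?thesis by (rule gen) (use qE[of n] in auto)
    qed
    finally have "(1/4) ^ n * q (E n) * 1 \<le> (1/4) ^ n * q (E n) * (P / (real n + 1))"
      by (simp add: q_scale E)
    then have "1 \<le> P / (real n + 1)" using qE[of n] by (subst (asm) mult_le_cancel_left_pos) auto
    then show ?thesis by (simp add: le_divide_eq add_nonneg_pos)
  qed
  obtain n :: nat where "P < real n" using reals_Archimedean2 by blast
  with bound[of n] show False by simp
qed

text \<open>
  The lower bound is minimality. For the upper bound it suffices that \<open>p\<close> is countably subadditive
  on operators: by completeness of \<open>p\<close> a series with summable values of \<open>p\<close> converges in \<open>p\<close>, hence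
  in the essential norm by the lower bound, and the limit is the class of the sum of the series.
\<close>

lemma complete_algebra_norm_equivalent:
  fixes p :: "('a, 'k::real_or_complex) calkin \<Rightarrow> real"
  assumes p: "algebra_norm calkin_scale p" and cp: "complete_norm p"
  obtains c C where "c > 0" "C > 0" "\<And>x. c * calkin_norm x \<le> p x" "\<And>x. p x \<le> C * calkin_norm x"
proof -
  note pD = algebra_normD[OF p] and nD = algebra_normD[OF algebra_norm_calkin_norm]
  obtain c where c: "c > 0" "\<And>T. c * essential_norm T \<le> p (to_calkin T)"
    using essential_norm_minimal[OF p] by blast
  have c': "c * calkin_norm x \<le> p x" for x
    by (rule calkin_cases[of x]) (simp add: c)
  obtain C where C: "\<And>T. p (to_calkin T) \<le> C * norm T"
  proof (rule countably_subadditive_seminorm_bounded[of "\<lambda>T. p (to_calkin T)"])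
    show "0 \<le> p (to_calkin T)" for T by (rule pD(1))
    show "p (to_calkin (S + T)) \<le> p (to_calkin S) + p (to_calkin T)" for S T
      by (simp add: to_calkin_ops pD(3))
    show "p (to_calkin (r *\<^sub>R T)) = \<bar>r\<bar> * p (to_calkin T)" for r T
    proof -
      have "r *\<^sub>R T = c0_op_scale (of_real r) T" by (rule c0_op_eqI) (simp add: c0_scale_of_real)
      then show ?thesis by (simp add: to_calkin_ops pD(4))
    qed
    fix f :: "nat \<Rightarrow> ('a, 'k) c0_op"
    assume f: "summable (\<lambda>n. norm (f n))" "summable (\<lambda>n. p (to_calkin (f n)))"
    have sm: "summable f" using f(1) by (rule summable_norm_cancel)
    define s where "s n = to_calkin (\<Sum>k<n. f k)" for n
    have diff: "p (s n - s m) \<le> (\<Sum>k\<in>{m..<n}. p (to_calkin (f k)))" if "m \<le> n" for m n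
      using that
    proof (induction n rule: dec_induct)
      case base
      then show ?case using pD(2)[of 0] by simp
    next
      case (step n)
      have "s (Suc n) - s m = (s n - s m) + to_calkin (f n)" by (simp add: s_def to_calkin_ops)
      then have "p (s (Suc n) - s m) \<le> p (s n - s m) + p (to_calkin (f n))"
        by (simp only: pD(3))
      then show ?case using step by simp
    qed
    have "\<exists>N. \<forall>m\<ge>N. \<forall>n\<ge>N. p (s m - s n) < e" if e: "e > 0" for e
    proof -
      obtain N where N: "\<And>m n. m \<ge> N \<Longrightarrow> norm (\<Sum>k\<in>{m..<n}. p (to_calkin (f k))) < e"
        using f(2) e unfolding summable_Cauchy by blast
      have le: "p (s n - s m) < e" if "m \<ge> N" "m \<le> n" for m n
        using N[OF that(1), of n] diff[OF that(2)] by simp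
      have "p (s m - s n) < e" if "m \<ge> N" "n \<ge> N" for m n
        using le[of m n] le[of n m] that calkin_algebra_norm_minus[OF p, of "s m" "s n"] by (cases "m \<le> n") auto
      then show ?thesis by blast
    qed
    then obtain x where x: "(\<lambda>n. p (s n - x)) \<longlonglongrightarrow> 0" using cp unfolding complete_norm_def by meson
    have "x = to_calkin (suminf f)"
    proof -
      have "calkin_norm (x - to_calkin (suminf f)) \<le> p (s n - x) / c + norm ((\<Sum>k<n. f k) - suminf f)" for n
      proof -
        have "calkin_norm (x - to_calkin (suminf f)) \<le> calkin_norm (x - s n) + calkin_norm (s n - to_calkin (suminf f))"
          using nD(3)[of "x - s n" "s n - to_calkin (suminf f)"] by simp
        moreover have "calkin_norm (x - s n) \<le> p (s n - x) / c"
          using c'[of "x - s n"] c(1) calkin_algebra_norm_minus[OF p, of x "s n"] by (simp add: field_simps)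
        moreover have "calkin_norm (s n - to_calkin (suminf f)) \<le> norm ((\<Sum>k<n. f k) - suminf f)"
          using essential_norm_le[of 0 "(\<Sum>k<n. f k) - suminf f"] by (simp add: s_def flip: to_calkin_ops(2))
        ultimately show ?thesis by linarith
      qed
      moreover have "(\<lambda>n. p (s n - x) / c + norm ((\<Sum>k<n. f k) - suminf f)) \<longlonglongrightarrow> 0 / c + 0"
        using summable_LIMSEQ[OF sm] by (intro tendsto_intros x) (use c in \<open>auto simp: LIM_zero tendsto_norm_zero\<close>)
      ultimately have "calkin_norm (x - to_calkin (suminf f)) \<le> 0 / c + 0"
        by (intro LIMSEQ_le_const) auto
      then have "x - to_calkin (suminf f) = 0" using nD(1,2) by (metis add_0 div_0 order_antisym)
      then show ?thesis by simp
    qed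
    moreover have "p x \<le> (\<Sum>n. p (to_calkin (f n)))"
    proof (rule LIMSEQ_le_const)
      show "(\<lambda>n. (\<Sum>k<n. p (to_calkin (f k))) + p (s n - x)) \<longlonglongrightarrow> (\<Sum>n. p (to_calkin (f n)))"
        using tendsto_add[OF summable_LIMSEQ[OF f(2)] x] by simp
      have "p x \<le> (\<Sum>k<n. p (to_calkin (f k))) + p (s n - x)" for n
      proof -
        have "s 0 = 0" by (simp add: s_def to_calkin_ops)
        then have "p (s n) \<le> (\<Sum>k<n. p (to_calkin (f k)))" using diff[of 0 n] by (simp add: atLeast0LessThan)
        moreover have "p x \<le> p (s n) + p (x - s n)" using pD(3)[of "s n" "x - s n"] by simp
        ultimately show ?thesis using calkin_algebra_norm_minus[OF p, of x "s n"] by simp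
      qed
      then show "\<exists>N. \<forall>n\<ge>N. p x \<le> (\<Sum>k<n. p (to_calkin (f k))) + p (s n - x)" by blast
    qed
    ultimately show "p (to_calkin (\<Sum>n. f n)) \<le> (\<Sum>n. p (to_calkin (f n)))" by simp
  next
    fix C assume "\<And>T. p (to_calkin T) \<le> C * norm T"
    then show ?thesis by (rule that)
  qed
  have "p x \<le> (\<bar>C\<bar> + 1) * calkin_norm x" for x
  proof (rule calkin_cases[of x])
    fix T assume x: "x = to_calkin T"
    have "p (to_calkin T) \<le> (\<bar>C\<bar> + 1) * essential_norm T"
    proof (rule field_le_epsilon)
      fix e :: real assume "e > 0"
      then have "e / (\<bar>C\<bar> + 1) > 0" by (simp add: add_nonneg_pos)
      then obtain S where S: "compact_op S" "norm (T - S) < essential_norm T + e / (\<bar>C\<bar> + 1)"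
        using essential_norm_approx by blast
      have "to_calkin T = to_calkin (T - S)" using S by (simp add: to_calkin_eq_iff)
      then have "p (to_calkin T) \<le> C * norm (T - S)" using C by metis
      also have "\<dots> \<le> (\<bar>C\<bar> + 1) * norm (T - S)" by (intro mult_right_mono) auto
      also have "\<dots> \<le> (\<bar>C\<bar> + 1) * (essential_norm T + e / (\<bar>C\<bar> + 1))"
        using S by (intro mult_left_mono) auto
      also have "\<dots> = (\<bar>C\<bar> + 1) * essential_norm T + e" by (simp add: distrib_left)
      finally show "p (to_calkin T) \<le> (\<bar>C\<bar> + 1) * essential_norm T + e" .
    qed
    then show ?thesis by (simp add: x)
  qed
  then show ?thesis using that[of c "\<bar>C\<bar> + 1"] c(1) c' by (simp add: add_nonneg_pos)
qed

end

section \<open>Uniqueness of the complete algebra norm\<close>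

theorem theorem1p1:
  assumes "locally_compact_space (euclidean :: 'a::t2_space topology)"
    and "scattered (UNIV :: 'a set)"
  shows "algebra_norm calkin_scale (calkin_norm :: ('a, 'k::real_or_complex) calkin \<Rightarrow> real) \<and>
    (\<forall>p :: ('a, 'k) calkin \<Rightarrow> real. algebra_norm calkin_scale p \<longrightarrow>
       (\<exists>c>0. \<forall>T. c * essential_norm T \<le> p (to_calkin T))) \<and>
    (\<exists>p :: ('a, 'k) calkin \<Rightarrow> real. algebra_norm calkin_scale p \<and> complete_norm p) \<and>
    (\<forall>p q :: ('a, 'k) calkin \<Rightarrow> real.
       algebra_norm calkin_scale p \<and> complete_norm p \<and>
       algebra_norm calkin_scale q \<and> complete_norm q \<longrightarrow> equivalent_norms p q)"
proof -
  interpret scattered_lc_space "TYPE('a)"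
    using assms by unfold_locales
  have "equivalent_norms p q"
    if pq: "algebra_norm calkin_scale p" "complete_norm p" "algebra_norm calkin_scale q" "complete_norm q"
    for p q :: "('a, 'k) calkin \<Rightarrow> real"
  proof -
    obtain c C where p: "c > 0" "C > 0" "\<And>x. c * calkin_norm x \<le> p x" "\<And>x. p x \<le> C * calkin_norm x"
      using complete_algebra_norm_equivalent[OF pq(1,2)] by blast
    obtain d D where q: "d > 0" "D > 0" "\<And>x. d * calkin_norm x \<le> q x" "\<And>x. q x \<le> D * calkin_norm x"
      using complete_algebra_norm_equivalent[OF pq(3,4)] by blast
    have "d / C * p x \<le> q x" for x
    proof -
      have "d / C * p x \<le> d / C * (C * calkin_norm x)" using p q by (intro mult_left_mono) auto
      also have "\<dots> = d * calkin_norm x" using p by simp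
      finally show ?thesis using q(3)[of x] by simp
    qed
    moreover have "q x \<le> D / c * p x" for x
    proof -
      have "q x \<le> D / c * (c * calkin_norm x)" using p q by simp
      also have "\<dots> \<le> D / c * p x" using p q by (intro mult_left_mono) auto
      finally show ?thesis .
    qed
    moreover have "d / C > 0" "D / c > 0" using p q by simp_all
    ultimately show ?thesis unfolding equivalent_norms_def by blast
  qed
  then show ?thesis
    using algebra_norm_calkin_norm complete_norm_calkin_norm essential_norm_minimal by blast
qed

end
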